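(* Let $\mathcal{Q}=\langle X\mid \mathcal{S}\rangle$ be a semigroup presentation and $w\in X^+$. To each $x\in X$ assign a diagram group $G_x=\mathcal{D}(\mathcal{P}_x,w_x)$, where $\mathcal{P}_x=\langle \Sigma_x\mid \mathcal{R}_x\rangle$ is a semigroup presentation and $w_x\in\Sigma_x^+$. Let $A=\{a_x\mid x\in X\}$ be an alphabet (with one letter $a_x$ for each $x\in X$), and assume that the alphabets $X$, $A$, $\Sigma_x$ $(x\in X)$ are pairwise disjoint. Put $$\Sigma=\bigcup_{x\in X}\Sigma_x,\qquad \mathcal{R}=\bigcup_{x\in X}\mathcal{R}_x,\qquad \mathcal{W}=\bigcup_{x\in X}\{x=a_xw_xa_x\},$$ and consider the semigroup presentation $$\mathcal{P}=\langle X\cup\Sigma\cup A\mid \mathcal{S}\cup\mathcal{R}\cup\mathcal{W}\rangle .$$ Then the diagram group $\mathcal{D}(\mathcal{P},w)$ is isomorphic to the diagram product $\mathcal{D}(G_X;\mathcal{S},w)$ of the family of groups $G_X=\{G_x\ (x\in X)\}$ over the presentation $\mathcal{Q}=\langle X\mid\mathcal{S}\rangle$ with base $w$. In particular, the diagram product of any family of diagram groups over a semigroup presentation is a diagram group.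
   Context: Diagram groups. A semigroup presentation $\mathcal{P}=\langle\Sigma\mid\mathcal{R}\rangle$ consists of an alphabet $\Sigma$ and a set $\mathcal{R}$ of pairs $(u,v)$ of non-empty words over $\Sigma$, written $u=v$; presentations are assumed anti-symmetric: if $(u=v)\in\mathcal{R}$ then $(v=u)\notin\mathcal{R}$ (in particular no relation $u=u$ belongs to $\mathcal{R}$). $\Sigma^+$ and $\Sigma^*$ are the free semigroup and free monoid on $\Sigma$. The graph $\Gamma(\mathcal{P})$ has vertex set $\Sigma^+$ and an edge $(p,u\to v,q)$ from $puq$ to $pvq$ for all $p,q\in\Sigma^*$ and all $u,v$ with $(u=v)\in\mathcal{R}$ or $(v=u)\in\mathcal{R}$; the inverse edge is $(p,v\to u,q)$. The edge is positive if $(u=v)\in\mathcal{R}$. The Squier complex $\mathcal{K}(\mathcal{P})$ is the 2-complex obtained from $\Gamma(\mathcal{P})$ by attaching, for all $p,z,q\in\Sigma^*$ and $(\ell_1=r_1),(\ell_2=r_2)\in\mathcal{R}$, a 2-cell along the closed path $p_1p_2^{-1}$, where $p_1=(p,\ell_1\to r_1,z\ell_2q)(pr_1z,\ell_2\to r_2,q)$ and $p_2=(p\ell_1z,\ell_2\to r_2,q)(p,\ell_1\to r_1,zr_2q)$. For $w\in\Sigma^+$ the diagram group $\mathcal{D}(\mathcal{P},w)$ is (up to isomorphism, by Kilibarda's theorem; this may be taken as the definition) the fundamental group $\pi_1(\mathcal{K}(\mathcal{P}),w)$. A group is a diagram group if it is isomorphic to some $\mathcal{D}(\mathcal{P},w)$.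 2-complexes of groups and their fundamental groups. Let $\mathcal{K}$ be a 2-complex whose 1-skeleton is an oriented graph with vertex set $V$ and set of positive edges $E^+$; $\iota(e),\tau(e)$ denote the initial and terminal vertices of $e$. A 2-complex of groups structure assigns a group $G_v$ to each $v\in V$, a group $G_e$ to each $e\in E^+$, and embeddings $\iota_e:G_e\to G_{\iota(e)}$, $\tau_e:G_e\to G_{\tau(e)}$. Its fundamental group with basepoint $v_0$ is the ordinary fundamental group, based at $v_0$, of the 2-complex obtained from $\mathcal{K}$ by adding: for each $v\in V$ and $g\in G_v$ a loop $g_v$ at $v$; for all $v\in V$, $g,h\in G_v$ a 2-cell with boundary path $g_vh_v(gh)_v^{-1}$; and for all $e\in E^+$, $a\in G_e$ a 2-cell with boundary path $e^{-1}g_{\iota(e)}e\,h_{\tau(e)}^{-1}$, where $g=\iota_e(a)$, $h=\tau_e(a)$. Diagram product. Let $H_X=\{H_x\ (x\in X)\}$ be a family of groups, $\mathcal{Q}=\langle X\mid\mathcal{S}\rangle$ a semigroup presentation, $w\in X^+$. For a word $u=x_1x_2\cdots x_n$ ($x_i\in X$) put $H_u=H_{x_1}\times\cdots\times H_{x_n}$, and $H_u=1$ if $u$ is empty. On the 1-skeleton of the Squier complex $\mathcal{K}(\mathcal{Q})$ assign to a vertex $u$ the group $G_u=H_u$, and to a positive edge $e=(u,s\to t,v)$, $u,v\in X^*$, $(s=t)\in\mathcal{S}$, the group $G_e=H_u\times H_v$ with the natural embeddings $\iota_e:H_u\times H_v\to H_{usv}=H_u\times H_s\times H_v$ and $\tau_e:H_u\times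 H_v\to H_{utv}=H_u\times H_t\times H_v$. The fundamental group with basepoint $w$ of the resulting 2-complex of groups is the diagram product $\mathcal{D}(H_X;\mathcal{S},w)$ of the family $H_X$ over $\mathcal{Q}$ with base $w$. *)

theory Defs
  imports "HOL-Algebra.Algebra" "HOL-Library.Disjoint_Sets"
begin

section \<open>Combinatorial 2-complexes and their fundamental groups\<close>

text \<open>
  Only the positive edges of the 1-skeleton are recorded.  An edge in the sense of paths is a pair
  \<open>(e, s)\<close> where \<open>s\<close> is true for the positive edge \<open>e\<close> itself and false for its formal inverse.
  A 2-cell is given by its boundary path.
\<close>

record ('v, 'e) complex2 =
  verts :: "'v set"
  edges :: "'e set"
  initial :: "'e \<Rightarrow> 'v"
  terminal :: "'e \<Rightarrow> 'v"
  cells :: "('e \<times> bool) list set"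

definition edge_inv :: "'e \<times> bool \<Rightarrow> 'e \<times> bool" where
  "edge_inv e = (fst e, \<not> snd e)"

definition path_inv :: "('e \<times> bool) list \<Rightarrow> ('e \<times> bool) list" where
  "path_inv p = rev (map edge_inv p)"

definition src :: "('v, 'e) complex2 \<Rightarrow> 'e \<times> bool \<Rightarrow> 'v" where
  "src K e = (if snd e then initial K (fst e) else terminal K (fst e))"

definition tgt :: "('v, 'e) complex2 \<Rightarrow> 'e \<times> bool \<Rightarrow> 'v" where
  "tgt K e = (if snd e then terminal K (fst e) else initial K (fst e))"

fun is_path :: "('v, 'e) complex2 \<Rightarrow> 'v \<Rightarrow> ('e \<times> bool) list \<Rightarrow> 'v \<Rightarrow> bool" where
  "is_path K u [] v \<longleftrightarrow> u \<in> verts K \<and> u = v"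
| "is_path K u (e # p) v \<longleftrightarrow> fst e \<in> edges K \<and> src K e = u \<and> u \<in> verts K \<and> is_path K (tgt K e) p v"

definition is_complex2 :: "('v, 'e) complex2 \<Rightarrow> bool" where
  "is_complex2 K \<longleftrightarrow>
     (\<forall>e\<in>edges K. initial K e \<in> verts K \<and> terminal K e \<in> verts K) \<and>
     (\<forall>c\<in>cells K. c \<noteq> [] \<and> (\<exists>v. is_path K v c v))"

text \<open>
  Homotopy of paths from \<open>u\<close> to \<open>v\<close>.  Cyclic shifts and inverses of the boundary paths in
  \<open>cells K\<close> become null-homotopic as well, so it does not matter at which vertex and in which
  direction a boundary path is read.
\<close>

inductive homotopic ::
  "('v, 'e) complex2 \<Rightarrow> 'v \<Rightarrow> 'v \<Rightarrow> ('e \<times> bool) list \<Rightarrow> ('e \<times> bool) list \<Rightarrow> bool"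
  for K u v where
  homotopic_refl: "is_path K u p v \<Longrightarrow> homotopic K u v p p"
| homotopic_sym: "homotopic K u v p q \<Longrightarrow> homotopic K u v q p"
| homotopic_trans: "homotopic K u v p q \<Longrightarrow> homotopic K u v q r \<Longrightarrow> homotopic K u v p r"
| homotopic_cancel:
    "is_path K u (p @ [e, edge_inv e] @ q) v \<Longrightarrow>
     homotopic K u v (p @ [e, edge_inv e] @ q) (p @ q)"
| homotopic_cell:
    "is_path K u (p @ c @ q) v \<Longrightarrow> c \<in> cells K \<Longrightarrow> homotopic K u v (p @ c @ q) (p @ q)"

definition loop_class ::
  "('v, 'e) complex2 \<Rightarrow> 'v \<Rightarrow> ('e \<times> bool) list \<Rightarrow> ('e \<times> bool) list set" where
  "loop_class K v p = {q. homotopic K v v p q}"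

definition fundamental_group ::
  "('v, 'e) complex2 \<Rightarrow> 'v \<Rightarrow> ('e \<times> bool) list set monoid" where
  "fundamental_group K v =
     \<lparr>carrier = loop_class K v ` {p. is_path K v p v},
      monoid.mult = (\<lambda>A B. \<Union>p\<in>A. \<Union>q\<in>B. loop_class K v (p @ q)),
      one = loop_class K v []\<rparr>"

section \<open>Semigroup presentations, Squier complexes and diagram groups\<close>

record 'a presentation =
  alphabet :: "'a set"
  relations :: "('a list \<times> 'a list) set"

definition words :: "'a presentation \<Rightarrow> 'a list set" where
  "words P = lists (alphabet P)"

definition nonempty_words :: "'a presentation \<Rightarrow> 'a list set" where
  "nonempty_words P = words P - {[]}"

definition semigroup_presentation :: "'a presentation \<Rightarrow> bool" where
  "semigroup_presentation P \<longleftrightarrow>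
     relations P \<subseteq> nonempty_words P \<times> nonempty_words P \<and>
     (\<forall>u v. (u, v) \<in> relations P \<longrightarrow> (v, u) \<notin> relations P)"

text \<open>
  The triple \<open>(p, (u, v), q)\<close> with \<open>(u, v) \<in> relations P\<close> is the positive edge
  \<open>(p, u \<rightarrow> v, q)\<close> from \<open>puq\<close> to \<open>pvq\<close>.
\<close>

type_synonym 'a squier_edge = "'a list \<times> ('a list \<times> 'a list) \<times> 'a list"

definition squier_complex :: "'a presentation \<Rightarrow> ('a list, 'a squier_edge) complex2" where
  "squier_complex P =
     \<lparr>verts = nonempty_words P,
      edges = words P \<times> relations P \<times> words P,
      initial = (\<lambda>(p, (u, v), q). p @ u @ q),
      terminal = (\<lambda>(p, (u, v), q). p @ v @ q),
      cells =
        {[((p, (l1, r1), z @ l2 @ q), True), ((p @ r1 @ z, (l2, r2), q), True)] @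
         path_inv [((p @ l1 @ z, (l2, r2), q), True), ((p, (l1, r1), z @ r2 @ q), True)]
         | p z q l1 r1 l2 r2.
             p \<in> words P \<and> z \<in> words P \<and> q \<in> words P \<and>
             (l1, r1) \<in> relations P \<and> (l2, r2) \<in> relations P}\<rparr>"

definition diagram_group ::
  "'a presentation \<Rightarrow> 'a list \<Rightarrow> ('a squier_edge \<times> bool) list set monoid" where
  "diagram_group P w = fundamental_group (squier_complex P) w"

text \<open>
  The first argument only records the type of letters from which the alphabets may be taken; it is
  needed because HOL has no quantification over types.
\<close>

definition is_diagram_group :: "'a itself \<Rightarrow> ('g, 'm) monoid_scheme \<Rightarrow> bool" where
  "is_diagram_group T G \<longleftrightarrow>
     group G \<and>
     (\<exists>(P :: 'a presentation) w.
        semigroup_presentation P \<and> w \<in> nonempty_words P \<and> G \<cong> diagram_group P w)"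

section \<open>2-complexes of groups and diagram products\<close>

record ('v, 'e, 'g, 'h) complex_of_groups =
  underlying :: "('v, 'e) complex2"
  vertex_group :: "'v \<Rightarrow> 'g monoid"
  edge_group :: "'e \<Rightarrow> 'h monoid"
  initial_emb :: "'e \<Rightarrow> 'h \<Rightarrow> 'g"
  terminal_emb :: "'e \<Rightarrow> 'h \<Rightarrow> 'g"

definition is_complex_of_groups :: "('v, 'e, 'g, 'h) complex_of_groups \<Rightarrow> bool" where
  "is_complex_of_groups C \<longleftrightarrow>
     is_complex2 (underlying C) \<and>
     (\<forall>v\<in>verts (underlying C). group (vertex_group C v)) \<and>
     (\<forall>e\<in>edges (underlying C).
        group (edge_group C e) \<and>
        initial_emb C e \<in> mon (edge_group C e) (vertex_group C (initial (underlying C) e)) \<and>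
        terminal_emb C e \<in> mon (edge_group C e) (vertex_group C (terminal (underlying C) e)))"

text \<open>
  The 2-complex whose ordinary fundamental group is the fundamental group of a 2-complex of groups:
  \<open>Inl e\<close> is an edge of the underlying complex, \<open>Inr (v, g)\<close> is the loop \<open>g\<^sub>v\<close>.
\<close>

definition total_complex ::
  "('v, 'e, 'g, 'h) complex_of_groups \<Rightarrow> ('v, 'e + 'v \<times> 'g) complex2" where
  "total_complex C =
     (let K = underlying C in
     \<lparr>verts = verts K,
      edges = Inl ` edges K \<union> Inr ` (SIGMA v:verts K. carrier (vertex_group C v)),
      initial = case_sum (initial K) fst,
      terminal = case_sum (terminal K) fst,
      cells =
        map (map_prod Inl id) ` cells K \<union>
        {[(Inr (v, g), True), (Inr (v, h), True), (Inr (v, g \<otimes>\<^bsub>vertex_group C v\<^esub> h), False)]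
         | v g h. v \<in> verts K \<and> g \<in> carrier (vertex_group C v) \<and> h \<in> carrier (vertex_group C v)} \<union>
        {[(Inl e, False), (Inr (initial K e, initial_emb C e a), True),
          (Inl e, True), (Inr (terminal K e, terminal_emb C e a), False)]
         | e a. e \<in> edges K \<and> a \<in> carrier (edge_group C e)}\<rparr>)"

definition complex_of_groups_pi1 ::
  "('v, 'e, 'g, 'h) complex_of_groups \<Rightarrow> 'v \<Rightarrow> (('e + 'v \<times> 'g) \<times> bool) list set monoid" where
  "complex_of_groups_pi1 C v = fundamental_group (total_complex C) v"

definition word_group :: "('a \<Rightarrow> 'g monoid) \<Rightarrow> 'a list \<Rightarrow> 'g list monoid" where
  "word_group H u = DirProd_list (map H u)"

definition diagram_product_complex ::
  "('a \<Rightarrow> 'g monoid) \<Rightarrow> 'a presentation \<Rightarrow>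
   ('a list, 'a squier_edge, 'g list, 'g list \<times> 'g list) complex_of_groups" where
  "diagram_product_complex H Q =
     \<lparr>underlying = squier_complex Q,
      vertex_group = word_group H,
      edge_group = (\<lambda>(u, (s, t), v). word_group H u \<times>\<times> word_group H v),
      initial_emb = (\<lambda>(u, (s, t), v) (a, b). a @ \<one>\<^bsub>word_group H s\<^esub> @ b),
      terminal_emb = (\<lambda>(u, (s, t), v) (a, b). a @ \<one>\<^bsub>word_group H t\<^esub> @ b)\<rparr>"

definition diagram_product ::
  "('a \<Rightarrow> 'g monoid) \<Rightarrow> 'a presentation \<Rightarrow> 'a list \<Rightarrow>
   (('a squier_edge + 'a list \<times> 'g list) \<times> bool) list set monoid" where
  "diagram_product H Q w = complex_of_groups_pi1 (diagram_product_complex H Q) w"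

section \<open>The composite presentation\<close>

definition composite_presentation ::
  "'a presentation \<Rightarrow> ('a \<Rightarrow> 'a presentation) \<Rightarrow> ('a \<Rightarrow> 'a list) \<Rightarrow> ('a \<Rightarrow> 'a) \<Rightarrow> 'a presentation" where
  "composite_presentation Q P wx a =
     \<lparr>alphabet = alphabet Q \<union> (\<Union>x\<in>alphabet Q. alphabet (P x)) \<union> a ` alphabet Q,
      relations = relations Q \<union> (\<Union>x\<in>alphabet Q. relations (P x)) \<union>
        (\<lambda>x. ([x], [a x] @ wx x @ [a x])) ` alphabet Q\<rparr>"

section \<open>Well-formedness of the constructions\<close>

lemma is_path_append:
  "is_path K u (p @ q) v \<longleftrightarrow> (\<exists>m. is_path K u p m \<and> is_path K m q v)" if "is_complex2 K"
proof (induction p arbitrary: u)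
  case Nil
  have "is_path K u q v \<Longrightarrow> u \<in> verts K" by (cases q) auto
  then show ?case by auto
next
  case (Cons e p) then show ?case by auto
qed

lemma is_complex2_squier_complex: assumes "semigroup_presentation P" shows "is_complex2 (squier_complex P)"
  unfolding is_complex2_def
proof (intro conjI ballI)
  fix c assume "c \<in> cells (squier_complex P)"
  then obtain p z q l1 r1 l2 r2 where c: "c = [((p, (l1, r1), z @ l2 @ q), True), ((p @ r1 @ z, (l2, r2), q), True)] @
         path_inv [((p @ l1 @ z, (l2, r2), q), True), ((p, (l1, r1), z @ r2 @ q), True)]"
   and *: "p \<in> words P" "z \<in> words P" "q \<in> words P"
             "(l1, r1) \<in> relations P" "(l2, r2) \<in> relations P"
    unfolding squier_complex_def by auto
  have "l1 \<in> words P" "r1 \<in> words P" "l2 \<in> words P" "r2 \<in> words P" "l1 \<noteq> []" "r1 \<noteq> []" "l2 \<noteq> []" "r2 \<noteq> []"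
    using assms * unfolding semigroup_presentation_def nonempty_words_def by blast+
  then have "is_path (squier_complex P) (p @ l1 @ z @ l2 @ q) c (p @ l1 @ z @ l2 @ q)"
    using * unfolding c by (auto simp: path_inv_def edge_inv_def squier_complex_def src_def tgt_def words_def nonempty_words_def)
  then show "\<exists>v. is_path (squier_complex P) v c v" by blast
  show "c \<noteq> []" using c by simp
qed (use assms in \<open>(fastforce simp: squier_complex_def semigroup_presentation_def nonempty_words_def words_def)+\<close>)

lemma DirProd_list_mult_Cons:
  assumes "g \<in> carrier G" "h \<in> carrier G" "gs \<in> carrier (DirProd_list Gs)" "hs \<in> carrier (DirProd_list Gs)"
  shows "(g # gs) \<otimes>\<^bsub>DirProd_list (G # Gs)\<^esub> (h # hs) = (g \<otimes>\<^bsub>G\<^esub> h) # (gs \<otimes>\<^bsub>DirProd_list Gs\<^esub> hs)"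
proof -
  have "(\<lambda>(g, gs). g # gs) \<in> hom (G \<times>\<times> (DirProd_list Gs)) (DirProd_list (G # Gs))"
    using DirProd_list_iso[of G Gs] by (simp add: iso_def)
  from hom_mult[OF this, of "(g,gs)" "(h,hs)"] assms show ?thesis by (simp add: DirProd_def)
qed

lemma DirProd_list_append_carrier:
  assumes "a \<in> carrier (DirProd_list As)" "b \<in> carrier (DirProd_list Bs)"
  shows "a @ b \<in> carrier (DirProd_list (As @ Bs))"
  using assms
  by (induction As arbitrary: a) (force simp: DirProd_list_def[of "[]"] DirProd_list_carrier)+

lemma DirProd_list_mult_append:
  assumes "a \<in> carrier (DirProd_list As)" "a' \<in> carrier (DirProd_list As)"
    "b \<in> carrier (DirProd_list Bs)" "b' \<in> carrier (DirProd_list Bs)"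
  shows "(a @ b) \<otimes>\<^bsub>DirProd_list (As @ Bs)\<^esub> (a' @ b')
     = (a \<otimes>\<^bsub>DirProd_list As\<^esub> a') @ (b \<otimes>\<^bsub>DirProd_list Bs\<^esub> b')"
  using assms
proof (induction As arbitrary: a a')
  case Nil then show ?case by (auto simp: DirProd_list_def)
next
  case (Cons G Gs)
  then obtain g gs h hs where "a = g # gs" "a' = h # hs" "g \<in> carrier G" "h \<in> carrier G"
     "gs \<in> carrier (DirProd_list Gs)" "hs \<in> carrier (DirProd_list Gs)"
     by (auto simp: DirProd_list_carrier)
  then show ?case using Cons.IH[of gs hs] Cons.prems by (simp add: DirProd_list_mult_Cons DirProd_list_append_carrier)
qed

lemma word_group_emb: assumes "\<forall>x\<in>set u \<union> set s \<union> set v. group (H x)"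
  shows "(\<lambda>(a, b). a @ \<one>\<^bsub>word_group H s\<^esub> @ b) \<in> mon (word_group H u \<times>\<times> word_group H v) (word_group H (u @ s @ v))"
proof -
  interpret S: group "word_group H s" unfolding word_group_def
    by (rule DirProd_list_is_group) (use assms in \<open>auto\<close>)
  have "inj_on (\<lambda>(a, b). a @ \<one>\<^bsub>word_group H s\<^esub> @ b) (carrier (word_group H u \<times>\<times> word_group H v))"
    by (auto simp: inj_on_def word_group_def DirProd_def dest!: DirProd_list_carrier_mem(1))
  moreover have "(\<lambda>(a, b). a @ \<one>\<^bsub>word_group H s\<^esub> @ b) \<in> hom (word_group H u \<times>\<times> word_group H v) (word_group H (u @ s @ v))"
  proof (rule homI, goal_cases)
    case (1 x) then show ?case
     using S.one_closed by (auto simp: word_group_def DirProd_def intro!: DirProd_list_append_carrier)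
  next
    case (2 x y) then show ?case using S.one_closed S.l_one[OF S.one_closed]
      by (auto simp: word_group_def DirProd_def DirProd_list_mult_append DirProd_list_append_carrier)
  qed
  ultimately show ?thesis by (auto simp: mon_def)
qed

lemma is_complex_of_groups_diagram_product_complex: assumes "semigroup_presentation Q" "\<forall>x\<in>alphabet Q. group (H x)"
  shows "is_complex_of_groups (diagram_product_complex H Q)"
proof -
  have *: "group (word_group H u)" if "set u \<subseteq> alphabet Q" for u
    unfolding word_group_def
    by (rule DirProd_list_is_group) (use assms that nth_mem in \<open>force\<close>)
  show ?thesis unfolding is_complex_of_groups_def
    using is_complex2_squier_complex[OF assms(1)] assms
    apply (auto simp: diagram_product_complex_def squier_complex_def semigroup_presentation_def nonempty_words_def words_def
     intro!: * DirProd_group word_group_emb)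
    done
qed

lemma is_complex2_total_complex: assumes "is_complex_of_groups C" shows "is_complex2 (total_complex C)"
proof -
  let ?K = "underlying C"
  have 1: "is_path (total_complex C) u (map (map_prod Inl id) p) v" if "is_path ?K u p v" for u p v
    using that by (induction p arbitrary: u) (auto simp: total_complex_def Let_def src_def tgt_def split: prod.splits)
  show ?thesis unfolding is_complex2_def
  proof (intro conjI ballI)
    fix c assume "c \<in> cells (total_complex C)"
    then consider (base) c' where "c' \<in> cells ?K" "c = map (map_prod Inl id) c'"
      | (mult) v g h where "v \<in> verts ?K" "g \<in> carrier (vertex_group C v)" "h \<in> carrier (vertex_group C v)"
          "c = [(Inr (v, g), True), (Inr (v, h), True), (Inr (v, g \<otimes>\<^bsub>vertex_group C v\<^esub> h), False)]"
      | (edge) e a where "e \<in> edges ?K" "a \<in> carrier (edge_group C e)"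
          "c = [(Inl e, False), (Inr (initial ?K e, initial_emb C e a), True),
            (Inl e, True), (Inr (terminal ?K e, terminal_emb C e a), False)]"
      by (simp add: total_complex_def Let_def) blast
    then show "\<exists>v. is_path (total_complex C) v c v"
    proof cases
      case base
      then obtain v where "is_path ?K v c' v"
        using assms by (auto simp: is_complex_of_groups_def is_complex2_def)
      then show ?thesis using 1 base(2) by blast
    next
      case mult
      then have "is_path (total_complex C) v c v"
        using assms by (simp add: total_complex_def Let_def is_complex_of_groups_def src_def tgt_def
            image_iff group.is_monoid monoid.m_closed)
      then show ?thesis ..
    next
      case edge
      then have "initial_emb C e a \<in> carrier (vertex_group C (initial ?K e))"
        "terminal_emb C e a \<in> carrier (vertex_group C (terminal ?K e))"
        using assms by (auto simp: is_complex_of_groups_def mon_def hom_def)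
      then have "is_path (total_complex C) (terminal ?K e) c (terminal ?K e)"
        using assms edge by (simp add: total_complex_def Let_def is_complex_of_groups_def
            is_complex2_def src_def tgt_def image_iff)
      then show ?thesis ..
    qed
  qed (use assms in \<open>auto simp: total_complex_def Let_def is_complex_of_groups_def is_complex2_def\<close>)
qed

lemma homotopic_is_path: assumes "is_complex2 K" "homotopic K u v p q" shows "is_path K u p v" "is_path K u q v"
proof -
  have "is_path K u p v \<and> is_path K u q v" using assms(2)
  proof induction
    case (homotopic_cell p c q)
    then show ?case using assms(1)
    proof -
      obtain a where a: "is_path K a c a" "c \<noteq> []" using homotopic_cell assms by (auto simp: is_complex2_def)
      obtain m n where "is_path K u p m" "is_path K m c n" "is_path K n q v"
        using homotopic_cell(1) by (auto simp: is_path_append[OF assms(1)])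
      moreover have "is_path K x c y \<Longrightarrow> c \<noteq> [] \<Longrightarrow> x = src K (hd c) \<and> y = tgt K (last c)" for x y c
      proof (induction c arbitrary: x)
         case (Cons e c) then show ?case by (cases c) auto
       qed simp
      ultimately show ?thesis using a homotopic_cell(1) unfolding is_path_append[OF assms(1)] by metis
    qed
  next
    case (homotopic_cancel p e q)
    then show ?case by (fastforce simp: is_path_append[OF assms(1)] src_def tgt_def edge_inv_def split: if_splits)
  qed auto
  then show "is_path K u p v" "is_path K u q v" by auto
qed

lemma homotopic_append: assumes "is_complex2 K"
  "homotopic K v v p q" "is_path K v a v" "is_path K v b v" shows "homotopic K v v (a @ p @ b) (a @ q @ b)"
  using assms(2)
proof induction
  case (homotopic_refl p) then show ?case using assms is_path_append[OF assms(1)] by (blast intro: homotopic.homotopic_refl)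
next case (homotopic_sym p q) then show ?case by (blast intro: homotopic.homotopic_sym)
next case (homotopic_trans p q r) then show ?case by (blast intro: homotopic.homotopic_trans)
next case (homotopic_cancel p e q)
  have "is_path K v (a @ (p @ [e, edge_inv e] @ q) @ b) v" using homotopic_cancel assms is_path_append[OF assms(1)] by blast
  then show ?case using homotopic.homotopic_cancel[of K v "a @ p" e "q @ b"] by simp
next case (homotopic_cell p c q)
  have "is_path K v (a @ (p @ c @ q) @ b) v" using homotopic_cell assms is_path_append[OF assms(1)] by blast
  then show ?case using homotopic.homotopic_cell[of K v "a @ p" c "q @ b"] homotopic_cell by simp
qed

lemma path_inv_homotopic: assumes "is_complex2 K" "is_path K u p v" shows "is_path K v (path_inv p) u \<and>
   homotopic K v v (path_inv p @ p) []"
  using assms(2)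
proof (induction p arbitrary: v rule: rev_induct)
  case Nil then show ?case by (auto simp: path_inv_def intro!: homotopic_refl)
next
  case (snoc e p)
  then obtain m where m: "is_path K u p m" "is_path K m [e] v" by (auto simp: is_path_append[OF assms(1)])
  have v: "v \<in> verts K" using m(2) by auto
  have 1: "is_path K v [edge_inv e] m" using m(2) assms(1) by (auto simp: edge_inv_def src_def tgt_def is_complex2_def)
  have a: "is_path K v (edge_inv e # path_inv p) u" "is_path K v ([edge_inv e] @ path_inv p @ p @ [e]) v"
    using snoc.IH[OF m(1)] 1 m by (fastforce simp: is_path_append[OF assms(1)])+
  have gen: "homotopic K v v ([edge_inv e] @ x @ [e]) ([edge_inv e] @ y @ [e])" if "homotopic K m m x y" for x y
    using that
  proof induction
    case (homotopic_refl p) then show ?case using 1 m is_path_append[OF assms(1)] by (blast intro: homotopic.homotopic_refl)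
  next case (homotopic_sym p q) then show ?case by (blast intro: homotopic.homotopic_sym)
  next case (homotopic_trans p q r) then show ?case by (blast intro: homotopic.homotopic_trans)
  next case (homotopic_cancel p f q)
    have "is_path K v ([edge_inv e] @ (p @ [f, edge_inv f] @ q) @ [e]) v" using homotopic_cancel 1 m is_path_append[OF assms(1)] by blast
    then show ?case using homotopic.homotopic_cancel[of K v "[edge_inv e] @ p" f "q @ [e]"] by simp
  next case (homotopic_cell p c q)
    have "is_path K v ([edge_inv e] @ (p @ c @ q) @ [e]) v" using homotopic_cell 1 m is_path_append[OF assms(1)] by blast
    then show ?case using homotopic.homotopic_cell[of K v "[edge_inv e] @ p" c "q @ [e]"] homotopic_cell by simp
  qed
  have "homotopic K v v ([edge_inv e] @ (path_inv p @ p) @ [e]) ([edge_inv e] @ [] @ [e])"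
    by (rule gen) (use snoc.IH[OF m(1)] in simp)
  moreover have "homotopic K v v ([] @ [edge_inv e, edge_inv (edge_inv e)] @ []) ([] @ [])"
    by (rule homotopic_cancel) (use m 1 in \<open>auto simp: edge_inv_def\<close>)
  ultimately show ?case using a homotopic_trans by (fastforce simp: path_inv_def edge_inv_def)
qed

lemma group_fundamental_group: assumes K: "is_complex2 K" and v: "v \<in> verts K" shows "group (fundamental_group K v)"
proof -
  have cls: "loop_class K v p = loop_class K v q" if "homotopic K v v p q" for p q
    using that by (auto simp: loop_class_def intro: homotopic_trans homotopic_sym)
  have m: "loop_class K v p \<otimes>\<^bsub>fundamental_group K v\<^esub> loop_class K v q = loop_class K v (p @ q)"
    if "is_path K v p v" "is_path K v q v" for p q
  proof -
    have "loop_class K v (p' @ q') = loop_class K v (p @ q)" if "p' \<in> loop_class K v p" "q' \<in> loop_class K v q" for p' q'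
    proof -
      have h: "homotopic K v v p p'" "homotopic K v v q q'" using that by (auto simp: loop_class_def)
      have "homotopic K v v (p @ q) (p' @ q)"
       using homotopic_append[OF K h(1), of "[]" q] \<open>is_path K v q v\<close> v by simp
      moreover have "homotopic K v v (p' @ q) (p' @ q')"
       using homotopic_append[OF K h(2), of p' "[]"] homotopic_is_path(2)[OF K h(1)] v by simp
      ultimately show ?thesis using cls by metis
    qed
    moreover have "p \<in> loop_class K v p" "q \<in> loop_class K v q" using that by (auto simp: loop_class_def intro: homotopic_refl)
    ultimately have "(\<Union>p'\<in>loop_class K v p. \<Union>q'\<in>loop_class K v q. loop_class K v (p' @ q')) = loop_class K v (p @ q)" by blast
    then show ?thesis unfolding fundamental_group_def by simp
  qed
  have c: "carrier (fundamental_group K v) = loop_class K v ` {p. is_path K v p v}"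
   and o: "\<one>\<^bsub>fundamental_group K v\<^esub> = loop_class K v []" by (auto simp: fundamental_group_def)
  show ?thesis
  proof (rule groupI, goal_cases)
    case (1 x y)
    then obtain p q where p: "x = loop_class K v p" "y = loop_class K v q"
      "is_path K v p v" "is_path K v q v" by (auto simp: c)
    then have "is_path K v (p @ q) v" using is_path_append[OF K] by blast
    then show ?case using p by (simp add: m) (simp add: c)
  next case 2 then show ?case using v by (force simp: c o)
  next case (3 x y z)
    then obtain p q r where "x = loop_class K v p" "y = loop_class K v q" "z = loop_class K v r"
      and p: "is_path K v p v" "is_path K v q v" "is_path K v r v" by (auto simp: c)
    moreover have "is_path K v (p @ q) v" "is_path K v (q @ r) v" using p is_path_append[OF K] by blast+
    ultimately show ?case by (simp add: m)
  next case (4 x) then show ?case using m[of "[]"] v by (auto simp: c o)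
  next case (5 x)
    then obtain p where p: "x = loop_class K v p" "is_path K v p v" by (auto simp: c)
    from path_inv_homotopic[OF K p(2)] show ?case using p m[of "path_inv p" p] cls
      by (intro bexI[of _ "loop_class K v (path_inv p)"]) (auto simp: c o)
  qed
qed

end

theory Submission
  imports Defs
begin

text \<open>
  A word that is connected to a word over \<open>X\<close> in the Squier complex of \<open>\<P>\<close> is a concatenation of
  blocks: letters \<open>x \<in> X\<close>, and words \<open>a\<^sub>x u a\<^sub>x\<close> with \<open>u\<close> connected to \<open>w\<^sub>x\<close> in the complex of \<open>\<P>\<^sub>x\<close>.
  The markers \<open>a\<^sub>x\<close> make the blocks unique, and disjointness of the alphabets keeps every relation
  inside a single block or, for a relation of \<open>\<S>\<close>, on a sequence of blocks that are letters
  (\<open>flat_inj\<close>, \<open>find_letters\<close>, \<open>find_inner\<close>, \<open>find_wrapped\<close>).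

  Collapsing each block to its letter therefore translates paths of \<open>\<P>\<close> into the diagram product
  (\<open>complex_map_read\<close>).  Relations of \<open>\<S>\<close> are kept, the relation \<open>x = a\<^sub>x w\<^sub>x a\<^sub>x\<close> is read as the identity,
  and a relation of \<open>\<R>\<^sub>x\<close> applied inside a block, \<open>u \<rightarrow> v\<close>, is read as the element of \<open>G\<^sub>x\<close> given by
  the loop \<open>w\<^sub>x \<leadsto> u \<rightarrow> v \<leadsto> w\<^sub>x\<close>, where a path from \<open>w\<^sub>x\<close> to each word of its component has been chosen
  once and for all.

  In the other direction (\<open>complex_map_draw\<close>) an element of \<open>G\<^sub>x\<close> at a letter \<open>x\<close> is drawn by expanding
  \<open>x\<close> to \<open>a\<^sub>x w\<^sub>x a\<^sub>x\<close>, following a loop that represents it between the two markers, and contracting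
  again.  That both translations respect homotopy rests on one principle: moves on disjoint subwords
  commute up to homotopy (\<open>interchange\<close> in Squier complexes, \<open>label_interchange\<close> in the diagram product).

  Reading what has been drawn gives back the original path (\<open>read_draw\<close>).  Drawing what has been read
  gives the original path up to the natural paths that expand the letters to the blocks of a given word
  (\<open>expand_natural\<close>).  At \<open>w\<close> itself there is nothing to expand, so the two translations induce
  mutually inverse isomorphisms of fundamental groups (\<open>fundamental_group_iso\<close>, \<open>composite_iso\<close>).

  For an arbitrary family of diagram groups the alphabets are first made disjoint.  Neither diagram
  groups nor diagram products change under renaming of letters and replacement of the groups by
  isomorphic ones (\<open>diagram_group_rename\<close>, \<open>diagram_product_rename\<close>).
\<close>


section \<open>Paths up to homotopy\<close>

lemma is_path_verts: "is_path K u p v \<Longrightarrow> u \<in> verts K" "is_path K u p v \<Longrightarrow> v \<in> verts K"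
  by (induction p arbitrary: u) auto

lemma is_path_appendI: "is_path K u p v \<Longrightarrow> is_path K v q w \<Longrightarrow> is_path K u (p @ q) w"
  by (induction p arbitrary: u) auto

lemma is_path_appendE:
  assumes "is_path K u (p @ q) w"
  obtains v where "is_path K u p v" "is_path K v q w"
proof -
  have "\<exists>v. is_path K u p v \<and> is_path K v q w"
    using assms by (induction p arbitrary: u) (auto dest: is_path_verts)
  then show thesis using that by blast
qed

lemma is_path_endpoints:
  assumes "is_path K u p v" "is_path K u' p v'" "p \<noteq> []"
  shows "u' = u" "v' = v"
proof -
  have ends: "u = src K (hd p) \<and> v = tgt K (last p)" if "is_path K u p v" "p \<noteq> []" for u v
    using that by (induction p arbitrary: u) (auto split: if_splits)
  show "u' = u" "v' = v" using ends[OF assms(1,3)] ends[OF assms(2,3)] by auto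
qed

lemma is_path_edge:
  assumes "is_complex2 K" "e \<in> edges K"
  shows "is_path K (initial K e) [(e, True)] (terminal K e)"
  using assms by (auto simp: is_complex2_def src_def tgt_def)

lemma edge_inv_edge_inv [simp]: "edge_inv (edge_inv e) = e"
  by (simp add: edge_inv_def)

lemma path_inv_Nil [simp]: "path_inv [] = []"
  by (simp add: path_inv_def)

lemma path_inv_append [simp]: "path_inv (p @ q) = path_inv q @ path_inv p"
  by (simp add: path_inv_def)

lemma path_inv_path_inv [simp]: "path_inv (path_inv p) = p"
  by (simp add: path_inv_def rev_map comp_def)

lemma path_inv_single: "path_inv [(e, b)] = [(e, \<not> b)]"
  by (simp add: path_inv_def edge_inv_def)

lemma homotopic_context:
  assumes "homotopic K v w p q" "is_path K u a v" "is_path K w b x"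
  shows "homotopic K u x (a @ p @ b) (a @ q @ b)"
  using assms(1)
proof induction
  case (homotopic_refl p)
  show ?case
    using is_path_appendI[OF assms(2) is_path_appendI[OF homotopic_refl assms(3)]]
    by (rule homotopic.homotopic_refl)
next
  case (homotopic_sym p q)
  then show ?case by (blast intro: homotopic.homotopic_sym)
next
  case (homotopic_trans p q r)
  then show ?case by (blast intro: homotopic.homotopic_trans)
next
  case (homotopic_cancel p e q)
  have "is_path K u (a @ (p @ [e, edge_inv e] @ q) @ b) x"
    using is_path_appendI[OF assms(2) is_path_appendI[OF homotopic_cancel assms(3)]] .
  then show ?case using homotopic.homotopic_cancel[of K u "a @ p" e "q @ b"] by simp
next
  case (homotopic_cell p c q)
  have "is_path K u (a @ (p @ c @ q) @ b) x"
    using is_path_appendI[OF assms(2) is_path_appendI[OF homotopic_cell(1) assms(3)]] .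
  then show ?case using homotopic.homotopic_cell[of K u "a @ p" c "q @ b"] homotopic_cell by simp
qed

declare homotopic_trans [trans]

locale complex2 =
  fixes K :: "('v, 'e) complex2"
  assumes complex: "is_complex2 K"
begin

lemma homotopic_paths:
  "homotopic K u v p q \<Longrightarrow> is_path K u p v" "homotopic K u v p q \<Longrightarrow> is_path K u q v"
  using homotopic_is_path[OF complex] by auto

lemma homotopic_append2:
  assumes "homotopic K u v p p'" "homotopic K v w q q'"
  shows "homotopic K u w (p @ q) (p' @ q')"
proof -
  have "homotopic K u w ([] @ p @ q) ([] @ p' @ q)"
    by (rule homotopic_context[OF assms(1)])
      (use assms in \<open>auto dest: homotopic_paths is_path_verts\<close>)
  moreover have "homotopic K u w (p' @ q @ []) (p' @ q' @ [])"
    by (rule homotopic_context[OF assms(2)])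
      (use assms in \<open>auto dest: homotopic_paths is_path_verts\<close>)
  ultimately show ?thesis by (auto intro: homotopic_trans)
qed

lemma homotopic_append_left:
  assumes "is_path K u p v" "homotopic K v w q q'"
  shows "homotopic K u w (p @ q) (p @ q')"
  using homotopic_append2[OF homotopic_refl[OF assms(1)] assms(2)] .

lemma homotopic_append_right:
  assumes "homotopic K u v p p'" "is_path K v q w"
  shows "homotopic K u w (p @ q) (p' @ q)"
  using homotopic_append2[OF assms(1) homotopic_refl[OF assms(2)]] .

lemma inv_left: "is_path K u p v \<Longrightarrow> homotopic K v v (path_inv p @ p) []"
  using path_inv_homotopic[OF complex] by blast

lemma is_path_inv: "is_path K u p v \<Longrightarrow> is_path K v (path_inv p) u"
  using path_inv_homotopic[OF complex] by blast

lemma inv_right: "is_path K u p v \<Longrightarrow> homotopic K u u (p @ path_inv p) []"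
  using inv_left[OF is_path_inv] by simp

lemma homotopic_inv:
  assumes "homotopic K u v p q"
  shows "homotopic K v u (path_inv p) (path_inv q)"
proof -
  have p: "is_path K u p v" and q: "is_path K u q v" using homotopic_paths assms by auto
  have "homotopic K v u (path_inv p) (path_inv p @ q @ path_inv q)"
    using homotopic_append_left[OF is_path_inv[OF p] homotopic_sym[OF inv_right[OF q]]] by simp
  also have "homotopic K v u (path_inv p @ q @ path_inv q) (path_inv p @ p @ path_inv q)"
    using homotopic_context[OF homotopic_sym[OF assms] is_path_inv[OF p] is_path_inv[OF q]] .
  also have "homotopic K v u (path_inv p @ p @ path_inv q) (path_inv q)"
    using homotopic_append_right[OF inv_left[OF p] is_path_inv[OF q]] by simp
  finally show ?thesis .
qed

text \<open>
  Reverses the sides \<open>g\<close> and \<open>f\<close> of a homotopy square; this is how naturality on positive edges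
  carries over to inverse edges.
\<close>

lemma homotopic_square_inv:
  assumes sq: "homotopic K u v' (a @ f) (g @ b)"
    and "is_path K u a v" "is_path K v f v'" "is_path K u g u'" "is_path K u' b v'"
  shows "homotopic K u' v (path_inv g @ a) (b @ path_inv f)"
proof -
  note inv = is_path_inv[OF assms(2)] is_path_inv[OF assms(3)] is_path_inv[OF assms(4)]
    is_path_inv[OF assms(5)]
  have "homotopic K u' v (path_inv g @ a) (path_inv g @ a @ f @ path_inv f)"
    using homotopic_append_left[OF is_path_appendI[OF inv(3) assms(2)]
        homotopic_sym[OF inv_right[OF assms(3)]]] by simp
  also have "homotopic K u' v (path_inv g @ a @ f @ path_inv f) (path_inv g @ g @ b @ path_inv f)"
    using homotopic_context[OF sq inv(3) inv(2)] by simp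
  also have "homotopic K u' v (path_inv g @ g @ b @ path_inv f) (b @ path_inv f)"
    using homotopic_append_right[OF inv_left[OF assms(4)] is_path_appendI[OF assms(5) inv(2)]] by simp
  finally show ?thesis .
qed

text \<open>
  The boundary of the 2-cell of an edge \<open>e\<close> in a complex of groups is of the form \<open>e\<inverse> g e h\<inverse>\<close>; it is
  null-homotopic as soon as \<open>g\<close> slides along \<open>e\<close> to \<open>h\<close>.
\<close>

lemma homotopic_conjugate:
  assumes "homotopic K u v (g @ e) (e @ h)" "is_path K u e v" "is_path K v h v"
  shows "homotopic K v v (path_inv e @ g @ e) h"
  using homotopic_trans[OF homotopic_append_left[OF is_path_inv[OF assms(2)] assms(1)]]
    homotopic_append_right[OF inv_left[OF assms(2)] assms(3)] by simp

lemma homotopic_imp_null: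
  assumes "homotopic K u v p q" shows "homotopic K u u (p @ path_inv q) []"
  using homotopic_append_right[OF assms is_path_inv] inv_right homotopic_paths[OF assms]
  by (blast intro: homotopic_trans)

lemma null_imp_homotopic:
  assumes "homotopic K u u (p @ path_inv q) []" "is_path K u p v" "is_path K u q v"
  shows "homotopic K u v p q"
proof -
  have "homotopic K u v p (p @ path_inv q @ q)"
    using homotopic_append_left[OF assms(2) homotopic_sym[OF inv_left[OF assms(3)]]] by simp
  also have "homotopic K u v (p @ path_inv q @ q) q"
    using homotopic_append_right[OF assms(1,3)] by simp
  finally show ?thesis .
qed

end

lemma (in complex2) inverse_unique:
  assumes "homotopic K u u (p @ q) []" "is_path K u p v" "is_path K v q u"
  shows "homotopic K v u (path_inv p) q"
  using homotopic_inv[OF null_imp_homotopic[of u p "path_inv q" v]] assms is_path_inv[OF assms(3)] by simp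

section \<open>Maps of 2-complexes\<close>

definition path_map :: "('e \<Rightarrow> ('f \<times> bool) list) \<Rightarrow> ('e \<times> bool) list \<Rightarrow> ('f \<times> bool) list" where
  "path_map f p = concat (map (\<lambda>(e, s). if s then f e else path_inv (f e)) p)"

lemma path_map_Nil [simp]: "path_map f [] = []"
  by (simp add: path_map_def)

lemma path_map_Cons: "path_map f ((e, s) # p) = (if s then f e else path_inv (f e)) @ path_map f p"
  by (simp add: path_map_def)

lemma path_map_append [simp]: "path_map f (p @ q) = path_map f p @ path_map f q"
  by (simp add: path_map_def)

lemma path_map_path_inv: "path_map f (path_inv p) = path_inv (path_map f p)"
  by (induction p) (auto simp: path_map_def path_inv_def edge_inv_def rev_map comp_def)

lemma path_map_path_map: "path_map g (path_map f p) = path_map (\<lambda>e. path_map g (f e)) p"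
  by (induction p) (auto simp: path_map_Cons path_map_path_inv)

lemma path_map_id: "path_map (\<lambda>e. [(e, True)]) p = p"
  by (induction p) (auto simp: path_map_Cons path_inv_def edge_inv_def)

text \<open>
  The domain of the map is a union \<open>V\<close> of connected components.  This matters for reading: only the
  words in the component of a word over \<open>X\<close> decompose into blocks.  An edge may go to a path because
  drawing a group element takes several steps.
\<close>

locale complex_map =
  fixes K :: "('v, 'e) complex2" and V :: "'v set" and L :: "('w, 'f) complex2"
    and fV :: "'v \<Rightarrow> 'w" and fE :: "'e \<Rightarrow> ('f \<times> bool) list"
  assumes K: "is_complex2 K" and L: "is_complex2 L"
    and vert: "\<And>v. v \<in> V \<Longrightarrow> v \<in> verts K \<Longrightarrow> fV v \<in> verts L"
    and closed: "\<And>e. e \<in> edges K \<Longrightarrow> initial K e \<in> V \<longleftrightarrow> terminal K e \<in> V"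
    and edge: "\<And>e. e \<in> edges K \<Longrightarrow> initial K e \<in> V \<Longrightarrow>
      is_path L (fV (initial K e)) (fE e) (fV (terminal K e))"
    and cell: "\<And>c v. c \<in> cells K \<Longrightarrow> is_path K v c v \<Longrightarrow> v \<in> V \<Longrightarrow>
      homotopic L (fV v) (fV v) (path_map fE c) []"
begin

sublocale L: complex2 L by unfold_locales (rule L)

lemma is_path_path_map:
  "is_path K u p v \<Longrightarrow> u \<in> V \<Longrightarrow> is_path L (fV u) (path_map fE p) (fV v) \<and> v \<in> V"
proof (induction p arbitrary: u)
  case Nil then show ?case by (auto simp: vert)
next
  case (Cons d p)
  obtain e s where d: "d = (e, s)" by force
  have e: "e \<in> edges K" "src K d = u" "is_path K (tgt K d) p v" using Cons.prems d by auto
  have "tgt K d \<in> V" using e Cons.prems closed[OF e(1)] d by (auto simp: src_def tgt_def split: if_splits)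
  moreover have "is_path L (fV u) (if s then fE e else path_inv (fE e)) (fV (tgt K d))"
    using edge[OF e(1)] e Cons.prems closed[OF e(1)] L.is_path_inv d
    by (auto simp: src_def tgt_def split: if_splits)
  ultimately show ?case using Cons.IH[OF e(3)] d by (auto simp: path_map_Cons intro: is_path_appendI)
qed

lemma homotopic_path_map:
  assumes "homotopic K u v p q" "u \<in> V"
  shows "homotopic L (fV u) (fV v) (path_map fE p) (path_map fE q)"
  using assms(1)
proof induction
  case (homotopic_refl p)
  then show ?case using is_path_path_map assms(2) by (blast intro: homotopic.homotopic_refl)
next
  case (homotopic_sym p q)
  then show ?case by (blast intro: homotopic.homotopic_sym)
next
  case (homotopic_trans p q r)
  then show ?case by (blast intro: homotopic.homotopic_trans)
next
  case (homotopic_cancel p e q)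
  obtain m where m: "is_path K u p m" "is_path K m ([e, edge_inv e] @ q) v"
    using is_path_appendE[OF homotopic_cancel] by blast
  then obtain n where n: "is_path K m [e] n"
    using is_path_appendE[of K m "[e]" "[edge_inv e] @ q"] by auto
  from m(2) have q: "is_path K m q v"
    by (cases "snd e") (auto simp: src_def tgt_def edge_inv_def)
  have m': "is_path L (fV u) (path_map fE p) (fV m)" "m \<in> V"
    using is_path_path_map[OF m(1) assms(2)] by auto
  have n': "is_path L (fV m) (path_map fE [e]) (fV n)"
    using is_path_path_map[OF n m'(2)] by auto
  have q': "is_path L (fV m) (path_map fE q) (fV v)"
    using is_path_path_map[OF q m'(2)] by auto
  have inv: "path_map fE [e, edge_inv e] = path_map fE [e] @ path_inv (path_map fE [e])"
    using path_map_append[of fE "[e]" "[edge_inv e]"] path_map_path_inv[of fE "[e]"]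
    by (simp add: path_inv_def)
  have "homotopic L (fV u) (fV v) (path_map fE p @ path_map fE [e, edge_inv e] @ path_map fE q)
      (path_map fE p @ [] @ path_map fE q)"
    unfolding inv by (rule homotopic_context[OF L.inv_right[OF n'] m'(1) q'])
  then show ?case using path_map_append[of fE p] path_map_append[of fE "[e, edge_inv e]" q]
    by simp
next
  case (homotopic_cell p c q)
  obtain m n where m: "is_path K u p m" "is_path K m c n" "is_path K n q v"
    using is_path_appendE[OF homotopic_cell(1)] is_path_appendE by metis
  obtain b where "is_path K b c b" "c \<noteq> []" using K homotopic_cell(2) by (auto simp: is_complex2_def)
  then have mn: "m = n" using is_path_endpoints[OF _ m(2)] by blast
  have m': "is_path L (fV u) (path_map fE p) (fV m)" "m \<in> V"
    using is_path_path_map[OF m(1) assms(2)] by auto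
  have q': "is_path L (fV m) (path_map fE q) (fV v)"
    using is_path_path_map[OF m(3)] m' mn by auto
  have "homotopic L (fV u) (fV v) (path_map fE p @ path_map fE c @ path_map fE q)
      (path_map fE p @ [] @ path_map fE q)"
    by (rule homotopic_context[OF cell[OF homotopic_cell(2)] m'(1) q']) (use m mn m' in auto)
  then show ?case by simp
qed

end

text \<open>
  A natural transformation between two functors on fundamental groupoids only has to be checked on
  positive edges: naturality squares compose, and those of inverse edges are obtained by reversing
  two sides.
\<close>

lemma path_map_natural:
  assumes F: "complex_map K V L fV F" and G: "complex_map K V L gV G"
    and eta: "\<And>v. v \<in> V \<Longrightarrow> v \<in> verts K \<Longrightarrow> is_path L (fV v) (\<eta> v) (gV v)"
    and nat: "\<And>e. e \<in> edges K \<Longrightarrow> initial K e \<in> V \<Longrightarrow>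
      homotopic L (fV (initial K e)) (gV (terminal K e))
        (\<eta> (initial K e) @ G e) (F e @ \<eta> (terminal K e))"
    and p: "is_path K u p v" "u \<in> V"
  shows "homotopic L (fV u) (gV v) (\<eta> u @ path_map G p) (path_map F p @ \<eta> v)"
  using p
proof (induction p arbitrary: u)
  case Nil
  then show ?case by (auto intro!: homotopic_refl eta)
next
  case (Cons d p)
  interpret F: complex_map K V L fV F by fact
  interpret G: complex_map K V L gV G by fact
  obtain e s where d: "d = (e, s)" by force
  let ?t = "tgt K d"
  have e: "e \<in> edges K" "src K d = u" "is_path K ?t p v" using Cons.prems d by auto
  have p1: "is_path K u [d] ?t" using Cons.prems is_path_verts(1)[OF e(3)] by auto
  have t: "?t \<in> V" "?t \<in> verts K" using F.is_path_path_map[OF p1 Cons.prems(2)] is_path_verts p1 by auto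
  have u: "u \<in> verts K" using is_path_verts p1 by auto
  have IH: "homotopic L (fV ?t) (gV v) (\<eta> ?t @ path_map G p) (path_map F p @ \<eta> v)"
    using Cons.IH[OF e(3) t(1)] .
  have step: "homotopic L (fV u) (gV ?t) (\<eta> u @ path_map G [d]) (path_map F [d] @ \<eta> ?t)"
  proof (cases s)
    case True
    then show ?thesis using nat[OF e(1)] e(2) Cons.prems(2) d by (simp add: path_map_Cons src_def tgt_def)
  next
    case False
    then have ends: "initial K e = ?t" "terminal K e = u" using e(2) d by (auto simp: src_def tgt_def)
    have "homotopic L (fV ?t) (gV u) (\<eta> ?t @ G e) (F e @ \<eta> u)" using nat[OF e(1)] ends t by simp
    then have "homotopic L (fV u) (gV ?t) (path_inv (F e) @ \<eta> ?t) (\<eta> u @ path_inv (G e))"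
      by (rule F.L.homotopic_square_inv)
        (use F.edge[OF e(1)] G.edge[OF e(1)] ends t eta u Cons.prems in auto)
    then show ?thesis using False d by (simp add: path_map_Cons homotopic_sym)
  qed
  have "homotopic L (fV u) (gV v) (\<eta> u @ path_map G [d] @ path_map G p) (path_map F [d] @ \<eta> ?t @ path_map G p)"
    using F.L.homotopic_append_right[OF step] G.is_path_path_map[OF e(3) t(1)] by force
  also have "homotopic L (fV u) (gV v) (path_map F [d] @ \<eta> ?t @ path_map G p) (path_map F [d] @ path_map F p @ \<eta> v)"
    by (rule F.L.homotopic_append_left[OF _ IH]) (use F.is_path_path_map[OF p1 Cons.prems(2)] in blast)
  finally show ?case using path_map_append[of F "[d]" p] path_map_append[of G "[d]" p] by simp
qed

lemma complex_map_id: "is_complex2 K \<Longrightarrow> (\<And>e. e \<in> edges K \<Longrightarrow> initial K e \<in> V \<longleftrightarrow> terminal K e \<in> V) \<Longrightarrow>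
   complex_map K V K (\<lambda>v. v) (\<lambda>e. [(e, True)])"
  unfolding complex_map_def
proof (intro conjI allI impI)
  fix c v assume "c \<in> cells K" "is_path K v c v"
  then show "homotopic K v v (path_map (\<lambda>e. [(e, True)]) c) []"
    using homotopic_cell[of K v "[]" c "[]" v] by (simp add: path_map_id)
qed (use is_path_edge[of K] in \<open>auto simp: is_complex2_def\<close>)

lemma complex_map_comp:
  assumes F: "complex_map K V L fV F" and G: "complex_map L W M gV G" and VW: "\<And>v. v \<in> V \<Longrightarrow> v \<in> verts K \<Longrightarrow> fV v \<in> W"
  shows "complex_map K V M (\<lambda>v. gV (fV v)) (\<lambda>e. path_map G (F e))"
proof -
  interpret F: complex_map K V L fV F by fact
  interpret G: complex_map L W M gV G by fact
  show ?thesis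
  proof
    fix e assume "e \<in> edges K" "initial K e \<in> V"
    then show "is_path M (gV (fV (initial K e))) (path_map G (F e)) (gV (fV (terminal K e)))"
      using G.is_path_path_map[OF F.edge] VW F.K by (auto simp: is_complex2_def)
  next
    fix c v assume "c \<in> cells K" "is_path K v c v" "v \<in> V"
    then show "homotopic M (gV (fV v)) (gV (fV v)) (path_map (\<lambda>e. path_map G (F e)) c) []"
      using G.homotopic_path_map[OF F.cell] VW is_path_verts(1) by (fastforce simp flip: path_map_path_map)
  qed (use F.K G.L F.vert G.vert VW F.closed in auto)
qed

section \<open>Fundamental groups\<close>

lemma loop_class_eqI: "homotopic K v v p q \<Longrightarrow> loop_class K v p = loop_class K v q"
  by (auto simp: loop_class_def intro: homotopic_trans homotopic_sym)

lemma loop_class_eqD: "is_path K v q v \<Longrightarrow> loop_class K v p = loop_class K v q \<Longrightarrow> homotopic K v v p q"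
  by (auto simp: loop_class_def dest: homotopic_refl)

lemma carrier_fundamental_group: "carrier (fundamental_group K v) = loop_class K v ` {p. is_path K v p v}"
  and one_fundamental_group: "\<one>\<^bsub>fundamental_group K v\<^esub> = loop_class K v []"
  by (auto simp: fundamental_group_def)

lemma (in complex2) mult_fundamental_group:
  assumes "is_path K v p v" "is_path K v q v"
  shows "loop_class K v p \<otimes>\<^bsub>fundamental_group K v\<^esub> loop_class K v q = loop_class K v (p @ q)"
proof -
  have "loop_class K v (p' @ q') = loop_class K v (p @ q)"
    if "p' \<in> loop_class K v p" "q' \<in> loop_class K v q" for p' q'
  proof -
    have "homotopic K v v p p'" "homotopic K v v q q'" using that by (simp_all add: loop_class_def)
    from homotopic_append2[OF this] show ?thesis by (rule loop_class_eqI[symmetric])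
  qed
  moreover have "p \<in> loop_class K v p" "q \<in> loop_class K v q"
    using assms by (auto simp: loop_class_def intro: homotopic_refl)
  ultimately have "(\<Union>p'\<in>loop_class K v p. \<Union>q'\<in>loop_class K v q. loop_class K v (p' @ q')) = loop_class K v (p @ q)"
    by blast
  then show ?thesis unfolding fundamental_group_def by simp
qed

text \<open>
  Two maps that are inverse to each other up to natural paths \<open>\<eta>\<close> and \<open>\<theta>\<close> form an equivalence of
  fundamental groupoids.  If these paths are trivial at the base points, then the induced
  homomorphisms of the vertex groups are inverse to each other.
\<close>

theorem fundamental_group_iso:
  assumes F: "complex_map K V L fV F" and G: "complex_map L W K gV G"
    and VW: "\<And>v. v \<in> V \<Longrightarrow> v \<in> verts K \<Longrightarrow> fV v \<in> W" and WV: "\<And>w. w \<in> W \<Longrightarrow> w \<in> verts L \<Longrightarrow> gV w \<in> V"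
    and eta: "\<And>v. v \<in> V \<Longrightarrow> v \<in> verts K \<Longrightarrow> is_path K (gV (fV v)) (\<eta> v) v"
    and eta_nat: "\<And>e. e \<in> edges K \<Longrightarrow> initial K e \<in> V \<Longrightarrow>
      homotopic K (gV (fV (initial K e))) (terminal K e)
        (\<eta> (initial K e) @ [(e, True)]) (path_map G (F e) @ \<eta> (terminal K e))"
    and theta: "\<And>w. w \<in> W \<Longrightarrow> w \<in> verts L \<Longrightarrow> is_path L (fV (gV w)) (\<theta> w) w"
    and theta_nat: "\<And>e. e \<in> edges L \<Longrightarrow> initial L e \<in> W \<Longrightarrow>
      homotopic L (fV (gV (initial L e))) (terminal L e)
        (\<theta> (initial L e) @ [(e, True)]) (path_map F (G e) @ \<theta> (terminal L e))"
    and v: "v \<in> V" "v \<in> verts K" and base: "gV (fV v) = v" "\<eta> v = []" "\<theta> (fV v) = []"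
  shows "fundamental_group K v \<cong> fundamental_group L (fV v)"
proof -
  interpret F: complex_map K V L fV F by fact
  interpret G: complex_map L W K gV G by fact
  let ?w = "fV v"
  have w: "?w \<in> W" "?w \<in> verts L" using v VW F.vert by auto
  have GF: "homotopic K v v p (path_map G (path_map F p))" if "is_path K v p v" for p
    using path_map_natural[OF complex_map_comp[OF F G VW] complex_map_id[OF F.K F.closed] eta eta_nat that v(1)]
    by (simp add: base path_map_id path_map_path_map)
  have FG: "homotopic L ?w ?w p (path_map F (path_map G p))" if "is_path L ?w p ?w" for p
    using path_map_natural[OF complex_map_comp[OF G F WV] complex_map_id[OF G.K G.closed] theta theta_nat that w(1)]
    by (simp add: base path_map_id path_map_path_map)
  define h where "h A = loop_class L ?w (path_map F (SOME p. p \<in> A))" for A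
  have h: "h (loop_class K v p) = loop_class L ?w (path_map F p)" if "is_path K v p v" for p
  proof -
    have "p \<in> loop_class K v p" using that by (auto simp: loop_class_def intro: homotopic_refl)
    then have "(SOME p'. p' \<in> loop_class K v p) \<in> loop_class K v p" by (rule someI)
    then have "homotopic K v v p (SOME p'. p' \<in> loop_class K v p)" by (simp add: loop_class_def)
    then show ?thesis unfolding h_def
      by (intro loop_class_eqI homotopic_sym[OF F.homotopic_path_map[OF _ v(1)]])
  qed
  have Fp: "is_path L ?w (path_map F p) ?w" if "is_path K v p v" for p
    using F.is_path_path_map[OF that v(1)] by simp
  have Gp: "is_path K v (path_map G p) v" if "is_path L ?w p ?w" for p
    using G.is_path_path_map[OF that w(1)] base by simp
  have "h \<in> hom (fundamental_group K v) (fundamental_group L ?w)"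
  proof (rule homI)
    fix x y assume "x \<in> carrier (fundamental_group K v)" "y \<in> carrier (fundamental_group K v)"
    then obtain p q where "x = loop_class K v p" "y = loop_class K v q" and p: "is_path K v p v" "is_path K v q v"
      by (auto simp: carrier_fundamental_group)
    then show "h (x \<otimes>\<^bsub>fundamental_group K v\<^esub> y) = h x \<otimes>\<^bsub>fundamental_group L ?w\<^esub> h y"
      by (simp add: G.L.mult_fundamental_group F.L.mult_fundamental_group h is_path_appendI[OF p] Fp)
  qed (auto simp: carrier_fundamental_group h Fp)
  moreover have "inj_on h (carrier (fundamental_group K v))"
  proof (rule inj_onI)
    fix x y assume "x \<in> carrier (fundamental_group K v)" "y \<in> carrier (fundamental_group K v)" and eq: "h x = h y"
    then obtain p q where xy: "x = loop_class K v p" "y = loop_class K v q" and p: "is_path K v p v" "is_path K v q v"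
      by (auto simp: carrier_fundamental_group)
    have "homotopic L ?w ?w (path_map F p) (path_map F q)"
      using eq unfolding xy h[OF p(1)] h[OF p(2)] by (rule loop_class_eqD[OF Fp[OF p(2)]])
    then have "homotopic K v v (path_map G (path_map F p)) (path_map G (path_map F q))"
      using G.homotopic_path_map[OF _ w(1)] base(1) by metis
    then show "x = y" unfolding xy
      by (rule loop_class_eqI[OF homotopic_trans[OF GF[OF p(1)] homotopic_trans[OF _ homotopic_sym[OF GF[OF p(2)]]]]])
  qed
  moreover have "carrier (fundamental_group L ?w) \<subseteq> h ` carrier (fundamental_group K v)"
  proof
    fix y assume "y \<in> carrier (fundamental_group L ?w)"
    then obtain p where p: "y = loop_class L ?w p" "is_path L ?w p ?w" by (auto simp: carrier_fundamental_group)
    then have "y = h (loop_class K v (path_map G p))"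
      unfolding h[OF Gp[OF p(2)]] p(1) by (intro loop_class_eqI FG)
    then show "y \<in> h ` carrier (fundamental_group K v)" using Gp[OF p(2)] by (auto simp: carrier_fundamental_group)
  qed
  ultimately have "h \<in> iso (fundamental_group K v) (fundamental_group L ?w)"
    by (auto simp: iso_def bij_betw_def hom_def)
  then show ?thesis by (rule is_isoI)
qed


section \<open>The monoidal structure of Squier complexes\<close>

text \<open>
  The empty word is an isolated extra vertex, and so does not change the fundamental group at a
  non-empty word.  It makes the concatenation of vertices an operation with a neutral element.
\<close>

definition squier_complex0 :: "'a presentation \<Rightarrow> ('a list, 'a squier_edge) complex2" where
  "squier_complex0 P = (squier_complex P)\<lparr>verts := words P\<rparr>"

lemma words_append [simp]: "u @ v \<in> words P \<longleftrightarrow> u \<in> words P \<and> v \<in> words P"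
  by (auto simp: words_def)

lemma words_Nil [simp]: "[] \<in> words P"
  by (simp add: words_def)

lemma words_Cons: "x # u \<in> words P \<longleftrightarrow> x \<in> alphabet P \<and> u \<in> words P"
  by (simp add: words_def)

lemma squier_complex0_simps [simp]:
  "verts (squier_complex0 P) = words P"
  "edges (squier_complex0 P) = words P \<times> relations P \<times> words P"
  "initial (squier_complex0 P) (p, (l, r), q) = p @ l @ q"
  "terminal (squier_complex0 P) (p, (l, r), q) = p @ r @ q"
  "cells (squier_complex0 P) = cells (squier_complex P)"
  by (auto simp: squier_complex0_def squier_complex_def)

lemma squier_complex_simps [simp]:
  "verts (squier_complex P) = nonempty_words P"
  "edges (squier_complex P) = words P \<times> relations P \<times> words P"
  "initial (squier_complex P) (p, (l, r), q) = p @ l @ q"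
  "terminal (squier_complex P) (p, (l, r), q) = p @ r @ q"
  by (auto simp: squier_complex_def)

lemma src_squier_complex0: "src (squier_complex0 P) e = src (squier_complex P) e"
  and tgt_squier_complex0: "tgt (squier_complex0 P) e = tgt (squier_complex P) e"
  by (auto simp: src_def tgt_def squier_complex0_def)

text \<open>
  \<open>whisker p \<pi> q\<close> is the path \<open>\<pi>\<close> carried out between the fixed words \<open>p\<close> and \<open>q\<close>.
\<close>

definition whisker :: "'a list \<Rightarrow> ('a squier_edge \<times> bool) list \<Rightarrow> 'a list \<Rightarrow> ('a squier_edge \<times> bool) list" where
  "whisker p \<pi> q = map (\<lambda>((p', r, q'), s). ((p @ p', r, q' @ q), s)) \<pi>"

lemma whisker_simps [simp]:
  "whisker p [] q = []"
  "whisker p (((p', r, q'), s) # \<pi>) q = ((p @ p', r, q' @ q), s) # whisker p \<pi> q"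
  "whisker p (\<pi> @ \<rho>) q = whisker p \<pi> q @ whisker p \<rho> q"
  "whisker p (whisker p' \<pi> q') q = whisker (p @ p') \<pi> (q' @ q)"
  "whisker [] \<pi> [] = \<pi>"
  by (auto simp: whisker_def)

lemma path_inv_whisker [simp]: "path_inv (whisker p \<pi> q) = whisker p (path_inv \<pi>) q"
  by (induction \<pi>) (auto simp: whisker_def path_inv_def edge_inv_def)

lemma path_map_whisker: "path_map (\<lambda>(p', r, q'). [((p @ p', r, q' @ q), True)]) \<pi> = whisker p \<pi> q"
  by (induction \<pi>) (auto simp: path_map_Cons path_inv_single)

locale squier =
  fixes P :: "'a presentation"
  assumes presentation: "semigroup_presentation P"
begin

abbreviation "K \<equiv> squier_complex0 P"

lemma relation_words:
  assumes "(l, r) \<in> relations P"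
  shows "l \<in> words P" "r \<in> words P" "l \<noteq> []" "r \<noteq> []"
  using assms presentation by (auto simp: semigroup_presentation_def nonempty_words_def)

text \<open>
  Both sides of a relation are non-empty, so no edge starts or ends at the empty word.
\<close>

lemma is_path_squier_complex0:
  "is_path K u \<pi> v \<and> u \<noteq> [] \<longleftrightarrow> is_path (squier_complex P) u \<pi> v"
proof (induction \<pi> arbitrary: u)
  case Nil
  then show ?case by (auto simp: nonempty_words_def)
next
  case (Cons d \<pi>)
  obtain p l r q s where d: "d = ((p, (l, r), q), s)" by (metis prod.exhaust)
  have "(l, r) \<in> relations P \<Longrightarrow> tgt (squier_complex P) d \<noteq> []"
    using relation_words[of l r] by (auto simp: d tgt_def)
  moreover have "u \<in> words P \<and> u \<noteq> [] \<longleftrightarrow> u \<in> nonempty_words P"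
    by (auto simp: nonempty_words_def)
  ultimately show ?case using Cons.IH[of "tgt (squier_complex P) d"]
    by (auto simp: d src_squier_complex0 tgt_squier_complex0)
qed

lemma complex_squier_complex: "is_complex2 (squier_complex P)"
  using is_complex2_squier_complex[OF presentation] .

lemma complex0: "is_complex2 K"
  unfolding is_complex2_def
proof (intro conjI ballI)
  fix e assume "e \<in> edges K"
  then show "initial K e \<in> verts K" "terminal K e \<in> verts K"
    by (cases e; auto dest: relation_words)+
next
  fix c assume "c \<in> cells K"
  then obtain v where "is_path (squier_complex P) v c v" "c \<noteq> []"
    using complex_squier_complex by (auto simp: is_complex2_def)
  then show "\<exists>v. is_path K v c v" "c \<noteq> []"
    using is_path_squier_complex0 by blast+
qed

sublocale complex2 K
  by unfold_locales (rule complex0)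

lemma homotopic_squier_complex0:
  "u \<noteq> [] \<Longrightarrow> homotopic K u v \<pi> \<rho> \<longleftrightarrow> homotopic (squier_complex P) u v \<pi> \<rho>"
proof
  have cell: "homotopic L v v c []" if "is_path L v c v" "c \<in> cells L" for L :: "('a list, 'a squier_edge) complex2" and c v
    using homotopic_cell[of L v "[]" c "[]" v] that by simp
  assume u: "u \<noteq> []"
  { assume *: "homotopic K u v \<pi> \<rho>"
    have "complex_map K {u. u \<noteq> []} (squier_complex P) (\<lambda>u. u) (\<lambda>e. [(e, True)])"
    proof
      fix e assume e: "e \<in> edges K" "initial K e \<in> {u. u \<noteq> []}"
      then show "is_path (squier_complex P) (initial K e) [(e, True)] (terminal K e)"
        using is_path_edge[OF complex0 e(1)] is_path_squier_complex0 by blast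
    next
      fix e assume "e \<in> edges K"
      then show "initial K e \<in> {u. u \<noteq> []} \<longleftrightarrow> terminal K e \<in> {u. u \<noteq> []}"
        by (cases e) (auto dest: relation_words)
    next
      fix c v assume "c \<in> cells K" "is_path K v c v" "v \<in> {u. u \<noteq> []}"
      then show "homotopic (squier_complex P) v v (path_map (\<lambda>e. [(e, True)]) c) []"
        using is_path_squier_complex0[of v c v] by (auto simp: path_map_id intro: cell)
    qed (auto simp: nonempty_words_def complex0 complex_squier_complex)
    from complex_map.homotopic_path_map[OF this *] u show "homotopic (squier_complex P) u v \<pi> \<rho>"
      by (simp add: path_map_id) }
  { assume *: "homotopic (squier_complex P) u v \<pi> \<rho>"
    have "complex_map (squier_complex P) UNIV K (\<lambda>u. u) (\<lambda>e. [(e, True)])"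
    proof
      fix e assume e: "e \<in> edges (squier_complex P)"
      then show "is_path K (initial (squier_complex P) e) [(e, True)] (terminal (squier_complex P) e)"
        using is_path_edge[OF complex_squier_complex e(1)] is_path_squier_complex0 by blast
    next
      fix c v assume "c \<in> cells (squier_complex P)" "is_path (squier_complex P) v c v"
      then show "homotopic K v v (path_map (\<lambda>e. [(e, True)]) c) []"
        using is_path_squier_complex0[of v c v] by (auto simp: path_map_id intro: cell)
    qed (auto simp: nonempty_words_def complex0 complex_squier_complex)
    from complex_map.homotopic_path_map[OF this *] show "homotopic K u v \<pi> \<rho>"
      by (simp add: path_map_id) }
qed

lemma diagram_group_eq:
  assumes "w \<noteq> []" shows "diagram_group P w = fundamental_group K w"
proof -
  have "loop_class (squier_complex P) w = loop_class K w"
    by (auto simp: loop_class_def homotopic_squier_complex0[OF assms])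
  moreover have "is_path (squier_complex P) w \<pi> w = is_path K w \<pi> w" for \<pi>
    using is_path_squier_complex0[of w \<pi> w] assms by blast
  ultimately show ?thesis by (simp add: diagram_group_def fundamental_group_def)
qed

text \<open>
  The words at the two ends of a 2-cell are arbitrary, so they absorb \<open>p\<close> and \<open>q\<close>.
\<close>

lemma cells_whisker:
  assumes "c \<in> cells (squier_complex P)" "p \<in> words P" "q \<in> words P"
  shows "whisker p c q \<in> cells (squier_complex P)"
proof -
  obtain p' z q' l1 r1 l2 r2 where "c = [((p', (l1, r1), z @ l2 @ q'), True), ((p' @ r1 @ z, (l2, r2), q'), True)] @
         path_inv [((p' @ l1 @ z, (l2, r2), q'), True), ((p', (l1, r1), z @ r2 @ q'), True)]"
    and "p' \<in> words P" "z \<in> words P" "q' \<in> words P" "(l1, r1) \<in> relations P" "(l2, r2) \<in> relations P"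
    using assms(1) by (auto simp: squier_complex_def)
  then show ?thesis using assms(2,3)
    by (auto simp: squier_complex_def path_inv_def edge_inv_def
        intro!: exI[of _ "p @ p'"] exI[of _ z] exI[of _ "q' @ q"])
qed

text \<open>
  With \<open>R = P\<close> this makes whiskering compatible with homotopy; with a proper subpresentation it places
  the complex of some \<open>\<P>\<^sub>x\<close> between two markers.
\<close>

lemma complex_map_whisker:
  assumes R: "semigroup_presentation R" "alphabet R \<subseteq> alphabet P" "relations R \<subseteq> relations P"
    and pq: "p \<in> words P" "q \<in> words P"
  shows "complex_map (squier_complex0 R) UNIV K (\<lambda>u. p @ u @ q)
    (\<lambda>(p', r, q'). [((p @ p', r, q' @ q), True)])"
proof -
  interpret R: squier R by unfold_locales fact
  have sub: "words R \<subseteq> words P" using R(2) by (auto simp: words_def)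
  have rel: "(l, r) \<in> relations P \<and> l \<in> words P \<and> r \<in> words P" if "(l, r) \<in> relations R" for l r
    using R(3) relation_words[of l r] that by blast
  have edge: "is_path K (p @ initial (squier_complex0 R) e @ q)
      ((\<lambda>(p', r, q'). [((p @ p', r, q' @ q), True)]) e) (p @ terminal (squier_complex0 R) e @ q)"
    if "e \<in> edges (squier_complex0 R)" for e
    using that sub pq by (cases e) (auto simp: src_def tgt_def subset_iff dest: rel)
  have path: "is_path K (p @ u @ q) (whisker p \<pi> q) (p @ v @ q)"
    if "is_path (squier_complex0 R) u \<pi> v" for u \<pi> v
    using that
  proof (induction \<pi> arbitrary: u)
    case Nil then show ?case using sub pq by auto
  next
    case (Cons d \<pi>)
    obtain p' l r q' s where d: "d = ((p', (l, r), q'), s)" by (metis prod.exhaust)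
    have e: "(p', (l, r), q') \<in> edges (squier_complex0 R)" "src (squier_complex0 R) d = u"
      "is_path (squier_complex0 R) (tgt (squier_complex0 R) d) \<pi> v"
      using Cons.prems d by auto
    have "is_path K (p @ u @ q) [((p @ p', (l, r), q' @ q), s)] (p @ tgt (squier_complex0 R) d @ q)"
      using e sub pq by (cases s) (auto simp: d src_def tgt_def dest: rel)
    from is_path_appendI[OF this Cons.IH[OF e(3)]] show ?case by (simp add: d)
  qed
  have "cells (squier_complex R) \<subseteq> cells (squier_complex P)"
    unfolding squier_complex_def using sub R(3) by (simp add: subset_iff) blast
  then have cell: "homotopic K (p @ v @ q) (p @ v @ q) (whisker p c q) []"
    if "c \<in> cells (squier_complex R)" "is_path (squier_complex0 R) v c v" for c v
    using homotopic_cell[of K "p @ v @ q" "[]" "whisker p c q" "[]" "p @ v @ q"] that path cells_whisker pq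
    by auto
  show ?thesis
    by unfold_locales (use R.complex0 complex0 sub pq edge cell in \<open>auto simp: path_map_whisker\<close>)
qed

lemmas complex_map_whisker_self = complex_map_whisker[OF presentation order_refl order_refl]

lemma is_path_whisker:
  assumes "is_path K u \<pi> v" "p \<in> words P" "q \<in> words P"
  shows "is_path K (p @ u @ q) (whisker p \<pi> q) (p @ v @ q)"
  using complex_map.is_path_path_map[OF complex_map_whisker_self[OF assms(2,3)] assms(1)]
  by (simp add: path_map_whisker)

lemma homotopic_whisker:
  assumes "homotopic K u v \<pi> \<rho>" "p \<in> words P" "q \<in> words P"
  shows "homotopic K (p @ u @ q) (p @ v @ q) (whisker p \<pi> q) (whisker p \<rho> q)"
  using complex_map.homotopic_path_map[OF complex_map_whisker_self[OF assms(2,3)] assms(1)]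
  by (simp add: path_map_whisker)

text \<open>
  Moves on two adjacent words can be carried out in either order.  On two positive edges this is a
  2-cell.  For a fixed edge on the right the claim is naturality in the path on the left, and then for
  a fixed path on the left it is naturality in the path on the right, so \<open>path_map_natural\<close> applies
  twice.
\<close>

lemma interchange:
  assumes \<pi>: "is_path K u \<pi> u'" and \<rho>: "is_path K v \<rho> v'"
  shows "homotopic K (u @ v) (u' @ v')
    (whisker [] \<pi> v @ whisker u' \<rho> []) (whisker u \<rho> [] @ whisker [] \<pi> v')"
proof -
  have edge_edge: "homotopic K (initial K e @ initial K d) (terminal K e @ terminal K d)
      (whisker (initial K e) [(d, True)] [] @ whisker [] [(e, True)] (terminal K d))
      (whisker [] [(e, True)] (initial K d) @ whisker (terminal K e) [(d, True)] [])"
    if ed: "e \<in> edges K" "d \<in> edges K" for e d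
  proof -
    obtain p1 l1 r1 q1 p2 l2 r2 q2 where e: "e = (p1, (l1, r1), q1)" and d: "d = (p2, (l2, r2), q2)"
      by (metis prod.exhaust)
    let ?a = "whisker [] [(e, True)] (initial K d) @ whisker (terminal K e) [(d, True)] []"
    let ?b = "whisker (initial K e) [(d, True)] [] @ whisker [] [(e, True)] (terminal K d)"
    have "?a @ path_inv ?b \<in> cells K"
      unfolding squier_complex0_simps(5) using ed
      by (auto simp: squier_complex_def e d path_inv_def edge_inv_def
          intro!: exI[of _ p1] exI[of _ "q1 @ p2"] exI[of _ q2])
    moreover have b: "is_path K (initial K e @ initial K d) ?b (terminal K e @ terminal K d)"
      and a: "is_path K (initial K e @ initial K d) ?a (terminal K e @ terminal K d)"
      using ed relation_words by (auto simp: e d src_def tgt_def)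
    ultimately have "homotopic K (initial K e @ initial K d) (initial K e @ initial K d) (?a @ path_inv ?b) []"
      using homotopic_cell[of K _ "[]" "?a @ path_inv ?b" "[]"] is_path_appendI[OF a is_path_inv[OF b]] by simp
    from null_imp_homotopic[OF this a b] show ?thesis by (rule homotopic_sym)
  qed
  have path_edge: "homotopic K (u @ initial K d) (u' @ terminal K d)
      (whisker u [(d, True)] [] @ whisker [] \<pi> (terminal K d))
      (whisker [] \<pi> (initial K d) @ whisker u' [(d, True)] [])"
    if d: "d \<in> edges K" for d
  proof -
    have dw: "initial K d \<in> words P" "terminal K d \<in> words P"
      using d complex0 by (auto simp: is_complex2_def)
    have "homotopic K ([] @ u @ initial K d) ([] @ u' @ terminal K d)
        (whisker u [(d, True)] [] @ path_map (\<lambda>(p', r, q'). [(([] @ p', r, q' @ terminal K d), True)]) \<pi>)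
        (path_map (\<lambda>(p', r, q'). [(([] @ p', r, q' @ initial K d), True)]) \<pi> @ whisker u' [(d, True)] [])"
    proof (rule path_map_natural[OF complex_map_whisker_self complex_map_whisker_self _ _ \<pi>])
      fix u assume "u \<in> verts K"
      then show "is_path K ([] @ u @ initial K d) (whisker u [(d, True)] []) ([] @ u @ terminal K d)"
        using is_path_whisker[OF is_path_edge[OF complex0 d], of u "[]"] by simp
    next
      fix e assume "e \<in> edges K"
      from edge_edge[OF this d]
      show "homotopic K ([] @ initial K e @ initial K d) ([] @ terminal K e @ terminal K d)
        (whisker (initial K e) [(d, True)] [] @ (\<lambda>(p', r, q'). [(([] @ p', r, q' @ terminal K d), True)]) e)
        ((\<lambda>(p', r, q'). [(([] @ p', r, q' @ initial K d), True)]) e @ whisker (terminal K e) [(d, True)] [])"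
        by (cases e) simp
    qed (use dw in auto)
    then show ?thesis unfolding path_map_whisker by simp
  qed
  have uu': "u \<in> words P" "u' \<in> words P" using is_path_verts[OF \<pi>] by auto
  have "homotopic K (u @ v @ []) (u' @ v' @ [])
      (whisker [] \<pi> v @ path_map (\<lambda>(p', r, q'). [((u' @ p', r, q' @ []), True)]) \<rho>)
      (path_map (\<lambda>(p', r, q'). [((u @ p', r, q' @ []), True)]) \<rho> @ whisker [] \<pi> v')"
  proof (rule path_map_natural[OF complex_map_whisker_self complex_map_whisker_self _ _ \<rho>])
    fix v assume "v \<in> verts K"
    then show "is_path K (u @ v @ []) (whisker [] \<pi> v) (u' @ v @ [])"
      using is_path_whisker[OF \<pi>, of "[]" v] by simp
  next
    fix e assume "e \<in> edges K"
    from homotopic_sym[OF path_edge[OF this]]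
    show "homotopic K (u @ initial K e @ []) (u' @ terminal K e @ [])
      (whisker [] \<pi> (initial K e) @ (\<lambda>(p', r, q'). [((u' @ p', r, q' @ []), True)]) e)
      ((\<lambda>(p', r, q'). [((u @ p', r, q' @ []), True)]) e @ whisker [] \<pi> (terminal K e))"
      by (cases e) simp
  qed (use uu' in auto)
  then show ?thesis unfolding path_map_whisker by simp
qed

end


section \<open>The total complex of a diagram product\<close>

text \<open>
  The elementary moves of a diagram product, without the words around them: a relation of the
  presentation, or an element of the group at a single letter.
\<close>

datatype ('a, 'g) label = Rel "'a list" "'a list" | Elt 'a 'g

fun label_source :: "('a, 'g) label \<Rightarrow> 'a list" where
  "label_source (Rel s t) = s"
| "label_source (Elt x g) = [x]"

fun label_target :: "('a, 'g) label \<Rightarrow> 'a list" where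
  "label_target (Rel s t) = t"
| "label_target (Elt x g) = [x]"

locale group_family =
  fixes Q :: "'a presentation" and H :: "'a \<Rightarrow> 'g monoid"
  assumes Q: "semigroup_presentation Q" and H: "\<And>x. x \<in> alphabet Q \<Longrightarrow> group (H x)"
begin

interpretation Q: squier Q by unfold_locales (rule Q)

abbreviation "G \<equiv> word_group H"
abbreviation "id_word u \<equiv> \<one>\<^bsub>G u\<^esub>"
abbreviation "T \<equiv> total_complex (diagram_product_complex H Q)"

lemma complex_T: "is_complex2 T"
  by (intro is_complex2_total_complex is_complex_of_groups_diagram_product_complex Q ballI H)

sublocale T: complex2 T by unfold_locales (rule complex_T)

lemma T_simps [simp]:
  "verts T = nonempty_words Q"
  "edges T = Inl ` (words Q \<times> relations Q \<times> words Q) \<union> Inr ` (SIGMA u:nonempty_words Q. carrier (G u))"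
  "initial T (Inl (p, (l, r), q)) = p @ l @ q"
  "terminal T (Inl (p, (l, r), q)) = p @ r @ q"
  "initial T (Inr (u, g)) = u"
  "terminal T (Inr (u, g)) = u"
  by (simp_all add: total_complex_def diagram_product_complex_def Let_def)

lemma cells_T:
  "cells T = map (map_prod Inl id) ` cells (squier_complex Q) \<union>
    {[(Inr (u, g), True), (Inr (u, h), True), (Inr (u, g \<otimes>\<^bsub>G u\<^esub> h), False)]
      | u g h. u \<in> nonempty_words Q \<and> g \<in> carrier (G u) \<and> h \<in> carrier (G u)} \<union>
    {[(Inl (p, (s, t), q), False), (Inr (p @ s @ q, a @ id_word s @ b), True),
      (Inl (p, (s, t), q), True), (Inr (p @ t @ q, a @ id_word t @ b), False)]
      | p s t q a b. p \<in> words Q \<and> (s, t) \<in> relations Q \<and> q \<in> words Q \<and>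
        a \<in> carrier (G p) \<and> b \<in> carrier (G q)}"
proof -
  have "{[(Inl e, False), (Inr (initial (squier_complex Q) e, initial_emb (diagram_product_complex H Q) e a), True),
          (Inl e, True), (Inr (terminal (squier_complex Q) e, terminal_emb (diagram_product_complex H Q) e a), False)]
         | e a. e \<in> edges (squier_complex Q) \<and> a \<in> carrier (edge_group (diagram_product_complex H Q) e)} =
    {[(Inl (p, (s, t), q), False), (Inr (p @ s @ q, a @ id_word s @ b), True),
      (Inl (p, (s, t), q), True), (Inr (p @ t @ q, a @ id_word t @ b), False)]
      | p s t q a b. p \<in> words Q \<and> (s, t) \<in> relations Q \<and> q \<in> words Q \<and>
        a \<in> carrier (G p) \<and> b \<in> carrier (G q)}" (is "?A = ?B")
  proof
    show "?A \<subseteq> ?B"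
      by (clarsimp simp: diagram_product_complex_def DirProd_def)
    show "?B \<subseteq> ?A"
      by (clarsimp simp: diagram_product_complex_def DirProd_def)
  qed
  then show ?thesis
    unfolding total_complex_def Let_def by (simp add: diagram_product_complex_def)
qed

lemma group_G: "u \<in> words Q \<Longrightarrow> group (G u)"
  unfolding word_group_def
  by (rule DirProd_list_is_group) (use H in \<open>auto simp: words_def dest!: nth_mem\<close>)

lemma carrier_G_Nil [simp]: "carrier (G []) = {[]}"
  by (simp add: word_group_def DirProd_list_def)

lemma carrier_G_Cons: "carrier (G (x # u)) = {g # gs | g gs. g \<in> carrier (H x) \<and> gs \<in> carrier (G u)}"
  by (auto simp: word_group_def DirProd_list_carrier)

lemma carrier_G_append: "a \<in> carrier (G u) \<Longrightarrow> b \<in> carrier (G v) \<Longrightarrow> a @ b \<in> carrier (G (u @ v))"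
  by (simp add: word_group_def DirProd_list_append_carrier)

lemma length_carrier_G: "g \<in> carrier (G u) \<Longrightarrow> length g = length u"
  by (induction u arbitrary: g) (auto simp: carrier_G_Cons)

lemma id_word_append: "id_word (u @ v) = id_word u @ id_word v"
proof -
  have "foldr (\<lambda>G. (#) \<one>\<^bsub>G\<^esub>) (us @ vs) [] = foldr (\<lambda>G. (#) \<one>\<^bsub>G\<^esub>) us [] @ foldr (\<lambda>G. (#) \<one>\<^bsub>G\<^esub>) vs []"
    for us vs :: "'g monoid list"
    by (induction us) auto
  then show ?thesis by (simp add: word_group_def DirProd_list_one)
qed

lemma id_word_single [simp]: "id_word [x] = [\<one>\<^bsub>H x\<^esub>]"
  and id_word_Nil [simp]: "id_word [] = []"
  by (simp_all add: word_group_def DirProd_list_one)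

lemma id_word_Cons: "id_word (x # u) = \<one>\<^bsub>H x\<^esub> # id_word u"
  using id_word_append[of "[x]" u] by simp

lemma id_word_closed: "u \<in> words Q \<Longrightarrow> id_word u \<in> carrier (G u)"
  by (rule monoid.one_closed[OF group.is_monoid[OF group_G]])

lemma mult_append:
  "a \<in> carrier (G u) \<Longrightarrow> a' \<in> carrier (G u) \<Longrightarrow> b \<in> carrier (G v) \<Longrightarrow> b' \<in> carrier (G v) \<Longrightarrow>
   (a @ b) \<otimes>\<^bsub>G (u @ v)\<^esub> (a' @ b') = (a \<otimes>\<^bsub>G u\<^esub> a') @ (b \<otimes>\<^bsub>G v\<^esub> b')"
  by (simp add: word_group_def DirProd_list_mult_append)

lemma mult_Cons:
  "g \<in> carrier (H x) \<Longrightarrow> h \<in> carrier (H x) \<Longrightarrow> b \<in> carrier (G v) \<Longrightarrow> b' \<in> carrier (G v) \<Longrightarrow>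
   (g # b) \<otimes>\<^bsub>G (x # v)\<^esub> (h # b') = (g \<otimes>\<^bsub>H x\<^esub> h) # (b \<otimes>\<^bsub>G v\<^esub> b')"
  by (simp add: word_group_def DirProd_list_mult_Cons)

lemma one_mult:
  "u \<in> words Q \<Longrightarrow> g \<in> carrier (G u) \<Longrightarrow> id_word u \<otimes>\<^bsub>G u\<^esub> g = g"
  "u \<in> words Q \<Longrightarrow> g \<in> carrier (G u) \<Longrightarrow> g \<otimes>\<^bsub>G u\<^esub> id_word u = g"
  by (simp_all add: group.is_monoid group_G monoid.l_one monoid.r_one)

lemma is_path_loop:
  "u \<in> nonempty_words Q \<Longrightarrow> g \<in> carrier (G u) \<Longrightarrow> is_path T u [(Inr (u, g), True)] u"
  using is_path_edge[OF complex_T, of "Inr (u, g)"] by simp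

lemma is_path_relation:
  "p \<in> words Q \<Longrightarrow> (s, t) \<in> relations Q \<Longrightarrow> q \<in> words Q \<Longrightarrow>
   is_path T (p @ s @ q) [(Inl (p, (s, t), q), True)] (p @ t @ q)"
  using is_path_edge[OF complex_T, of "Inl (p, (s, t), q)"] by (simp add: image_iff del: is_path.simps)

lemma loop_mult:
  assumes "u \<in> nonempty_words Q" "g \<in> carrier (G u)" "h \<in> carrier (G u)"
  shows "homotopic T u u [(Inr (u, g), True), (Inr (u, h), True)] [(Inr (u, g \<otimes>\<^bsub>G u\<^esub> h), True)]"
proof -
  let ?c = "[(Inr (u, g), True), (Inr (u, h), True)] @ path_inv [(Inr (u, g \<otimes>\<^bsub>G u\<^esub> h), True)]"
  have "?c \<in> cells T"
    unfolding cells_T path_inv_single using assms by auto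
  moreover have gh: "g \<otimes>\<^bsub>G u\<^esub> h \<in> carrier (G u)"
    using assms group_G[of u] by (auto simp: nonempty_words_def intro!: monoid.m_closed group.is_monoid)
  have a: "is_path T u [(Inr (u, g), True), (Inr (u, h), True)] u"
    using is_path_appendI[OF is_path_loop is_path_loop, of u g h] assms by simp
  note b = is_path_loop[OF assms(1) gh]
  have "is_path T u ?c u" by (rule is_path_appendI[OF a T.is_path_inv[OF b]])
  ultimately have "homotopic T u u ?c []" using homotopic_cell[of T u "[]" ?c "[]" u] by simp
  from T.null_imp_homotopic[OF this a b] show ?thesis .
qed

text \<open>
  The 2-cell of the product of the identity with itself gives \<open>1\<^sub>u 1\<^sub>u = 1\<^sub>u\<close>, and an idempotent of a
  group is trivial.
\<close>

lemma loop_one: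
  assumes "u \<in> nonempty_words Q"
  shows "homotopic T u u [(Inr (u, id_word u), True)] []"
proof -
  let ?e = "[(Inr (u, id_word u), True)]"
  have u: "u \<in> words Q" using assms by (simp add: nonempty_words_def)
  note e = is_path_loop[OF assms id_word_closed[OF u]]
  have "homotopic T u u (?e @ ?e) ?e"
    using loop_mult[OF assms id_word_closed id_word_closed] one_mult[OF u id_word_closed] u by simp
  from T.homotopic_append_right[OF this T.is_path_inv[OF e]]
  have "homotopic T u u (?e @ ?e @ path_inv ?e) (?e @ path_inv ?e)" by simp
  moreover have "homotopic T u u (?e @ ?e @ path_inv ?e) ?e"
    using T.homotopic_append_left[OF e T.inv_right[OF e]] by simp
  ultimately show ?thesis using T.inv_right[OF e] by (blast intro: homotopic_trans homotopic_sym)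
qed

text \<open>
  This is the 2-cell of an edge, with \<open>e\<inverse> g e \<simeq> h\<close> rewritten as \<open>g e \<simeq> e h\<close>.
\<close>

lemma edge_slide:
  assumes p: "p \<in> words Q" and st: "(s, t) \<in> relations Q" and q: "q \<in> words Q"
    and ab: "a \<in> carrier (G p)" "b \<in> carrier (G q)"
  shows "homotopic T (p @ s @ q) (p @ t @ q)
    [(Inr (p @ s @ q, a @ id_word s @ b), True), (Inl (p, (s, t), q), True)]
    [(Inl (p, (s, t), q), True), (Inr (p @ t @ q, a @ id_word t @ b), True)]"
proof -
  let ?e = "[(Inl (p, (s, t), q), True)]"
  let ?g = "[(Inr (p @ s @ q, a @ id_word s @ b), True)]"
  let ?h = "[(Inr (p @ t @ q, a @ id_word t @ b), True)]"
  let ?c = "path_inv ?e @ ?g @ ?e @ path_inv ?h"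
  have v: "p @ s @ q \<in> nonempty_words Q" "p @ t @ q \<in> nonempty_words Q" "s \<in> words Q" "t \<in> words Q"
    using Q.relation_words[OF st] p q by (auto simp: nonempty_words_def)
  have c: "?c \<in> cells T"
    unfolding cells_T path_inv_single append_Cons append_Nil using p st q ab by blast
  have g: "is_path T (p @ s @ q) ?g (p @ s @ q)" and h: "is_path T (p @ t @ q) ?h (p @ t @ q)"
    using v ab by (intro is_path_loop carrier_G_append id_word_closed; simp)+
  note e = is_path_relation[OF p st q]
  have "is_path T (p @ t @ q) ?c (p @ t @ q)"
    by (rule is_path_appendI[OF T.is_path_inv[OF e] is_path_appendI[OF g is_path_appendI[OF e T.is_path_inv[OF h]]]])
  with c have "homotopic T (p @ t @ q) (p @ t @ q) ((path_inv ?e @ ?g @ ?e) @ path_inv ?h) []"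
    using homotopic_cell[of T "p @ t @ q" "[]" ?c "[]" "p @ t @ q"] by simp
  then have "homotopic T (p @ t @ q) (p @ t @ q) (path_inv ?e @ ?g @ ?e) ?h"
    by (rule T.null_imp_homotopic[OF _ is_path_appendI[OF T.is_path_inv[OF e] is_path_appendI[OF g e]] h])
  from T.homotopic_append_left[OF e this]
  have "homotopic T (p @ s @ q) (p @ t @ q) (?e @ path_inv ?e @ ?g @ ?e) (?e @ ?h)" by simp
  moreover have "homotopic T (p @ s @ q) (p @ t @ q) (?e @ path_inv ?e @ ?g @ ?e) (?g @ ?e)"
    using T.homotopic_append_right[OF T.inv_right[OF e] is_path_appendI[OF g e]] by simp
  ultimately show ?thesis by (auto intro: homotopic_trans homotopic_sym)
qed

fun label_ok :: "('a, 'g) label \<Rightarrow> bool" where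
  "label_ok (Rel s t) \<longleftrightarrow> (s, t) \<in> relations Q"
| "label_ok (Elt x g) \<longleftrightarrow> x \<in> alphabet Q \<and> g \<in> carrier (H x)"

fun label_edge :: "'a list \<Rightarrow> ('a, 'g) label \<Rightarrow> 'a list \<Rightarrow> 'a squier_edge + 'a list \<times> 'g list" where
  "label_edge p (Rel s t) q = Inl (p, (s, t), q)"
| "label_edge p (Elt x g) q = Inr (p @ [x] @ q, id_word p @ [g] @ id_word q)"

lemma label_edge:
  assumes "label_ok l" "p \<in> words Q" "q \<in> words Q"
  shows "is_path T (p @ label_source l @ q) [(label_edge p l q, True)] (p @ label_target l @ q)"
proof (cases l)
  case (Rel s t)
  then show ?thesis using assms is_path_relation[of p s t q] by (simp del: is_path.simps)
next
  case (Elt x g)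
  have "[g] \<in> carrier (G [x])" using assms Elt by (simp add: carrier_G_Cons)
  then have "id_word p @ [g] @ id_word q \<in> carrier (G (p @ [x] @ q))"
    using assms by (intro carrier_G_append id_word_closed)
  then show ?thesis using assms Elt is_path_loop[of "p @ [x] @ q"]
    by (simp add: nonempty_words_def words_Cons)
qed

text \<open>
  The counterpart of \<open>interchange\<close>.  Two relations commute by a 2-cell of the Squier complex, a
  relation and an element by the 2-cell of an edge, and two elements because they sit in different
  factors of the direct product.
\<close>

lemma label_interchange:
  assumes ok: "label_ok l1" "label_ok l2" and w: "p \<in> words Q" "z \<in> words Q" "q \<in> words Q"
  shows "homotopic T (p @ label_source l1 @ z @ label_source l2 @ q) (p @ label_target l1 @ z @ label_target l2 @ q)
     [(label_edge p l1 (z @ label_source l2 @ q), True), (label_edge (p @ label_target l1 @ z) l2 q, True)]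
     [(label_edge (p @ label_source l1 @ z) l2 q, True), (label_edge p l1 (z @ label_target l2 @ q), True)]"
proof (cases l1; cases l2)
  fix s t s' t' assume l: "l1 = Rel s t" "l2 = Rel s' t'"
  let ?a = "[(Inl (p, (s, t), z @ s' @ q), True), (Inl (p @ t @ z, (s', t'), q), True)]"
  let ?b = "[(Inl (p @ s @ z, (s', t'), q), True), (Inl (p, (s, t), z @ t' @ q), True)]"
  let ?c = "[((p, (s, t), z @ s' @ q), True), ((p @ t @ z, (s', t'), q), True)] @
    path_inv [((p @ s @ z, (s', t'), q), True), ((p, (s, t), z @ t' @ q), True)]"
  have "?c \<in> cells (squier_complex Q)"
    using ok w unfolding l squier_complex_def by auto
  then have "map (map_prod Inl id) ?c \<in> cells T" unfolding cells_T by blast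
  then have c: "?a @ path_inv ?b \<in> cells T" by (simp add: path_inv_def edge_inv_def)
  have a: "is_path T (p @ s @ z @ s' @ q) ?a (p @ t @ z @ t' @ q)"
    using is_path_appendI[OF is_path_relation[of p s t "z @ s' @ q"], of "[(Inl (p @ t @ z, (s', t'), q), True)]"]
      is_path_relation[of "p @ t @ z" s' t' q] ok w Q.relation_words unfolding l by auto
  have b: "is_path T (p @ s @ z @ s' @ q) ?b (p @ t @ z @ t' @ q)"
    using is_path_appendI[OF is_path_relation[of "p @ s @ z" s' t' q], of "[(Inl (p, (s, t), z @ t' @ q), True)]"]
      is_path_relation[of p s t "z @ t' @ q"] ok w Q.relation_words unfolding l by auto
  show ?thesis
    using T.null_imp_homotopic[OF _ a b] homotopic_cell[of T _ "[]" "?a @ path_inv ?b" "[]"] c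
      is_path_appendI[OF a T.is_path_inv[OF b]] unfolding l by simp
next
  fix s t x g assume l: "l1 = Rel s t" "l2 = Elt x g"
  have "[g] \<in> carrier (G [x])" using ok l by (simp add: carrier_G_Cons)
  then have "id_word z @ [g] @ id_word q \<in> carrier (G (z @ [x] @ q))"
    using w by (intro carrier_G_append id_word_closed)
  from homotopic_sym[OF edge_slide[OF w(1) _ _ id_word_closed[OF w(1)] this, of s t]]
  show ?thesis using ok w by (simp add: l id_word_append words_Cons)
next
  fix s t x g assume l: "l2 = Rel s t" "l1 = Elt x g"
  have "[g] \<in> carrier (G [x])" using ok l by (simp add: carrier_G_Cons)
  then have "id_word p @ [g] @ id_word z \<in> carrier (G (p @ [x] @ z))"
    using w by (intro carrier_G_append id_word_closed)
  from edge_slide[OF _ _ w(3) this id_word_closed[OF w(3)], of s t]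
  show ?thesis using ok w by (simp add: l id_word_append words_Cons)
next
  fix x g y h assume l: "l1 = Elt x g" "l2 = Elt y h"
  let ?u = "p @ [x] @ z @ [y] @ q"
  have x: "[x] \<in> words Q" "[y] \<in> words Q" using ok l by (auto simp: words_Cons)
  have g: "[g] \<in> carrier (G [x])" "[h] \<in> carrier (G [y])" using ok l by (auto simp: carrier_G_Cons)
  let ?g = "id_word p @ [g] @ id_word z @ id_word [y] @ id_word q"
  let ?h = "id_word p @ id_word [x] @ id_word z @ [h] @ id_word q"
  have c: "?g \<in> carrier (G ?u)" "?h \<in> carrier (G ?u)"
    by (intro carrier_G_append id_word_closed g w x)+
  have comm: "?g \<otimes>\<^bsub>G ?u\<^esub> ?h = ?h \<otimes>\<^bsub>G ?u\<^esub> ?g"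
    by (simp only: mult_append carrier_G_append id_word_closed g w x one_mult)
  have u: "?u \<in> nonempty_words Q" using w x by (simp add: nonempty_words_def words_Cons)
  have "homotopic T ?u ?u [(Inr (?u, ?g), True), (Inr (?u, ?h), True)] [(Inr (?u, ?h), True), (Inr (?u, ?g), True)]"
    using homotopic_trans[OF loop_mult[OF u c, unfolded comm] homotopic_sym[OF loop_mult[OF u c(2,1)]]] .
  then show ?thesis by (simp add: l id_word_append id_word_Cons)
qed

lemma label_mult:
  assumes "x \<in> alphabet Q" "g \<in> carrier (H x)" "h \<in> carrier (H x)" and w: "p \<in> words Q" "q \<in> words Q"
  shows "homotopic T (p @ [x] @ q) (p @ [x] @ q)
    [(label_edge p (Elt x g) q, True), (label_edge p (Elt x h) q, True)] [(label_edge p (Elt x (g \<otimes>\<^bsub>H x\<^esub> h)) q, True)]"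
proof -
  have x: "[x] \<in> words Q" using assms by (auto simp: words_Cons)
  have g: "[g] \<in> carrier (G [x])" "[h] \<in> carrier (G [x])" using assms by (auto simp: carrier_G_Cons)
  let ?g = "id_word p @ [g] @ id_word q"
  let ?h = "id_word p @ [h] @ id_word q"
  let ?u = "p @ [x] @ q"
  have c: "?g \<in> carrier (G ?u)" "?h \<in> carrier (G ?u)"
    by (intro carrier_G_append id_word_closed g w x)+
  have "?g \<otimes>\<^bsub>G ?u\<^esub> ?h = id_word p @ ([g] \<otimes>\<^bsub>G [x]\<^esub> [h]) @ id_word q"
    by (simp only: mult_append carrier_G_append id_word_closed g w x one_mult)
  also have "[g] \<otimes>\<^bsub>G [x]\<^esub> [h] = [g \<otimes>\<^bsub>H x\<^esub> h]"
    using mult_Cons[OF assms(2,3), of "[]" "[]" "[]"] one_mult(1)[of "[]" "[]"] by simp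
  finally have "?g \<otimes>\<^bsub>G ?u\<^esub> ?h = id_word p @ [g \<otimes>\<^bsub>H x\<^esub> h] @ id_word q" .
  moreover have u: "?u \<in> nonempty_words Q" using w x by (simp add: nonempty_words_def words_Cons)
  ultimately show ?thesis using loop_mult[OF u c] by simp
qed

lemma label_one:
  assumes "x \<in> alphabet Q" and w: "p \<in> words Q" "q \<in> words Q"
  shows "homotopic T (p @ [x] @ q) (p @ [x] @ q) [(label_edge p (Elt x \<one>\<^bsub>H x\<^esub>) q, True)] []"
  using loop_one[of "p @ [x] @ q"] assms by (simp add: nonempty_words_def id_word_append id_word_Cons words_Cons)

lemma label_inverse:
  assumes "x \<in> alphabet Q" "g \<in> carrier (H x)" "h \<in> carrier (H x)" "g \<otimes>\<^bsub>H x\<^esub> h = \<one>\<^bsub>H x\<^esub>"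
    and w: "p \<in> words Q" "q \<in> words Q"
  shows "homotopic T (p @ [x] @ q) (p @ [x] @ q)
    [(label_edge p (Elt x g) q, False)] [(label_edge p (Elt x h) q, True)]"
proof -
  let ?g = "[(label_edge p (Elt x g) q, True)]" and ?h = "[(label_edge p (Elt x h) q, True)]"
  have "homotopic T (p @ [x] @ q) (p @ [x] @ q) (?g @ ?h) []"
    using label_mult[OF assms(1-3) w] label_one[OF assms(1) w] assms(4)
    by (auto intro: homotopic_trans)
  from T.inverse_unique[OF this] show ?thesis
    using label_edge[of "Elt x g", OF _ w] label_edge[of "Elt x h", OF _ w] assms
    by (simp add: path_inv_single del: is_path.simps)
qed

end


section \<open>The composite presentation\<close>

text \<open>
  \<open>(x, None)\<close> stands for the letter \<open>x\<close> and \<open>(x, Some w)\<close> for the word \<open>a\<^sub>x w a\<^sub>x\<close>.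
\<close>

type_synonym 'a block = "'a \<times> 'a list option"

locale composite =
  fixes Q :: "'a presentation" and P :: "'a \<Rightarrow> 'a presentation" and wx :: "'a \<Rightarrow> 'a list" and a :: "'a \<Rightarrow> 'a"
  assumes Q: "semigroup_presentation Q"
    and P: "\<And>x. x \<in> alphabet Q \<Longrightarrow> semigroup_presentation (P x)"
    and wx: "\<And>x. x \<in> alphabet Q \<Longrightarrow> wx x \<in> nonempty_words (P x)"
    and inj_a: "inj_on a (alphabet Q)"
    and disjoint_Q_a: "alphabet Q \<inter> a ` alphabet Q = {}"
    and disjoint_Q_P: "\<And>x. x \<in> alphabet Q \<Longrightarrow> alphabet Q \<inter> alphabet (P x) = {}"
    and disjoint_a_P: "\<And>x. x \<in> alphabet Q \<Longrightarrow> a ` alphabet Q \<inter> alphabet (P x) = {}"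
    and disjoint_P: "disjoint_family_on (\<lambda>x. alphabet (P x)) (alphabet Q)"
begin

abbreviation C :: "'a presentation" where "C \<equiv> composite_presentation Q P wx a"
abbreviation "H \<equiv> \<lambda>x. diagram_group (P x) (wx x)"

sublocale Q: squier Q by unfold_locales (rule Q)

lemma squier_P: "x \<in> alphabet Q \<Longrightarrow> squier (P x)"
  by unfold_locales (rule P)

lemma a_eq: "x \<in> alphabet Q \<Longrightarrow> y \<in> alphabet Q \<Longrightarrow> a x = a y \<Longrightarrow> x = y"
  using inj_a by (auto dest: inj_onD)

lemma letters:
  "x \<in> alphabet Q \<Longrightarrow> y \<in> alphabet Q \<Longrightarrow> a x \<noteq> y"
  "x \<in> alphabet Q \<Longrightarrow> y \<in> alphabet Q \<Longrightarrow> a x \<notin> alphabet (P y)"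
  "x \<in> alphabet Q \<Longrightarrow> y \<in> alphabet Q \<Longrightarrow> x \<notin> alphabet (P y)"
  "x \<in> alphabet Q \<Longrightarrow> y \<in> alphabet Q \<Longrightarrow> c \<in> alphabet (P x) \<Longrightarrow> c \<in> alphabet (P y) \<Longrightarrow> x = y"
proof -
  show "x \<in> alphabet Q \<Longrightarrow> y \<in> alphabet Q \<Longrightarrow> a x \<noteq> y" using disjoint_Q_a by blast
  show "x \<in> alphabet Q \<Longrightarrow> y \<in> alphabet Q \<Longrightarrow> a x \<notin> alphabet (P y)" using disjoint_a_P[of y] by blast
  show "x \<in> alphabet Q \<Longrightarrow> y \<in> alphabet Q \<Longrightarrow> x \<notin> alphabet (P y)" using disjoint_Q_P[of y] by blast
  show "x \<in> alphabet Q \<Longrightarrow> y \<in> alphabet Q \<Longrightarrow> c \<in> alphabet (P x) \<Longrightarrow> c \<in> alphabet (P y) \<Longrightarrow> x = y"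
    using disjoint_P unfolding disjoint_family_on_def by blast
qed

lemma relation_C_cases:
  assumes "(l, r) \<in> relations C"
  obtains (S) "(l, r) \<in> relations Q"
    | (R) x where "x \<in> alphabet Q" "(l, r) \<in> relations (P x)"
    | (W) x where "x \<in> alphabet Q" "l = [x]" "r = a x # wx x @ [a x]"
  using assms by (auto simp: composite_presentation_def)

lemma relation_P:
  assumes "x \<in> alphabet Q" "(l, r) \<in> relations (P x)"
  shows "set l \<subseteq> alphabet (P x)" "set r \<subseteq> alphabet (P x)" "l \<noteq> []" "r \<noteq> []"
  using squier.relation_words[OF squier_P[OF assms(1)] assms(2)] by (auto simp: words_def)

lemma relation_Q:
  assumes "(l, r) \<in> relations Q"
  shows "set l \<subseteq> alphabet Q" "set r \<subseteq> alphabet Q" "l \<noteq> []" "r \<noteq> []"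
  using Q.relation_words[OF assms] by (auto simp: words_def)

text \<open>
  The two sides of a relation determine its kind: a relation of \<open>\<S>\<close> has both sides over \<open>X\<close>, one of
  \<open>\<R>\<^sub>x\<close> has both sides over \<open>\<Sigma>\<^sub>x\<close>, and \<open>x = a\<^sub>x w\<^sub>x a\<^sub>x\<close> has a marker on the right only.  Hence a
  relation can only be the reverse of one of the same kind.
\<close>

lemma semigroup_presentation_C: "semigroup_presentation C"
  unfolding semigroup_presentation_def
proof (intro conjI allI impI)
  have sub: "words Q \<subseteq> words C" "\<And>x. x \<in> alphabet Q \<Longrightarrow> words (P x) \<subseteq> words C" "\<And>x. x \<in> alphabet Q \<Longrightarrow> a x \<in> alphabet C"
    "alphabet Q \<subseteq> alphabet C"
    by (auto simp: words_def composite_presentation_def)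
  show "relations C \<subseteq> nonempty_words C \<times> nonempty_words C"
  proof clarify
    fix l r assume "(l, r) \<in> relations C"
    then show "l \<in> nonempty_words C \<and> r \<in> nonempty_words C"
    proof (cases rule: relation_C_cases)
      case S
      then show ?thesis using Q.relation_words[OF S] sub by (auto simp: nonempty_words_def)
    next
      case (R x)
      then show ?thesis using squier.relation_words[OF squier_P R(2)] sub by (auto simp: nonempty_words_def)
    next
      case (W x)
      then show ?thesis using sub wx[of x] by (auto simp: nonempty_words_def words_Cons)
    qed
  qed
next
  fix l r assume lr: "(l, r) \<in> relations C"
  show "(r, l) \<notin> relations C"
  proof
    assume rl: "(r, l) \<in> relations C"
    from lr show False
    proof (cases rule: relation_C_cases)
      case S
      note l = relation_Q[OF S]
      from rl show False
      proof (cases rule: relation_C_cases)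
        case S': S
        then show False using S Q by (auto simp: semigroup_presentation_def)
      next
        case (R x)
        then show False using l relation_P[OF R] letters(3)[OF _ R(1)] by (cases l) auto
      next
        case (W x)
        then show False using l letters(1)[OF W(1)] by auto
      qed
    next
      case (R x)
      note l = relation_P[OF R]
      from rl show False
      proof (cases rule: relation_C_cases)
        case S
        then show False using l relation_Q[OF S] letters(3)[OF _ R(1)] by (cases l) auto
      next
        case (R y)
        have "hd l \<in> set l" using l by simp
        then have "x = y" using relation_P[OF R] l \<open>x \<in> alphabet Q\<close> letters(4)[of x y "hd l"] R(1) by blast
        then show False using R \<open>(l, r) \<in> relations (P x)\<close> P by (auto simp: semigroup_presentation_def)
      next
        case (W y)
        then show False using l letters(3)[of y x] R by auto
      qed
    next
      case (W x)
      from rl show False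
      proof (cases rule: relation_C_cases)
        case S
        then show False using W relation_Q[OF S] letters(1)[of x "a x"] by auto
      next
        case (R y)
        then show False using W relation_P[OF R] letters(3)[of x y] by auto
      next
        case (W y)
        then show False using \<open>l = [x]\<close> by auto
      qed
    qed
  qed
qed

sublocale C: squier C by unfold_locales (rule semigroup_presentation_C)

abbreviation "Kx x \<equiv> squier_complex0 (P x)"

lemma H_eq: "x \<in> alphabet Q \<Longrightarrow> H x = fundamental_group (Kx x) (wx x)"
  using squier.diagram_group_eq[OF squier_P] wx by (auto simp: nonempty_words_def)

lemma group_H: "x \<in> alphabet Q \<Longrightarrow> group (H x)"
  unfolding H_eq using squier.complex0[OF squier_P] wx by (auto simp: nonempty_words_def intro!: group_fundamental_group)

sublocale D: group_family Q H
  by (rule group_family.intro[OF Q group_H])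

section \<open>Decomposition of words into blocks\<close>

definition component :: "'a \<Rightarrow> 'a list set" where
  "component x = {w. \<exists>\<pi>. is_path (Kx x) (wx x) \<pi> w}"

fun block_word :: "'a block \<Rightarrow> 'a list" where
  "block_word (x, None) = [x]"
| "block_word (x, Some w) = a x # w @ [a x]"

definition flat :: "'a block list \<Rightarrow> 'a list" where
  "flat bs = concat (map block_word bs)"

abbreviation base :: "'a block list \<Rightarrow> 'a list" where
  "base bs \<equiv> map fst bs"

fun valid_block :: "'a block \<Rightarrow> bool" where
  "valid_block (x, None) \<longleftrightarrow> x \<in> alphabet Q"
| "valid_block (x, Some w) \<longleftrightarrow> x \<in> alphabet Q \<and> w \<in> component x"

abbreviation valid :: "'a block list \<Rightarrow> bool" where
  "valid bs \<equiv> list_all valid_block bs"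

abbreviation letter_blocks :: "'a list \<Rightarrow> 'a block list" where
  "letter_blocks u \<equiv> map (\<lambda>x. (x, None)) u"

lemma flat_simps [simp]: "flat [] = []" "flat (b # bs) = block_word b @ flat bs"
    "flat (bs @ bs') = flat bs @ flat bs'"
  by (auto simp: flat_def)

lemma flat_letter_blocks [simp]: "flat (letter_blocks u) = u"
  by (induction u) auto

lemma base_letter_blocks [simp]: "map (fst \<circ> (\<lambda>x. (x, None))) u = u"
  by (induction u) auto

lemma valid_letter_blocks: "u \<in> words Q \<Longrightarrow> valid (letter_blocks u)"
  by (induction u) (auto simp: words_Cons)

lemma component_words: "x \<in> alphabet Q \<Longrightarrow> w \<in> component x \<Longrightarrow> w \<in> words (P x)"
  using is_path_verts(2) by (fastforce simp: component_def)

lemma words_base: "valid bs \<Longrightarrow> base bs \<in> words Q"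
proof (induction bs)
  case (Cons b bs)
  then show ?case by (cases b rule: block_word.cases) (auto simp: words_Cons)
qed simp

lemma words_C: "x \<in> alphabet Q \<Longrightarrow> x \<in> alphabet C" "x \<in> alphabet Q \<Longrightarrow> a x \<in> alphabet C" "x \<in> alphabet Q \<Longrightarrow> w \<in> words (P x) \<Longrightarrow> w \<in> words C"
    "u \<in> words Q \<Longrightarrow> u \<in> words C"
  by (auto simp: words_def composite_presentation_def)

lemma words_flat: "valid bs \<Longrightarrow> flat bs \<in> words C"
proof (induction bs)
  case (Cons b bs)
  then show ?case
    by (cases b rule: block_word.cases) (auto simp: words_Cons words_C component_words)
qed simp

text \<open>
  A position in a word over blocks lies between two blocks or strictly inside a block \<open>a\<^sub>x w a\<^sub>x\<close>.
\<close>

lemma flat_cut: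
  assumes "flat bs = p @ q"
  shows "(\<exists>bs1 bs2. bs = bs1 @ bs2 \<and> p = flat bs1 \<and> q = flat bs2) \<or>
    (\<exists>bs1 x w1 w2 bs2. bs = bs1 @ (x, Some (w1 @ w2)) # bs2 \<and>
      p = flat bs1 @ a x # w1 \<and> q = w2 @ a x # flat bs2)"
  using assms
proof (induction bs arbitrary: p)
  case Nil
  then show ?case by auto
next
  case (Cons b bs)
  from Cons.prems consider (later) p' where "p = block_word b @ p'" "flat bs = p' @ q"
    | (here) u where "block_word b = p @ u" "q = u @ flat bs"
    by (auto simp: append_eq_append_conv2)
  then show ?case
  proof cases
    case later
    from Cons.IH[OF later(2)] show ?thesis
    proof (elim disjE exE conjE)
      fix bs1 bs2 assume "bs = bs1 @ bs2" "p' = flat bs1" "q = flat bs2"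
      then show ?thesis using later by (intro disjI1 exI[of _ "b # bs1"] exI[of _ bs2]) auto
    next
      fix bs1 x w1 w2 bs2
      assume "bs = bs1 @ (x, Some (w1 @ w2)) # bs2" "p' = flat bs1 @ a x # w1" "q = w2 @ a x # flat bs2"
      then show ?thesis using later
        by (intro disjI2 exI[of _ "b # bs1"] exI[of _ x] exI[of _ w1] exI[of _ w2] exI[of _ bs2]) auto
    qed
  next
    case here
    have first: ?thesis if "p = []"
      using that Cons.prems by (intro disjI1 exI[of _ "[]"] exI[of _ "b # bs"]) auto
    have last: ?thesis if "u = []"
      using that here by (intro disjI1 exI[of _ "[b]"] exI[of _ bs]) auto
    show ?thesis
    proof (cases b rule: block_word.cases)
      case (1 x)
      then show ?thesis using here first last by (cases p) auto
    next
      case (2 x w)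
      show ?thesis
      proof (cases "p = [] \<or> u = []")
        case False
        obtain p' where p: "p = a x # p'" "w @ [a x] = p' @ u" using False here 2 by (cases p) auto
        obtain u' where "u = u' @ [a x]" "w = p' @ u'"
          using p(2) False by (cases u rule: rev_cases) auto
        then show ?thesis using here p 2
          by (intro disjI2 exI[of _ "[]"] exI[of _ x] exI[of _ p'] exI[of _ u'] exI[of _ bs]) auto
      qed (use first last in auto)
    qed
  qed
qed

lemma flat_first_letter:
  assumes "flat bs = x # q" "x \<in> alphabet Q" "valid bs"
  obtains bs' where "bs = (x, None) # bs'" "q = flat bs'"
  using assms letters(1)
proof (cases bs)
  case (Cons b bs')
  then show ?thesis using assms that letters(1) by (cases b rule: block_word.cases) auto
qed simp

lemma flat_first_a:
  assumes "flat bs = a x # q" "x \<in> alphabet Q" "valid bs"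
  obtains w bs' where "bs = (x, Some w) # bs'" "q = w @ a x # flat bs'"
proof (cases bs)
  case (Cons b bs')
  then show ?thesis using assms that letters(1) a_eq by (cases b rule: block_word.cases) auto
qed (use assms in simp)

lemma flat_first_not_P:
  assumes "flat bs = c # q" "valid bs" "x \<in> alphabet Q"
  shows "c \<notin> alphabet (P x)"
proof (cases bs)
  case (Cons b bs')
  then show ?thesis using assms letters by (cases b rule: block_word.cases) auto
qed (use assms in simp)

lemma component_no_a: "x \<in> alphabet Q \<Longrightarrow> y \<in> alphabet Q \<Longrightarrow> w \<in> component x \<Longrightarrow> a y \<notin> set w"
  using component_words[of x w] letters(2)[of y x] by (auto simp: words_def)

lemma first_a_unique:
  assumes "w @ c # u = w' @ c # u'" "c \<notin> set w" "c \<notin> set w'"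
  shows "w = w' \<and> u = u'"
  using assms by (induction w arbitrary: w') (auto simp: Cons_eq_append_conv append_eq_Cons_conv)

lemma prefix_before:
  assumes "c \<notin> set l" "l @ q = w @ c # u"
  shows "\<exists>q'. w = l @ q' \<and> q = q' @ c # u"
  using assms
proof (induction l arbitrary: w)
  case (Cons d l)
  then show ?case by (cases w) auto
qed simp

text \<open>
  The first letter tells whether a block is a letter \<open>x\<close> or begins with \<open>a\<^sub>x\<close>; in the second case the
  block ends at the next occurrence of \<open>a\<^sub>x\<close>, since words over \<open>\<Sigma>\<^sub>x\<close> contain no markers.
\<close>

lemma flat_inj: "valid bs \<Longrightarrow> valid bs' \<Longrightarrow> flat bs = flat bs' \<Longrightarrow> bs = bs'"
proof (induction bs arbitrary: bs')
  case Nil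
  then show ?case by (cases bs') (auto elim: block_word.elims)
next
  case (Cons b bs)
  show ?case
  proof (cases b rule: block_word.cases)
    case (1 x)
    then obtain bs'' where "bs' = (x, None) # bs''" "flat bs = flat bs''"
      using flat_first_letter[of bs' x "flat bs"] Cons.prems by auto
    then show ?thesis using Cons 1 by auto
  next
    case (2 x w)
    then obtain w' bs'' where *: "bs' = (x, Some w') # bs''" "w @ a x # flat bs = w' @ a x # flat bs''"
      using flat_first_a[of bs' x "w @ a x # flat bs"] Cons.prems by auto
    then have "w = w' \<and> flat bs = flat bs''"
      using first_a_unique[OF *(2)] component_no_a Cons.prems 2 by auto
    then show ?thesis using Cons 2 * by auto
  qed
qed

text \<open>
  Letters of \<open>X\<close> do not occur inside the blocks \<open>a\<^sub>x w a\<^sub>x\<close>.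
\<close>

lemma find_letters:
  assumes "valid bs" "flat bs = p @ l @ q" "set l \<subseteq> alphabet Q" "l \<noteq> []"
  obtains bs1 bs2 where "bs = bs1 @ letter_blocks l @ bs2" "p = flat bs1" "q = flat bs2"
proof -
  have start: "\<exists>bs2. bs = letter_blocks l @ bs2 \<and> q = flat bs2" if "valid bs" "flat bs = l @ q" "set l \<subseteq> alphabet Q" for bs l
    using that
  proof (induction l arbitrary: bs)
    case (Cons x l)
    obtain bs' where "bs = (x, None) # bs'" "l @ q = flat bs'"
      using flat_first_letter[of bs x "l @ q"] Cons.prems by auto
    then show ?case using Cons.IH[of bs'] Cons.prems by auto
  qed simp
  from flat_cut[OF assms(2)] show thesis
  proof (elim disjE exE conjE)
    fix bs1 bs2 assume *: "bs = bs1 @ bs2" "p = flat bs1" "l @ q = flat bs2"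
    then obtain bs3 where "bs2 = letter_blocks l @ bs3" "q = flat bs3" using start[of bs2 l] assms by auto
    then show thesis using that * by auto
  next
    fix bs1 x w1 w2 bs2
    assume *: "bs = bs1 @ (x, Some (w1 @ w2)) # bs2" "l @ q = w2 @ a x # flat bs2"
    then have "hd l = hd (w2 @ [a x])" using assms(4) by (cases l; cases w2) auto
    moreover have "hd l \<in> alphabet Q" using assms by (cases l) auto
    moreover have "x \<in> alphabet Q" "w1 @ w2 \<in> words (P x)" using assms(1) * component_words[of x "w1 @ w2"] by auto
    ultimately have False using letters(1,3) by (cases w2) (auto simp: words_Cons)
    then show thesis ..
  qed
qed

text \<open>
  Letters of \<open>\<Sigma>\<^sub>x\<close> occur inside the blocks of \<open>x\<close> only, and a word over \<open>\<Sigma>\<^sub>x\<close> cannot run past a marker.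
\<close>

lemma find_inner:
  assumes "valid bs" "flat bs = p @ l @ q" "x \<in> alphabet Q" "set l \<subseteq> alphabet (P x)" "l \<noteq> []"
  obtains bs1 p' q' bs2 where "bs = bs1 @ (x, Some (p' @ l @ q')) # bs2"
    "p = flat bs1 @ a x # p'" "q = q' @ a x # flat bs2"
  using flat_cut[OF assms(2)]
proof (elim disjE exE conjE)
  fix bs1 bs2 assume *: "bs = bs1 @ bs2" "l @ q = flat bs2"
  then have "hd l \<notin> alphabet (P x)"
    using flat_first_not_P[of bs2 "hd l" "tl l @ q" x] assms by (cases l) auto
  then show thesis using assms by (cases l) auto
next
  fix bs1 y w1 w2 bs2
  assume *: "bs = bs1 @ (y, Some (w1 @ w2)) # bs2" "p = flat bs1 @ a y # w1" "l @ q = w2 @ a y # flat bs2"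
  then have y: "y \<in> alphabet Q" "w1 @ w2 \<in> words (P y)" using assms(1) * component_words[of y "w1 @ w2"] by auto
  have "a y \<notin> set l" using letters(2)[OF y(1) assms(3)] assms(4) by auto
  then have "\<exists>q'. w2 = l @ q' \<and> q = q' @ a y # flat bs2"
    using *(3) by (rule prefix_before)
  then obtain q' where q': "w2 = l @ q'" "q = q' @ a y # flat bs2" by blast
  then have "x = y" using letters(4)[of x y "hd l"] y assms by (cases l) (auto simp: words_Cons)
  then show thesis using that[of bs1 w1 q' bs2] * q' by auto
qed

text \<open>
  A marker followed by a letter of \<open>\<Sigma>\<^sub>x\<close> opens a block, which ends at the next marker.  A closing
  marker is followed by a letter of \<open>X\<close>, by another marker or by nothing; this is where \<open>w\<^sub>x\<close> has to be
  non-empty.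
\<close>

lemma find_wrapped:
  assumes "valid bs" "flat bs = p @ (a x # w @ [a x]) @ q" "x \<in> alphabet Q" "w \<in> nonempty_words (P x)"
  obtains bs1 bs2 where "bs = bs1 @ (x, Some w) # bs2" "p = flat bs1" "q = flat bs2"
  using flat_cut[OF assms(2)]
proof (elim disjE exE conjE)
  have w: "a x \<notin> set w" "set w \<subseteq> alphabet (P x)" "w \<noteq> []"
    using assms(3,4) letters(2) by (auto simp: nonempty_words_def words_def)
  fix bs1 bs2 assume *: "bs = bs1 @ bs2" "p = flat bs1" "(a x # w @ [a x]) @ q = flat bs2"
  then obtain w' bs3 where bs2: "bs2 = (x, Some w') # bs3" "w @ a x # q = w' @ a x # flat bs3"
    using flat_first_a[of bs2 x "w @ a x # q"] assms by auto
  then have "w = w' \<and> q = flat bs3" using first_a_unique[OF bs2(2) w(1)] component_no_a assms(1) * by auto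
  then show thesis using that * bs2 by auto
next
  fix bs1 y w1 w2 bs2
  assume *: "bs = bs1 @ (y, Some (w1 @ w2)) # bs2" "(a x # w @ [a x]) @ q = w2 @ a y # flat bs2"
  then have y: "y \<in> alphabet Q" "w1 @ w2 \<in> words (P y)" "valid bs2" using assms(1) * component_words[of y "w1 @ w2"] by auto
  have "w2 = []" using *(2) y letters(2)[OF assms(3) y(1)] by (cases w2) (auto simp: words_Cons)
  then have "flat bs2 = hd w # tl w @ a x # q" using * assms(4) by (cases w) (auto simp: nonempty_words_def)
  then have "hd w \<notin> alphabet (P x)" using flat_first_not_P y assms by blast
  then show thesis using assms(4) by (cases w) (auto simp: nonempty_words_def words_Cons)
qed

end


context composite
begin

section \<open>Reading a path of the composite presentation in the diagram product\<close>

lemma wx_component: "x \<in> alphabet Q \<Longrightarrow> wx x \<in> component x"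
  using wx by (auto simp: component_def nonempty_words_def intro!: exI[of _ "[]"])

text \<open>
  A chosen path from \<open>w\<^sub>x\<close> to each word of its component.  It is trivial at \<open>w\<^sub>x\<close>, so that
  \<open>x = a\<^sub>x w\<^sub>x a\<^sub>x\<close> can be read as the identity.
\<close>

definition tree :: "'a \<Rightarrow> 'a list \<Rightarrow> ('a squier_edge \<times> bool) list" where
  "tree x w = (if w = wx x then [] else SOME \<pi>. is_path (Kx x) (wx x) \<pi> w)"

lemma is_path_tree: "x \<in> alphabet Q \<Longrightarrow> w \<in> component x \<Longrightarrow> is_path (Kx x) (wx x) (tree x w) w"
  using wx_component[of x] component_words[of x "wx x"] someI_ex[of "\<lambda>\<pi>. is_path (Kx x) (wx x) \<pi> w"]
  by (auto simp: tree_def component_def)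

text \<open>
  A path inside a block becomes an element of \<open>G\<^sub>x\<close> by closing it up along the chosen paths.
\<close>

definition loop_of :: "'a \<Rightarrow> 'a list \<Rightarrow> ('a squier_edge \<times> bool) list \<Rightarrow> 'a list \<Rightarrow> ('a squier_edge \<times> bool) list set" where
  "loop_of x u \<pi> v = loop_class (Kx x) (wx x) (tree x u @ \<pi> @ path_inv (tree x v))"

context
  fixes x assumes x: "x \<in> alphabet Q"
begin

interpretation Px: squier "P x" using squier_P[OF x] .

lemma is_path_loop_of:
  assumes "u \<in> component x" "v \<in> component x" "is_path (Kx x) u \<pi> v"
  shows "is_path (Kx x) (wx x) (tree x u @ \<pi> @ path_inv (tree x v)) (wx x)"
  by (rule is_path_appendI[OF is_path_tree[OF x assms(1)] is_path_appendI[OF assms(3) Px.is_path_inv[OF is_path_tree[OF x assms(2)]]]])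

lemma loop_of_closed:
  assumes "u \<in> component x" "v \<in> component x" "is_path (Kx x) u \<pi> v"
  shows "loop_of x u \<pi> v \<in> carrier (H x)"
  using is_path_loop_of[OF assms] unfolding H_eq[OF x] loop_of_def carrier_fundamental_group by blast

lemma loop_of_homotopic:
  assumes "u \<in> component x" "v \<in> component x" "homotopic (Kx x) u v \<pi> \<rho>"
  shows "loop_of x u \<pi> v = loop_of x u \<rho> v"
  unfolding loop_of_def
  by (rule loop_class_eqI[OF homotopic_context[OF assms(3) is_path_tree[OF x assms(1)] Px.is_path_inv[OF is_path_tree[OF x assms(2)]]]])

lemma loop_of_mult:
  assumes "u \<in> component x" "v \<in> component x" "w \<in> component x"
    and \<pi>: "is_path (Kx x) u \<pi> v" and \<rho>: "is_path (Kx x) v \<rho> w"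
  shows "loop_of x u \<pi> v \<otimes>\<^bsub>H x\<^esub> loop_of x v \<rho> w = loop_of x u (\<pi> @ \<rho>) w"
proof -
  note tree = is_path_tree[OF x]
  have "homotopic (Kx x) (wx x) (wx x)
    ((tree x u @ \<pi>) @ (path_inv (tree x v) @ tree x v) @ (\<rho> @ path_inv (tree x w)))
    ((tree x u @ \<pi>) @ [] @ (\<rho> @ path_inv (tree x w)))"
    by (rule homotopic_context[OF Px.inv_left[OF tree[OF assms(2)]] is_path_appendI[OF tree[OF assms(1)] \<pi>]
        is_path_appendI[OF \<rho> Px.is_path_inv[OF tree[OF assms(3)]]]])
  then show ?thesis
    unfolding H_eq[OF x] loop_of_def
    using Px.mult_fundamental_group[OF is_path_loop_of[OF assms(1,2) \<pi>] is_path_loop_of[OF assms(2,3) \<rho>]]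
      loop_class_eqI by fastforce
qed

lemma loop_of_Nil:
  assumes "u \<in> component x" shows "loop_of x u [] u = \<one>\<^bsub>H x\<^esub>"
  unfolding H_eq[OF x] loop_of_def one_fundamental_group
  using loop_class_eqI[OF Px.inv_right[OF is_path_tree[OF x assms]]] by simp

lemma loop_of_base: "loop_of x (wx x) \<pi> (wx x) = loop_class (Kx x) (wx x) \<pi>"
  by (simp add: loop_of_def tree_def)

lemma component_path: "u \<in> component x \<Longrightarrow> is_path (Kx x) u \<pi> v \<Longrightarrow> v \<in> component x"
  unfolding component_def using is_path_appendI[of "Kx x" "wx x" _ u \<pi> v] by blast

lemma inner_edge:
  assumes "(l, r) \<in> relations (P x)" "p @ l @ q \<in> words (P x)"
  shows "is_path (Kx x) (p @ l @ q) [((p, (l, r), q), True)] (p @ r @ q)"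
  using is_path_edge[OF Px.complex0, of "(p, (l, r), q)"] assms by (simp del: is_path.simps)

lemma component_edge:
  assumes "(l, r) \<in> relations (P x)"
  shows "p @ l @ q \<in> component x \<longleftrightarrow> p @ r @ q \<in> component x"
proof
  assume l: "p @ l @ q \<in> component x"
  show "p @ r @ q \<in> component x"
    using component_path[OF l inner_edge[OF assms component_words[OF x l]]] .
next
  assume r: "p @ r @ q \<in> component x"
  then have "p @ l @ q \<in> words (P x)" using component_words[OF x r] Px.relation_words[OF assms] by auto
  then show "p @ l @ q \<in> component x"
    using component_path[OF r Px.is_path_inv[OF inner_edge[OF assms]]] by blast
qed

end

text \<open>
  \<open>move m p (l, r) q m' c\<close>: the edge \<open>(p, l \<rightarrow> r, q)\<close> leads from the blocks \<open>m\<close> to the blocks \<open>m'\<close>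
  and is read as \<open>c\<close> in the diagram product.
\<close>

inductive move :: "'a block list \<Rightarrow> 'a list \<Rightarrow> 'a list \<times> 'a list \<Rightarrow> 'a list \<Rightarrow> 'a block list \<Rightarrow>
    ('a, ('a squier_edge \<times> bool) list set) label \<Rightarrow> bool" where
  move_S: "(s, t) \<in> relations Q \<Longrightarrow> move (letter_blocks s) [] (s, t) [] (letter_blocks t) (Rel s t)"
| move_W: "x \<in> alphabet Q \<Longrightarrow> move [(x, None)] [] ([x], a x # wx x @ [a x]) [] [(x, Some (wx x))] (Elt x \<one>\<^bsub>H x\<^esub>)"
| move_R: "x \<in> alphabet Q \<Longrightarrow> (l, r) \<in> relations (P x) \<Longrightarrow> p @ l @ q \<in> component x \<Longrightarrow>
    move [(x, Some (p @ l @ q))] (a x # p) (l, r) (q @ [a x]) [(x, Some (p @ r @ q))]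
      (Elt x (loop_of x (p @ l @ q) [((p, (l, r), q), True)] (p @ r @ q)))"

lemma move_props:
  assumes "move m p (l, r) q m' c"
  shows "flat m = p @ l @ q" "flat m' = p @ r @ q" "valid m" "valid m'"
    "label_source c = base m" "label_target c = base m'" "D.label_ok c" "(l, r) \<in> relations C"
    "p \<in> words C" "q \<in> words C" "m \<noteq> []" "m' \<noteq> []"
proof -
  have "flat m = p @ l @ q \<and> flat m' = p @ r @ q \<and> valid m \<and> valid m' \<and>
    label_source c = base m \<and> label_target c = base m' \<and> D.label_ok c \<and> (l, r) \<in> relations C \<and>
    p \<in> words C \<and> q \<in> words C \<and> m \<noteq> [] \<and> m' \<noteq> []"
    using assms
  proof cases
    case move_S
    then show ?thesis using Q.relation_words valid_letter_blocks
      by (auto simp: composite_presentation_def)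
  next
    case (move_W x)
    then show ?thesis using wx_component monoid.one_closed[OF group.is_monoid[OF group_H]]
      by (auto simp: composite_presentation_def)
  next
    case (move_R x p' q')
    then have w: "p' @ l @ q' \<in> words (P x)" "p' @ r @ q' \<in> component x"
      using component_words[OF move_R(6,8)] component_edge[OF move_R(6,7)] move_R(8) by blast+
    moreover have "loop_of x (p' @ l @ q') [((p', (l, r), q'), True)] (p' @ r @ q') \<in> carrier (H x)"
      by (rule loop_of_closed[OF move_R(6,8) w(2) inner_edge[OF move_R(6,7) w(1)]])
    ultimately show ?thesis using move_R words_C
      by (auto simp: composite_presentation_def words_Cons)
  qed
  then show "flat m = p @ l @ q" "flat m' = p @ r @ q" "valid m" "valid m'"
    "label_source c = base m" "label_target c = base m'" "D.label_ok c" "(l, r) \<in> relations C"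
    "p \<in> words C" "q \<in> words C" "m \<noteq> []" "m' \<noteq> []" by blast+
qed

text \<open>
  A relation that applies to a word of blocks is one of the three kinds of moves, because its left
  hand side is a word over \<open>X\<close> or over a single \<open>\<Sigma>\<^sub>x\<close>.
\<close>

lemma find_move_initial:
  assumes lr: "(l, r) \<in> relations C" and bs: "valid bs" "flat bs = p @ l @ q"
  obtains bs1 m bs2 p' q' m' c where "bs = bs1 @ m @ bs2" "p = flat bs1 @ p'" "q = q' @ flat bs2"
    "move m p' (l, r) q' m' c"
  using lr
proof (cases rule: relation_C_cases)
  case S
  obtain bs1 bs2 where "bs = bs1 @ letter_blocks l @ bs2" "p = flat bs1" "q = flat bs2"
    using find_letters[OF bs] relation_Q[OF S] by blast
  then show thesis using that[OF _ _ _ move_S[OF S]] by simp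
next
  case (W x)
  obtain bs1 bs2 where "bs = bs1 @ letter_blocks l @ bs2" "p = flat bs1" "q = flat bs2"
    using find_letters[OF bs] W by auto
  then show thesis using that[of bs1 "[(x, None)]" bs2 "[]" "[]"] move_W[OF W(1)] W(2,3) by auto
next
  case (R x)
  obtain bs1 p' q' bs2 where *: "bs = bs1 @ (x, Some (p' @ l @ q')) # bs2"
    "p = flat bs1 @ a x # p'" "q = q' @ a x # flat bs2"
    using find_inner[OF bs R(1)] relation_P[OF R] by blast
  then have "p' @ l @ q' \<in> component x" using bs(1) by auto
  from that[OF _ _ _ move_R[OF R this]] * show thesis by simp
qed

text \<open>
  The same for inverse edges, where the new case is \<open>a\<^sub>x w\<^sub>x a\<^sub>x \<rightarrow> x\<close>.  Together with
  \<open>find_move_initial\<close> this shows that the words of blocks are closed under moves.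
\<close>

lemma find_move_terminal:
  assumes lr: "(l, r) \<in> relations C" and bs: "valid bs" "flat bs = p @ r @ q"
  obtains bs1 m bs2 p' q' m' c where "bs = bs1 @ m' @ bs2" "p = flat bs1 @ p'" "q = q' @ flat bs2"
    "move m p' (l, r) q' m' c"
  using lr
proof (cases rule: relation_C_cases)
  case S
  obtain bs1 bs2 where "bs = bs1 @ letter_blocks r @ bs2" "p = flat bs1" "q = flat bs2"
    using find_letters[OF bs] relation_Q[OF S] by blast
  then show thesis using that[OF _ _ _ move_S[OF S]] by simp
next
  case (W x)
  obtain bs1 bs2 where "bs = bs1 @ (x, Some (wx x)) # bs2" "p = flat bs1" "q = flat bs2"
    using find_wrapped[of bs p x "wx x" q] bs W wx by auto
  then show thesis using that[of bs1 "[(x, Some (wx x))]" bs2 "[]" "[]"] move_W[OF W(1)] W(2,3) by auto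
next
  case (R x)
  obtain bs1 p' q' bs2 where *: "bs = bs1 @ (x, Some (p' @ r @ q')) # bs2"
    "p = flat bs1 @ a x # p'" "q = q' @ a x # flat bs2"
    using find_inner[OF bs R(1)] relation_P[OF R] by blast
  then have "p' @ l @ q' \<in> component x" using bs(1) component_edge[OF R] by auto
  from that[OF _ _ _ move_R[OF R this]] * show thesis by simp
qed

text \<open>
  The kind of a relation is visible from its letters.  For a relation of \<open>\<R>\<^sub>x\<close> the block it is applied in
  is delimited by the last marker before it and the first marker after it.
\<close>

lemma move_unique:
  assumes bs: "valid bs1" "valid bs2" "valid cs1" "valid cs2"
    and eq: "flat bs1 @ p = flat cs1 @ p'" "q @ flat bs2 = q' @ flat cs2"
    and m: "move m p lr q m' c" and n: "move n p' lr q' n' d"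
  shows "bs1 = cs1 \<and> bs2 = cs2 \<and> c = d"
  using m
proof cases
  case (move_S s t)
  note st = move_S and rel = relation_Q[OF move_S(7)]
  from n show ?thesis
  proof cases
    case move_S
    then show ?thesis using st eq bs flat_inj by simp
  next
    case (move_W x)
    then show ?thesis using st rel letters(1)[of x "a x"] by auto
  next
    case (move_R x l r)
    then show ?thesis using st rel relation_P[OF move_R(7,8)] letters(3)[OF _ move_R(7)] by (cases s) auto
  qed
next
  case (move_W x)
  note xw = move_W
  from n show ?thesis
  proof cases
    case (move_S s t)
    then show ?thesis using xw relation_Q[OF move_S(7)] letters(1)[of x "a x"] by auto
  next
    case (move_W y)
    then show ?thesis using xw eq bs flat_inj by simp
  next
    case (move_R y l r)
    then show ?thesis using xw relation_P[OF move_R(7,8)] letters(3)[of x y] by auto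
  qed
next
  case (move_R x l r p1 q1)
  note R = move_R and rel = relation_P[OF move_R(7,8)]
  from n show ?thesis
  proof cases
    case (move_S s t)
    then show ?thesis using R rel relation_Q[OF move_S(7)] letters(3)[OF _ R(7)] by (cases s) auto
  next
    case (move_W y)
    then show ?thesis using R rel letters(3)[of y x] by auto
  next
    case (move_R y l' r' p2 q2)
    then have l: "l' = l" "r' = r" using R by auto
    have "x = y" using letters(4)[of x y "hd l"] rel relation_P[OF move_R(7,8)] R move_R l by (cases l) auto
    have na: "a x \<notin> set p1" "a x \<notin> set p2" "a x \<notin> set q1" "a x \<notin> set q2"
      using component_no_a[OF R(7) R(7) R(9)] component_no_a[OF R(7) R(7), of "p2 @ l @ q2"] move_R(9) \<open>x = y\<close> l by auto
    have "rev p1 @ a x # rev (flat bs1) = rev p2 @ a x # rev (flat cs1)"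
      using arg_cong[OF eq(1), of rev] R move_R \<open>x = y\<close> by simp
    from first_a_unique[OF this] have "p1 = p2 \<and> flat bs1 = flat cs1" using na(1,2) by simp
    moreover have "q1 = q2 \<and> flat bs2 = flat cs2"
      using first_a_unique[of q1 "a x" "flat bs2" q2 "flat cs2"] na(3,4) eq(2) R(4) move_R(4) \<open>x = y\<close> by simp
    ultimately show ?thesis using R move_R \<open>x = y\<close> l flat_inj bs by simp
  qed
qed

text \<open>
  The description of an edge as a move between fixed blocks is unique by \<open>move_unique\<close>, so the
  choice is the only possible one.
\<close>

definition read_edge :: "'a squier_edge \<Rightarrow> 'a squier_edge + 'a list \<times> ('a squier_edge \<times> bool) list set list" where
  "read_edge e = (SOME d. \<exists>bs1 p lr q bs2 m m' c. valid bs1 \<and> valid bs2 \<and> move m p lr q m' c \<and>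
     e = (flat bs1 @ p, lr, q @ flat bs2) \<and> d = D.label_edge (base bs1) c (base bs2))"

lemma read_edge:
  assumes "valid bs1" "valid bs2" "move m p lr q m' c"
  shows "read_edge (flat bs1 @ p, lr, q @ flat bs2) = D.label_edge (base bs1) c (base bs2)"
  unfolding read_edge_def
proof (rule some_equality)
  fix d assume "\<exists>bs1' p' lr' q' bs2' m m' c. valid bs1' \<and> valid bs2' \<and> move m p' lr' q' m' c \<and>
     (flat bs1 @ p, lr, q @ flat bs2) = (flat bs1' @ p', lr', q' @ flat bs2') \<and> d = D.label_edge (base bs1') c (base bs2')"
  then obtain bs1' p' q' bs2' n n' c' where *: "valid bs1'" "valid bs2'" "move n p' lr q' n' c'"
    "flat bs1 @ p = flat bs1' @ p'" "q @ flat bs2 = q' @ flat bs2'" "d = D.label_edge (base bs1') c' (base bs2')"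
    by auto
  then show "d = D.label_edge (base bs1) c (base bs2)"
    using move_unique[OF assms(1,2) *(1,2,4,5) assms(3) *(3)] by simp
qed (use assms in blast)

definition parse :: "'a list \<Rightarrow> 'a block list" where
  "parse u = (THE bs. valid bs \<and> flat bs = u)"

lemma parse_flat: "valid bs \<Longrightarrow> parse (flat bs) = bs"
  unfolding parse_def using flat_inj by blast

definition block_words :: "'a list set" where
  "block_words = {flat bs | bs. valid bs \<and> bs \<noteq> []}"

lemma block_wordsI: "valid bs \<Longrightarrow> bs \<noteq> [] \<Longrightarrow> flat bs \<in> block_words"
  by (auto simp: block_words_def)

lemma block_wordsE:
  assumes "u \<in> block_words" obtains bs where "u = flat bs" "valid bs" "bs \<noteq> []" "parse u = bs"
  using assms parse_flat by (auto simp: block_words_def)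

text \<open>
  The left hand sides of the two relations contain no markers.  So the second relation is applied
  either to blocks behind those of the first, and the two moves commute by \<open>label_interchange\<close>; or it is
  applied to the same block, both relations belong to \<open>\<R>\<^sub>x\<close>, and the claim is a 2-cell of the complex
  of \<open>\<P>\<^sub>x\<close>, hence an equation in \<open>G\<^sub>x\<close>.
\<close>

lemma read_cell:
  assumes rel: "(l1, r1) \<in> relations C" "(l2, r2) \<in> relations C"
    and u: "p @ l1 @ z @ l2 @ q \<in> block_words"
  shows "homotopic D.T (base (parse (p @ l1 @ z @ l2 @ q))) (base (parse (p @ r1 @ z @ r2 @ q)))
    [(read_edge (p, (l1, r1), z @ l2 @ q), True), (read_edge (p @ r1 @ z, (l2, r2), q), True)]
    [(read_edge (p @ l1 @ z, (l2, r2), q), True), (read_edge (p, (l1, r1), z @ r2 @ q), True)]"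
proof -
  obtain bs where bs: "p @ l1 @ z @ l2 @ q = flat bs" "valid bs" using u by (rule block_wordsE)
  obtain bs1 m bs2 p1 q1 m' c where 1: "bs = bs1 @ m @ bs2" "p = flat bs1 @ p1" "z @ l2 @ q = q1 @ flat bs2"
    "move m p1 (l1, r1) q1 m' c"
    by (rule find_move_initial[OF rel(1) bs(2) bs(1)[symmetric]])
  note m = move_props[OF 1(4)]
  obtain us where "z = q1 @ us \<and> us @ l2 @ q = flat bs2 \<or> z @ us = q1 \<and> l2 @ q = us @ flat bs2"
    using 1(3) append_eq_append_conv2[of z "l2 @ q" q1 "flat bs2"] by blast
  then consider (apart) z' where "z = q1 @ z'" "flat bs2 = z' @ l2 @ q"
    | (same) u where "q1 = z @ u" "u \<noteq> []" "l2 @ q = u @ flat bs2"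
    by (cases "us = []") auto
  then show ?thesis
  proof cases
    case apart
    have vbs2: "valid bs2" using bs(2) 1(1) by simp
    obtain bs3 n bs4 p2 q2 n' d where 2: "bs2 = bs3 @ n @ bs4" "z' = flat bs3 @ p2" "q = q2 @ flat bs4"
      "move n p2 (l2, r2) q2 n' d"
      by (rule find_move_initial[OF rel(2) vbs2 apart(2)])
    note n = move_props[OF 2(4)]
    have v: "valid bs1" "valid m" "valid bs3" "valid n" "valid bs4" "valid m'" "valid n'"
      using bs(2) 1(1) 2(1) m n by auto
    have p1: "parse (p @ l1 @ z @ l2 @ q) = bs1 @ m @ bs3 @ n @ bs4"
      using parse_flat[of "bs1 @ m @ bs3 @ n @ bs4"] v bs(1) 1(1) 2(1) by simp
    have p2: "parse (p @ r1 @ z @ r2 @ q) = bs1 @ m' @ bs3 @ n' @ bs4"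
      using parse_flat[of "bs1 @ m' @ bs3 @ n' @ bs4"] v 1(2) 2(2,3) apart(1) m(2) n(2) by simp
    have e1: "read_edge (p, (l1, r1), z @ l2 @ q) = D.label_edge (base bs1) c (base bs3 @ base n @ base bs4)"
      using read_edge[of bs1 "bs3 @ n @ bs4", OF _ _ 1(4)] v 1(2) 2(2,3) apart(1) n(1) by simp
    have e2: "read_edge (p @ r1 @ z, (l2, r2), q) = D.label_edge (base bs1 @ base m' @ base bs3) d (base bs4)"
      using read_edge[of "bs1 @ m' @ bs3" bs4, OF _ _ 2(4)] v 1(2) 2(2,3) apart(1) m(2) by simp
    have e3: "read_edge (p @ l1 @ z, (l2, r2), q) = D.label_edge (base bs1 @ base m @ base bs3) d (base bs4)"
      using read_edge[of "bs1 @ m @ bs3" bs4, OF _ _ 2(4)] v 1(2) 2(2,3) apart(1) m(1) by simp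
    have e4: "read_edge (p, (l1, r1), z @ r2 @ q) = D.label_edge (base bs1) c (base bs3 @ base n' @ base bs4)"
      using read_edge[of bs1 "bs3 @ n' @ bs4", OF _ _ 1(4)] v 1(2) 2(2,3) apart(1) n(2) by simp
    show ?thesis
      using D.label_interchange[OF m(7) n(7) words_base words_base words_base, of bs1 bs3 bs4] v
      unfolding p1 p2 e1 e2 e3 e4 m(5,6) n(5,6) by simp
  next
    case same
    from 1(4) obtain x p' q' where R: "x \<in> alphabet Q" "(l1, r1) \<in> relations (P x)" "p' @ l1 @ q' \<in> component x"
      "m = [(x, Some (p' @ l1 @ q'))]" "p1 = a x # p'" "q1 = q' @ [a x]"
      using same(1,2) by cases auto
    interpret Px: squier "P x" using squier_P[OF R(1)] .
    obtain u' where u: "q' = z @ u'" "u = u' @ [a x]"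
      using same(1,2) R(6) by (cases u rule: rev_cases) auto
    have no_a: "a x \<notin> set l2"
      using rel(2)
    proof (cases rule: relation_C_cases)
      case S
      then show ?thesis using relation_Q(1) letters(1)[OF R(1)] by blast
    next
      case (R y)
      then show ?thesis using relation_P(1) letters(2)[OF \<open>x \<in> alphabet Q\<close>] by blast
    next
      case (W y)
      then show ?thesis using letters(1)[OF R(1)] by auto
    qed
    obtain q2 where q2: "u' = l2 @ q2" "q = q2 @ a x # flat bs2"
      using prefix_before[OF no_a, of q u'] same(3) u(2) by auto
    have wq: "p' @ l1 @ z @ l2 @ q2 \<in> words (P x)" using component_words[OF R(1,3)] u q2 by simp
    have rel2: "(l2, r2) \<in> relations (P x)"
      using rel(2)
    proof (cases rule: relation_C_cases)
      case S
      then show ?thesis using relation_Q[OF S] wq letters(3)[OF _ R(1)] by (cases l2) (auto simp: words_Cons)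
    next
      case (R y)
      have "y = x" using relation_P[OF R] wq letters(4)[OF R(1) \<open>x \<in> alphabet Q\<close>] by (cases l2) (auto simp: words_Cons)
      then show ?thesis using R by simp
    next
      case (W y)
      then show ?thesis using wq letters(3)[OF W(1) R(1)] by (auto simp: words_Cons)
    qed
    have v: "valid bs1" "valid bs2" using bs(2) 1(1) by auto
    let ?ll = "p' @ l1 @ z @ l2 @ q2" and ?rl = "p' @ r1 @ z @ l2 @ q2"
    let ?lr = "p' @ l1 @ z @ r2 @ q2" and ?rr = "p' @ r1 @ z @ r2 @ q2"
    have ll: "?ll \<in> component x" using R(3) u q2 by simp
    have rl: "?rl \<in> component x" using component_edge[OF R(1,2), of p' "z @ l2 @ q2"] ll by simp
    have lr: "?lr \<in> component x" using component_edge[OF R(1) rel2, of "p' @ l1 @ z" q2] ll by simp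
    have rr: "?rr \<in> component x" using component_edge[OF R(1,2), of p' "z @ r2 @ q2"] lr by simp
    have parse_block: "parse (flat bs1 @ a x # w @ a x # flat bs2) = bs1 @ (x, Some w) # bs2"
      if "w \<in> component x" for w
      using parse_flat[of "bs1 @ (x, Some w) # bs2"] v that R(1) by simp
    have p1: "base (parse (p @ l1 @ z @ l2 @ q)) = base bs1 @ [x] @ base bs2"
      using parse_block[OF ll] 1(2) R(5) q2(2) by simp
    have p2: "base (parse (p @ r1 @ z @ r2 @ q)) = base bs1 @ [x] @ base bs2"
      using parse_block[OF rr] 1(2) R(5) q2(2) by simp
    let ?e = "\<lambda>u e v. D.label_edge (base bs1) (Elt x (loop_of x u [(e, True)] v)) (base bs2)"
    have e1: "read_edge (p, (l1, r1), z @ l2 @ q) = ?e ?ll (p', (l1, r1), z @ l2 @ q2) ?rl"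
      using read_edge[OF v move_R[OF R(1,2), of p' "z @ l2 @ q2"]] ll 1(2) R(5) q2(2) by simp
    have e2: "read_edge (p @ r1 @ z, (l2, r2), q) = ?e ?rl (p' @ r1 @ z, (l2, r2), q2) ?rr"
      using read_edge[OF v move_R[OF R(1) rel2, of "p' @ r1 @ z" q2]] rl 1(2) R(5) q2(2) by simp
    have e3: "read_edge (p @ l1 @ z, (l2, r2), q) = ?e ?ll (p' @ l1 @ z, (l2, r2), q2) ?lr"
      using read_edge[OF v move_R[OF R(1) rel2, of "p' @ l1 @ z" q2]] ll 1(2) R(5) q2(2) by simp
    have e4: "read_edge (p, (l1, r1), z @ r2 @ q) = ?e ?lr (p', (l1, r1), z @ r2 @ q2) ?rr"
      using read_edge[OF v move_R[OF R(1,2), of p' "z @ r2 @ q2"]] lr 1(2) R(5) q2(2) by simp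
    have g1: "is_path (Kx x) ?ll [((p', (l1, r1), z @ l2 @ q2), True)] ?rl"
      using inner_edge[OF R(1,2), of p' "z @ l2 @ q2"] component_words[OF R(1) ll] by (simp del: is_path.simps)
    have g2: "is_path (Kx x) ?rl [((p' @ r1 @ z, (l2, r2), q2), True)] ?rr"
      using inner_edge[OF R(1) rel2, of "p' @ r1 @ z" "q2"] component_words[OF R(1) rl] by (simp del: is_path.simps)
    have g3: "is_path (Kx x) ?ll [((p' @ l1 @ z, (l2, r2), q2), True)] ?lr"
      using inner_edge[OF R(1) rel2, of "p' @ l1 @ z" "q2"] component_words[OF R(1) ll] by (simp del: is_path.simps)
    have g4: "is_path (Kx x) ?lr [((p', (l1, r1), z @ r2 @ q2), True)] ?rr"
      using inner_edge[OF R(1,2), of p' "z @ r2 @ q2"] component_words[OF R(1) lr] by (simp del: is_path.simps)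
    have "homotopic (Kx x) ?ll ?rr
      [((p', (l1, r1), z @ l2 @ q2), True), ((p' @ r1 @ z, (l2, r2), q2), True)]
      [((p' @ l1 @ z, (l2, r2), q2), True), ((p', (l1, r1), z @ r2 @ q2), True)]"
      using Px.interchange[OF inner_edge[OF R(1,2), of p' z] inner_edge[OF R(1) rel2, of "[]" q2]] wq by simp
    from loop_of_homotopic[OF R(1) ll rr this]
    have mult: "loop_of x ?ll [((p', (l1, r1), z @ l2 @ q2), True)] ?rl \<otimes>\<^bsub>H x\<^esub> loop_of x ?rl [((p' @ r1 @ z, (l2, r2), q2), True)] ?rr =
        loop_of x ?ll [((p' @ l1 @ z, (l2, r2), q2), True)] ?lr \<otimes>\<^bsub>H x\<^esub> loop_of x ?lr [((p', (l1, r1), z @ r2 @ q2), True)] ?rr"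
      by (simp add: loop_of_mult[OF R(1) ll rl rr g1 g2] loop_of_mult[OF R(1) ll lr rr g3 g4])
    show ?thesis
      unfolding p1 p2 e1 e2 e3 e4
      by (rule homotopic_trans[OF D.label_mult[OF R(1) loop_of_closed[OF R(1) ll rl g1] loop_of_closed[OF R(1) rl rr g2] words_base[OF v(1)] words_base[OF v(2)], unfolded mult]
        homotopic_sym[OF D.label_mult[OF R(1) loop_of_closed[OF R(1) ll lr g3] loop_of_closed[OF R(1) lr rr g4] words_base[OF v(1)] words_base[OF v(2)]]]])
  qed
qed

lemma read_edge_path:
  assumes "(p, (l, r), q) \<in> edges C.K" "p @ l @ q \<in> block_words"
  shows "is_path D.T (base (parse (p @ l @ q))) [(read_edge (p, (l, r), q), True)] (base (parse (p @ r @ q)))"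
    "p @ r @ q \<in> block_words"
proof -
  have lr: "(l, r) \<in> relations C" using assms(1) by simp
  obtain bs where bs: "p @ l @ q = flat bs" "valid bs" using assms(2) by (rule block_wordsE)
  obtain bs1 m bs2 p1 q1 m' c where 1: "bs = bs1 @ m @ bs2" "p = flat bs1 @ p1" "q = q1 @ flat bs2"
    "move m p1 (l, r) q1 m' c"
    by (rule find_move_initial[OF lr bs(2) bs(1)[symmetric]])
  note m = move_props[OF 1(4)]
  have v: "valid bs1" "valid bs2" using bs 1 by auto
  have r: "p @ r @ q = flat (bs1 @ m' @ bs2)" using 1 m by simp
  show "p @ r @ q \<in> block_words" unfolding r by (rule block_wordsI) (use v m(4,12) in auto)
  have "parse (p @ l @ q) = bs1 @ m @ bs2" using parse_flat[OF bs(2)] bs(1) 1(1) by simp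
  moreover have "parse (p @ r @ q) = bs1 @ m' @ bs2" unfolding r by (rule parse_flat) (use v m in auto)
  moreover have "read_edge (p, (l, r), q) = D.label_edge (base bs1) c (base bs2)"
    unfolding 1 by (rule read_edge[OF v 1(4)])
  ultimately show "is_path D.T (base (parse (p @ l @ q))) [(read_edge (p, (l, r), q), True)] (base (parse (p @ r @ q)))"
    using D.label_edge[OF m(7) words_base[OF v(1)] words_base[OF v(2)]] m(5,6)
    by (simp del: is_path.simps)
qed

lemma complex_map_read:
  "complex_map C.K block_words D.T (\<lambda>u. base (parse u)) (\<lambda>e. [(read_edge e, True)])"
proof
  fix u assume "u \<in> block_words"
  then show "base (parse u) \<in> verts D.T"
    using words_base by (auto simp: nonempty_words_def elim!: block_wordsE)
next
  fix e assume e: "e \<in> edges C.K"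
  obtain p l r q where e': "e = (p, (l, r), q)" by (metis prod.exhaust)
  have lr: "(l, r) \<in> relations C" using e e' by simp
  show "initial C.K e \<in> block_words \<longleftrightarrow> terminal C.K e \<in> block_words"
  proof
    assume "terminal C.K e \<in> block_words"
    then have "p @ r @ q \<in> block_words" unfolding e' by simp
    then obtain bs where bs: "p @ r @ q = flat bs" "valid bs" by (rule block_wordsE)
    obtain bs1 m bs2 p1 q1 m' c where 1: "bs = bs1 @ m' @ bs2" "p = flat bs1 @ p1" "q = q1 @ flat bs2"
      "move m p1 (l, r) q1 m' c"
      by (rule find_move_terminal[OF lr bs(2) bs(1)[symmetric]])
    note m = move_props[OF 1(4)]
    have l: "initial C.K e = flat (bs1 @ m @ bs2)" using 1 m e' by simp
    show "initial C.K e \<in> block_words" unfolding l by (rule block_wordsI) (use bs(2) 1(1) m(3,11) in auto)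
  next
    assume "initial C.K e \<in> block_words"
    then show "terminal C.K e \<in> block_words"
      using read_edge_path(2)[of p l r q] e unfolding e' by simp
  qed
next
  fix e assume e: "e \<in> edges C.K" "initial C.K e \<in> block_words"
  obtain p l r q where e': "e = (p, (l, r), q)" by (metis prod.exhaust)
  show "is_path D.T (base (parse (initial C.K e))) [(read_edge e, True)] (base (parse (terminal C.K e)))"
    using read_edge_path(1)[of p l r q] e unfolding e' by (simp del: is_path.simps)
next
  fix c v assume "c \<in> cells C.K" and path: "is_path C.K v c v" and v: "v \<in> block_words"
  then obtain p z q l1 r1 l2 r2 where c: "c = [((p, (l1, r1), z @ l2 @ q), True), ((p @ r1 @ z, (l2, r2), q), True)] @
         path_inv [((p @ l1 @ z, (l2, r2), q), True), ((p, (l1, r1), z @ r2 @ q), True)]"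
   and rel: "(l1, r1) \<in> relations C" "(l2, r2) \<in> relations C"
    by (auto simp: squier_complex_def)
  have "v = p @ l1 @ z @ l2 @ q" using path by (simp add: c src_def)
  then have "homotopic D.T (base (parse v)) (base (parse (p @ r1 @ z @ r2 @ q)))
    [(read_edge (p, (l1, r1), z @ l2 @ q), True), (read_edge (p @ r1 @ z, (l2, r2), q), True)]
    [(read_edge (p @ l1 @ z, (l2, r2), q), True), (read_edge (p, (l1, r1), z @ r2 @ q), True)]"
    using read_cell[OF rel] v by simp
  from D.T.homotopic_imp_null[OF this]
  show "homotopic D.T (base (parse v)) (base (parse v)) (path_map (\<lambda>e. [(read_edge e, True)]) c) []"
    unfolding c path_map_append path_map_path_inv by (simp add: path_map_Cons)
qed (use C.complex0 D.complex_T in auto)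

end


context composite
begin

section \<open>Drawing a path of the diagram product in the composite presentation\<close>

definition wrap :: "'a \<Rightarrow> ('a squier_edge \<times> bool) list" where
  "wrap x = [(([], ([x], a x # wx x @ [a x]), []), True)]"

abbreviation inner :: "'a \<Rightarrow> ('a squier_edge \<times> bool) list \<Rightarrow> ('a squier_edge \<times> bool) list" where
  "inner x \<pi> \<equiv> whisker [a x] \<pi> [a x]"

definition wrapped_loop :: "'a \<Rightarrow> ('a squier_edge \<times> bool) list \<Rightarrow> ('a squier_edge \<times> bool) list" where
  "wrapped_loop x \<pi> = wrap x @ inner x \<pi> @ path_inv (wrap x)"

lemma is_path_wrap:
  assumes "x \<in> alphabet Q"
  shows "is_path C.K [x] (wrap x) (a x # wx x @ [a x])"
proof -
  have "([], ([x], a x # wx x @ [a x]), []) \<in> edges C.K"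
    using assms by (simp add: composite_presentation_def)
  from is_path_edge[OF C.complex0 this] show ?thesis by (simp add: wrap_def del: is_path.simps)
qed

context
  fixes x assumes x: "x \<in> alphabet Q"
begin

interpretation Px: squier "P x" using squier_P[OF x] .

lemma complex_map_inner: "complex_map (Kx x) UNIV C.K (\<lambda>u. [a x] @ u @ [a x])
    (\<lambda>(p', r, q'). [(([a x] @ p', r, q' @ [a x]), True)])"
  using x words_C(2)[OF x]
  by (intro C.complex_map_whisker P) (auto simp: words_Cons composite_presentation_def)

lemma is_path_inner: "is_path (Kx x) u \<pi> v \<Longrightarrow> is_path C.K (a x # u @ [a x]) (inner x \<pi>) (a x # v @ [a x])"
  using complex_map.is_path_path_map[OF complex_map_inner] unfolding path_map_whisker by fastforce

lemma homotopic_inner: "homotopic (Kx x) u v \<pi> \<rho> \<Longrightarrow>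
    homotopic C.K (a x # u @ [a x]) (a x # v @ [a x]) (inner x \<pi>) (inner x \<rho>)"
  using complex_map.homotopic_path_map[OF complex_map_inner] unfolding path_map_whisker by fastforce

lemma homotopic_wrapped_loop:
  assumes "homotopic (Kx x) (wx x) (wx x) \<pi> \<rho>"
  shows "homotopic C.K [x] [x] (wrapped_loop x \<pi>) (wrapped_loop x \<rho>)"
  unfolding wrapped_loop_def
  by (rule homotopic_context[OF homotopic_inner[OF assms] is_path_wrap[OF x] C.is_path_inv[OF is_path_wrap[OF x]]])

text \<open>
  The contraction at the end of the loop cancels against the expansion that follows it.
\<close>

lemma wrapped_loop_wrap:
  assumes "is_path C.K (a x # wx x @ [a x]) \<sigma> v" "is_path (Kx x) (wx x) \<pi> (wx x)"
  shows "homotopic C.K [x] v (wrapped_loop x \<pi> @ wrap x @ \<sigma>) (wrap x @ inner x \<pi> @ \<sigma>)"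
  using homotopic_context[OF C.inv_left[OF is_path_wrap[OF x]] is_path_appendI[OF is_path_wrap[OF x] is_path_inner[OF assms(2)]] assms(1)]
  by (simp add: wrapped_loop_def)

lemma wrapped_loop_append:
  assumes "is_path (Kx x) (wx x) \<pi> (wx x)" "is_path (Kx x) (wx x) \<rho> (wx x)"
  shows "homotopic C.K [x] [x] (wrapped_loop x \<pi> @ wrapped_loop x \<rho>) (wrapped_loop x (\<pi> @ \<rho>))"
  using wrapped_loop_wrap[OF is_path_appendI[OF is_path_inner[OF assms(2)] C.is_path_inv[OF is_path_wrap[OF x]]] assms(1)]
  by (simp add: wrapped_loop_def)

lemma wrapped_loop_Nil: "homotopic C.K [x] [x] (wrapped_loop x []) []"
  using C.inv_right[OF is_path_wrap[OF x]] by (simp add: wrapped_loop_def)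

end

definition draw_element :: "'a \<Rightarrow> ('a squier_edge \<times> bool) list set \<Rightarrow> ('a squier_edge \<times> bool) list" where
  "draw_element x g = wrapped_loop x (SOME \<pi>. \<pi> \<in> g)"

lemma draw_element:
  assumes x: "x \<in> alphabet Q" and \<pi>: "is_path (Kx x) (wx x) \<pi> (wx x)"
  shows "homotopic C.K [x] [x] (draw_element x (loop_class (Kx x) (wx x) \<pi>)) (wrapped_loop x \<pi>)"
    "is_path (Kx x) (wx x) (SOME \<rho>. \<rho> \<in> loop_class (Kx x) (wx x) \<pi>) (wx x)"
    "loop_class (Kx x) (wx x) (SOME \<rho>. \<rho> \<in> loop_class (Kx x) (wx x) \<pi>) = loop_class (Kx x) (wx x) \<pi>"
proof -
  interpret Px: squier "P x" using squier_P[OF x] .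
  have "\<pi> \<in> loop_class (Kx x) (wx x) \<pi>" using \<pi> by (simp add: loop_class_def homotopic_refl)
  then have "(SOME \<rho>. \<rho> \<in> loop_class (Kx x) (wx x) \<pi>) \<in> loop_class (Kx x) (wx x) \<pi>" by (rule someI)
  then have h: "homotopic (Kx x) (wx x) (wx x) \<pi> (SOME \<rho>. \<rho> \<in> loop_class (Kx x) (wx x) \<pi>)"
    unfolding loop_class_def by (rule CollectD)
  show "homotopic C.K [x] [x] (draw_element x (loop_class (Kx x) (wx x) \<pi>)) (wrapped_loop x \<pi>)"
    unfolding draw_element_def by (rule homotopic_wrapped_loop[OF x homotopic_sym[OF h]])
  show "is_path (Kx x) (wx x) (SOME \<rho>. \<rho> \<in> loop_class (Kx x) (wx x) \<pi>) (wx x)"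
    using Px.homotopic_paths(2)[OF h] .
  show "loop_class (Kx x) (wx x) (SOME \<rho>. \<rho> \<in> loop_class (Kx x) (wx x) \<pi>) = loop_class (Kx x) (wx x) \<pi>"
    by (rule loop_class_eqI[OF h, symmetric])
qed

lemma carrier_HE:
  assumes "x \<in> alphabet Q" "g \<in> carrier (H x)"
  obtains \<pi> where "is_path (Kx x) (wx x) \<pi> (wx x)" "g = loop_class (Kx x) (wx x) \<pi>"
  using assms unfolding H_eq[OF assms(1)] carrier_fundamental_group by blast

lemma is_path_draw_element:
  assumes "x \<in> alphabet Q" "g \<in> carrier (H x)" shows "is_path C.K [x] (draw_element x g) [x]"
  using carrier_HE[OF assms] draw_element(1)[OF assms(1)] C.homotopic_paths(1) by metis

lemma draw_element_mult:
  assumes x: "x \<in> alphabet Q" and "g \<in> carrier (H x)" "h \<in> carrier (H x)"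
  shows "homotopic C.K [x] [x] (draw_element x g @ draw_element x h) (draw_element x (g \<otimes>\<^bsub>H x\<^esub> h))"
proof -
  interpret Px: squier "P x" using squier_P[OF x] .
  obtain \<pi> \<rho> where g: "is_path (Kx x) (wx x) \<pi> (wx x)" "g = loop_class (Kx x) (wx x) \<pi>"
    and h: "is_path (Kx x) (wx x) \<rho> (wx x)" "h = loop_class (Kx x) (wx x) \<rho>"
    using assms by (meson carrier_HE)
  have gh: "g \<otimes>\<^bsub>H x\<^esub> h = loop_class (Kx x) (wx x) (\<pi> @ \<rho>)"
    unfolding H_eq[OF x] g(2) h(2) by (rule Px.mult_fundamental_group[OF g(1) h(1)])
  show ?thesis unfolding gh unfolding g(2) h(2)
    by (rule homotopic_trans[OF C.homotopic_append2[OF draw_element(1)[OF x g(1)] draw_element(1)[OF x h(1)]]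
      homotopic_trans[OF wrapped_loop_append[OF x g(1) h(1)] homotopic_sym[OF draw_element(1)[OF x is_path_appendI[OF g(1) h(1)]]]]])
qed

lemma draw_element_one:
  assumes x: "x \<in> alphabet Q" shows "homotopic C.K [x] [x] (draw_element x \<one>\<^bsub>H x\<^esub>) []"
proof -
  have "is_path (Kx x) (wx x) [] (wx x)" using wx[OF x] by (simp add: nonempty_words_def)
  from homotopic_trans[OF draw_element(1)[OF x this] wrapped_loop_Nil[OF x]]
  show ?thesis unfolding H_eq[OF x] one_fundamental_group .
qed

fun draw :: "'a list \<Rightarrow> ('a squier_edge \<times> bool) list set list \<Rightarrow> ('a squier_edge \<times> bool) list" where
  "draw (x # u) (g # gs) = whisker [] (draw_element x g) u @ whisker [x] (draw u gs) []"
| "draw _ _ = []"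

lemma draw_append:
  "length g = length u \<Longrightarrow> draw (u @ v) (g @ h) = whisker [] (draw u g) v @ whisker u (draw v h) []"
  by (induction u g rule: draw.induct) auto

lemma is_path_draw:
  assumes "u \<in> words Q" "g \<in> carrier (D.G u)" shows "is_path C.K u (draw u g) u"
  using assms
proof (induction u arbitrary: g)
  case (Cons x u)
  then obtain h hs where g: "g = h # hs" "h \<in> carrier (H x)" "hs \<in> carrier (D.G u)"
    and x: "x \<in> alphabet Q" "u \<in> words Q"
    by (auto simp: D.carrier_G_Cons words_Cons)
  have "is_path C.K ([] @ [x] @ u) (whisker [] (draw_element x h) u) ([] @ [x] @ u)"
    using C.is_path_whisker[OF is_path_draw_element[OF x(1) g(2)], of "[]" u] words_C(4)[OF x(2)] by simp
  moreover have "is_path C.K ([x] @ u @ []) (whisker [x] (draw u hs) []) ([x] @ u @ [])"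
    using C.is_path_whisker[OF Cons.IH[OF x(2) g(3)], of "[x]" "[]"] words_C(1)[OF x(1)] by (simp add: words_Cons)
  ultimately show ?case using is_path_appendI[of C.K "x # u"] by (simp add: g)
qed simp

text \<open>
  The remaining components of the first tuple commute with the first component of the second.
\<close>

lemma draw_mult:
  assumes "u \<in> words Q" "g \<in> carrier (D.G u)" "h \<in> carrier (D.G u)"
  shows "homotopic C.K u u (draw u g @ draw u h) (draw u (g \<otimes>\<^bsub>D.G u\<^esub> h))"
  using assms
proof (induction u arbitrary: g h)
  case Nil
  then show ?case using D.one_mult(1)[of "[]" "[]"] by (auto intro!: homotopic_refl)
next
  case (Cons x u)
  then obtain g0 g' h0 h' where g: "g = g0 # g'" "g0 \<in> carrier (H x)" "g' \<in> carrier (D.G u)"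
    and h: "h = h0 # h'" "h0 \<in> carrier (H x)" "h' \<in> carrier (D.G u)"
    and x: "x \<in> alphabet Q" "u \<in> words Q"
    by (auto simp: D.carrier_G_Cons words_Cons)
  have w: "[x] \<in> words C" "u \<in> words C" using x words_C by (auto simp: words_Cons)
  have G0: "is_path C.K (x # u) (whisker [] (draw_element x g0) u) (x # u)"
    and H0: "is_path C.K (x # u) (whisker [] (draw_element x h0) u) (x # u)"
    using C.is_path_whisker[OF is_path_draw_element[OF x(1) g(2)], of "[]" u]
      C.is_path_whisker[OF is_path_draw_element[OF x(1) h(2)], of "[]" u] w by auto
  have G1: "is_path C.K (x # u) (whisker [x] (draw u g') []) (x # u)"
    and H1: "is_path C.K (x # u) (whisker [x] (draw u h') []) (x # u)"
    using C.is_path_whisker[OF is_path_draw[OF x(2) g(3)], of "[x]" "[]"]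
      C.is_path_whisker[OF is_path_draw[OF x(2) h(3)], of "[x]" "[]"] w by auto
  have "homotopic C.K (x # u) (x # u)
      (whisker [x] (draw u g') [] @ whisker [] (draw_element x h0) u)
      (whisker [] (draw_element x h0) u @ whisker [x] (draw u g') [])"
    using homotopic_sym[OF C.interchange[OF is_path_draw_element[OF x(1) h(2)] is_path_draw[OF x(2) g(3)]]] by simp
  from homotopic_context[OF this G0 H1]
  have 1: "homotopic C.K (x # u) (x # u) (draw (x # u) g @ draw (x # u) h)
    (whisker [] (draw_element x g0 @ draw_element x h0) u @ whisker [x] (draw u g' @ draw u h') [])"
    by (simp add: g h)
  have 2: "homotopic C.K (x # u) (x # u) (whisker [] (draw_element x g0 @ draw_element x h0) u)
      (whisker [] (draw_element x (g0 \<otimes>\<^bsub>H x\<^esub> h0)) u)"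
    using C.homotopic_whisker[OF draw_element_mult[OF x(1) g(2) h(2)], of "[]" u] w by simp
  have 3: "homotopic C.K (x # u) (x # u) (whisker [x] (draw u g' @ draw u h') [])
      (whisker [x] (draw u (g' \<otimes>\<^bsub>D.G u\<^esub> h')) [])"
    using C.homotopic_whisker[OF Cons.IH[OF x(2) g(3) h(3)], of "[x]" "[]"] w by simp
  show ?case
    using homotopic_trans[OF 1 C.homotopic_append2[OF 2 3]]
    by (simp add: g h D.mult_Cons[OF g(2) h(2) g(3) h(3)])
qed

lemma draw_one: "u \<in> words Q \<Longrightarrow> homotopic C.K u u (draw u (D.id_word u)) []"
proof (induction u)
  case Nil
  then show ?case by (auto intro!: homotopic_refl)
next
  case (Cons x u)
  then have x: "x \<in> alphabet Q" "u \<in> words Q" by (auto simp: words_Cons)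
  have w: "[x] \<in> words C" "u \<in> words C" using x words_C by (auto simp: words_Cons)
  have "homotopic C.K (x # u) (x # u) (whisker [] (draw_element x \<one>\<^bsub>H x\<^esub>) u) []"
    using C.homotopic_whisker[OF draw_element_one[OF x(1)], of "[]" u] w by simp
  moreover have "homotopic C.K (x # u) (x # u) (whisker [x] (draw u (D.id_word u)) []) []"
    using C.homotopic_whisker[OF Cons.IH[OF x(2)], of "[x]" "[]"] w by simp
  ultimately show ?case using C.homotopic_append2 by (fastforce simp: D.id_word_Cons)
qed

text \<open>
  The identity at the letters of \<open>s\<close> contributes nothing; what is left lies outside \<open>s\<close> and so commutes
  with a relation applied to \<open>s\<close>, which is \<open>draw_slide\<close>.
\<close>

lemma draw_context:
  assumes w: "p \<in> words Q" "s \<in> words Q" "q \<in> words Q" and ab: "g \<in> carrier (D.G p)" "h \<in> carrier (D.G q)"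
  shows "homotopic C.K (p @ s @ q) (p @ s @ q) (draw (p @ s @ q) (g @ D.id_word s @ h))
    (whisker [] (draw p g) (s @ q) @ whisker (p @ s) (draw q h) [])"
proof -
  note wC = words_C(4)[OF w(1)] words_C(4)[OF w(2)] words_C(4)[OF w(3)]
  have P1: "is_path C.K (p @ s @ q) (whisker [] (draw p g) (s @ q)) (p @ s @ q)"
    using C.is_path_whisker[OF is_path_draw[OF w(1) ab(1)], of "[]" "s @ q"] wC by simp
  have P3: "is_path C.K (p @ s @ q) (whisker (p @ s) (draw q h) []) (p @ s @ q)"
    using C.is_path_whisker[OF is_path_draw[OF w(3) ab(2)], of "p @ s" "[]"] wC by simp
  have "homotopic C.K (p @ s @ q) (p @ s @ q) (whisker p (draw s (D.id_word s)) q) []"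
    using C.homotopic_whisker[OF draw_one[OF w(2)], of p q] wC by simp
  from homotopic_context[OF this P1 P3] show ?thesis
    using D.length_carrier_G[OF ab(1)] D.length_carrier_G[OF D.id_word_closed[OF w(2)]]
    by (simp add: draw_append)
qed

lemma draw_slide:
  assumes w: "p \<in> words Q" "q \<in> words Q" and st: "(s, t) \<in> relations Q"
    and gh: "g \<in> carrier (D.G p)" "h \<in> carrier (D.G q)"
  shows "homotopic C.K (p @ s @ q) (p @ t @ q)
     (draw (p @ s @ q) (g @ D.id_word s @ h) @ [((p, (s, t), q), True)])
     ([((p, (s, t), q), True)] @ draw (p @ t @ q) (g @ D.id_word t @ h))"
proof -
  let ?e = "[(([], (s, t), []), True)]"
  note st' = Q.relation_words[OF st]
  note wC = words_C(4)[OF w(1)] words_C(4)[OF w(2)] words_C(4)[OF st'(1)] words_C(4)[OF st'(2)]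
  have "([], (s, t), []) \<in> edges C.K" using st by (simp add: composite_presentation_def)
  from is_path_edge[OF C.complex0 this] have e: "is_path C.K s ?e t" by (simp del: is_path.simps)
  have eq: "is_path C.K (s @ q) (whisker [] ?e q) (t @ q)"
    using C.is_path_whisker[OF e, of "[]" q] wC by (simp del: is_path.simps)
  have peq: "is_path C.K (p @ s @ q) (whisker p ?e q) (p @ t @ q)"
    using C.is_path_whisker[OF e, of p q] wC by (simp del: is_path.simps)
  let ?g = "\<lambda>s. whisker [] (draw p g) (s @ q)" and ?h = "\<lambda>s. whisker (p @ s) (draw q h) []"
  have g: "is_path C.K (p @ s @ q) (?g s) (p @ s @ q)"
    using C.is_path_whisker[OF is_path_draw[OF w(1) gh(1)], of "[]" "s @ q"] wC by simp
  have h: "is_path C.K (p @ t @ q) (?h t) (p @ t @ q)"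
    using C.is_path_whisker[OF is_path_draw[OF w(2) gh(2)], of "p @ t" "[]"] wC by simp
  have 1: "homotopic C.K (p @ s @ q) (p @ t @ q) (?g s @ whisker p ?e q) (whisker p ?e q @ ?g t)"
    using C.interchange[OF is_path_draw[OF w(1) gh(1)] eq] by simp
  have 2: "homotopic C.K (p @ s @ q) (p @ t @ q) (?h s @ whisker p ?e q) (whisker p ?e q @ ?h t)"
    using C.homotopic_whisker[OF homotopic_sym[OF C.interchange[OF e is_path_draw[OF w(2) gh(2)]]], of p "[]"] wC
    by simp
  have "homotopic C.K (p @ s @ q) (p @ t @ q) (draw (p @ s @ q) (g @ D.id_word s @ h) @ whisker p ?e q) (?g s @ ?h s @ whisker p ?e q)"
    using C.homotopic_append_right[OF draw_context[OF w(1) st'(1) w(2) gh] peq] by simp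
  also have "homotopic C.K (p @ s @ q) (p @ t @ q) (?g s @ ?h s @ whisker p ?e q) (?g s @ whisker p ?e q @ ?h t)"
    by (rule C.homotopic_append_left[OF g 2])
  also have "homotopic C.K (p @ s @ q) (p @ t @ q) (?g s @ whisker p ?e q @ ?h t) (whisker p ?e q @ ?g t @ ?h t)"
    using C.homotopic_append_right[OF 1 h] by simp
  also have "homotopic C.K (p @ s @ q) (p @ t @ q) (whisker p ?e q @ ?g t @ ?h t)
      (whisker p ?e q @ draw (p @ t @ q) (g @ D.id_word t @ h))"
    by (rule C.homotopic_append_left[OF peq homotopic_sym[OF draw_context[OF w(1) st'(2) w(2) gh]]])
  finally show ?thesis by simp
qed

definition draw_edge :: "'a squier_edge + 'a list \<times> ('a squier_edge \<times> bool) list set list \<Rightarrow> ('a squier_edge \<times> bool) list" where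
  "draw_edge = case_sum (\<lambda>e. [(e, True)]) (\<lambda>(u, g). draw u g)"

lemma draw_edge_simps [simp]: "draw_edge (Inl e) = [(e, True)]" "draw_edge (Inr (u, g)) = draw u g"
  by (auto simp: draw_edge_def)

lemma relation_C: "(s, t) \<in> relations Q \<Longrightarrow> (s, t) \<in> relations C"
  by (simp add: composite_presentation_def)

lemma is_path_draw_relation:
  assumes "p \<in> words Q" "(s, t) \<in> relations Q" "q \<in> words Q"
  shows "is_path C.K (p @ s @ q) [((p, (s, t), q), True)] (p @ t @ q)"
  using is_path_edge[OF C.complex0, of "(p, (s, t), q)"] assms relation_C words_C(4) by (simp del: is_path.simps)

lemma is_path_draw_edge:
  assumes "e \<in> edges D.T" shows "is_path C.K (initial D.T e) (draw_edge e) (terminal D.T e)"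
proof (cases e)
  case (Inl e')
  obtain p s t q where e': "e' = (p, (s, t), q)" by (metis prod.exhaust)
  with assms Inl show ?thesis using is_path_draw_relation[of p s t q] by (auto simp del: is_path.simps)
next
  case (Inr ug)
  with assms show ?thesis using is_path_draw by (cases ug) (auto simp: nonempty_words_def)
qed

text \<open>
  The 2-cells of the Squier complex of \<open>\<Q>\<close> are kept; those of the vertex groups and of the edges are
  filled by \<open>draw_mult\<close> and \<open>draw_slide\<close>.
\<close>

lemma complex_map_draw: "complex_map D.T UNIV C.K (\<lambda>u. u) draw_edge"
proof
  fix c v assume c: "c \<in> cells D.T" and path: "is_path D.T v c v"
  have ends: "v = src D.T (hd c)" using path D.complex_T c by (cases c) (auto simp: is_complex2_def)
  from c consider (base) c' where "c' \<in> cells (squier_complex Q)" "c = map (map_prod Inl id) c'"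
    | (mult) u g h where "u \<in> nonempty_words Q" "g \<in> carrier (D.G u)" "h \<in> carrier (D.G u)"
        "c = [(Inr (u, g), True), (Inr (u, h), True), (Inr (u, g \<otimes>\<^bsub>D.G u\<^esub> h), False)]"
    | (slide) p s t q g h where "p \<in> words Q" "(s, t) \<in> relations Q" "q \<in> words Q"
        "g \<in> carrier (D.G p)" "h \<in> carrier (D.G q)"
        "c = [(Inl (p, (s, t), q), False), (Inr (p @ s @ q, g @ D.id_word s @ h), True),
          (Inl (p, (s, t), q), True), (Inr (p @ t @ q, g @ D.id_word t @ h), False)]"
    unfolding D.cells_T by blast
  then show "homotopic C.K v v (path_map draw_edge c) []"
  proof cases
    case base
    have eq: "path_map draw_edge c = c'"
      unfolding base(2) by (induction c') (auto simp: path_map_Cons path_inv_single)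
    have "cells (squier_complex Q) \<subseteq> cells (squier_complex C)"
    proof
      fix c assume "c \<in> cells (squier_complex Q)"
      then obtain p z q l1 r1 l2 r2 where "c = [((p, (l1, r1), z @ l2 @ q), True), ((p @ r1 @ z, (l2, r2), q), True)] @
         path_inv [((p @ l1 @ z, (l2, r2), q), True), ((p, (l1, r1), z @ r2 @ q), True)]"
       and "p \<in> words Q" "z \<in> words Q" "q \<in> words Q" "(l1, r1) \<in> relations Q" "(l2, r2) \<in> relations Q"
        by (auto simp: squier_complex_def)
      then show "c \<in> cells (squier_complex C)"
        unfolding squier_complex_def using relation_C words_C(4) by auto
    qed
    moreover have "is_path C.K v c' v'" if "is_path D.T v (map (map_prod Inl id) c') v'" for v v'
      using that
    proof (induction c' arbitrary: v)
      case Nil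
      then show ?case using words_C(4) by (auto simp: nonempty_words_def)
    next
      case (Cons d c')
      obtain p s t q b where d: "d = ((p, (s, t), q), b)" by (metis prod.exhaust)
      have e: "p \<in> words Q" "(s, t) \<in> relations Q" "q \<in> words Q" "v = src C.K d"
        "is_path D.T (tgt C.K d) (map (map_prod Inl id) c') v'"
        using Cons.prems by (auto simp: d src_def tgt_def id_def)
      have "is_path C.K v [d] (tgt C.K d)"
        using e(4) is_path_draw_relation[OF e(1-3)] C.is_path_inv[OF is_path_draw_relation[OF e(1-3)]]
        by (cases b) (auto simp: d src_def tgt_def path_inv_single)
      from is_path_appendI[OF this Cons.IH[OF e(5)]] show ?case by simp
    qed
    ultimately show ?thesis
      using homotopic_cell[of C.K v "[]" c' "[]" v] path base unfolding eq by auto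
  next
    case mult
    then have u: "u \<in> words Q" "v = u" using ends by (auto simp: nonempty_words_def src_def)
    show ?thesis
      using C.homotopic_imp_null[OF draw_mult[OF u(1) mult(2,3)]]
      by (simp add: mult(4) u(2) path_map_Cons)
  next
    case slide
    have v: "v = p @ t @ q" using ends by (simp add: slide src_def)
    note e = is_path_draw_relation[OF slide(1-3)]
    let ?e = "[((p, (s, t), q), True)]"
    have w: "p @ s @ q \<in> words Q" "p @ t @ q \<in> words Q" using slide Q.relation_words by auto
    have h: "is_path C.K (p @ t @ q) (draw (p @ t @ q) (g @ D.id_word t @ h)) (p @ t @ q)"
      using slide Q.relation_words by (intro is_path_draw w D.carrier_G_append D.id_word_closed) auto
    from C.homotopic_imp_null[OF C.homotopic_conjugate[OF draw_slide[OF slide(1,3,2,4,5)] e h]] show ?thesis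
      by (simp add: v slide(6) path_map_Cons)
  qed
next
  fix v assume "v \<in> verts D.T"
  then show "v \<in> verts C.K" using words_C(4) by (simp add: nonempty_words_def)
qed (use D.complex_T C.complex0 is_path_draw_edge in auto)

end


context composite
begin

section \<open>The two translations are mutually inverse\<close>

fun draw_label :: "('a, ('a squier_edge \<times> bool) list set) label \<Rightarrow> ('a squier_edge \<times> bool) list" where
  "draw_label (Rel s t) = [(([], (s, t), []), True)]"
| "draw_label (Elt x g) = draw_element x g"

lemma is_path_draw_label:
  assumes "D.label_ok c" shows "is_path C.K (label_source c) (draw_label c) (label_target c)"
  using assms is_path_draw_relation[of "[]" _ _ "[]"] is_path_draw_element by (cases c) (auto simp del: is_path.simps)

lemma draw_label_edge:
  assumes c: "D.label_ok c" and w: "p \<in> words Q" "q \<in> words Q"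
  shows "homotopic C.K (p @ label_source c @ q) (p @ label_target c @ q)
    (draw_edge (D.label_edge p c q)) (whisker p (draw_label c) q)"
proof (cases c)
  case (Rel s t)
  then show ?thesis using is_path_draw_relation[OF w(1) _ w(2)] c by (auto intro!: homotopic_refl simp del: is_path.simps)
next
  case (Elt x g)
  then have x: "x \<in> alphabet Q" "g \<in> carrier (H x)" using c by auto
  note wC = words_C(4)[OF w(1)] words_C(4)[OF w(2)]
  have path: "is_path C.K (p @ [x] @ q) (whisker p (draw_element x g) q) (p @ [x] @ q)"
    using C.is_path_whisker[OF is_path_draw_element[OF x]] wC by simp
  have 1: "homotopic C.K (p @ [x] @ q) (p @ [x] @ q) (whisker [] (draw p (D.id_word p)) ([x] @ q)) []"
    using C.homotopic_whisker[OF draw_one[OF w(1)], of "[]" "[x] @ q"] wC words_C(1)[OF x(1)] by (simp add: words_Cons)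
  have 2: "homotopic C.K (p @ [x] @ q) (p @ [x] @ q) (whisker (p @ [x]) (draw q (D.id_word q)) []) []"
    using C.homotopic_whisker[OF draw_one[OF w(2)], of "p @ [x]" "[]"] wC words_C(1)[OF x(1)] by (simp add: words_Cons)
  have "homotopic C.K (p @ [x] @ q) (p @ [x] @ q)
     (whisker [] (draw p (D.id_word p)) ([x] @ q) @ whisker p (draw_element x g) q @ whisker (p @ [x]) (draw q (D.id_word q)) [])
     ([] @ whisker p (draw_element x g) q @ [])"
    by (rule C.homotopic_append2[OF 1 C.homotopic_append2[OF homotopic_refl[OF path] 2]])
  then show ?thesis using D.length_carrier_G[OF D.id_word_closed[OF w(1)]]
    by (simp add: Elt draw_append)
qed

text \<open>
  The natural path from \<open>x\<close> to a block of \<open>x\<close>: expand to \<open>a\<^sub>x w\<^sub>x a\<^sub>x\<close>, then follow the chosen path from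
  \<open>w\<^sub>x\<close>.
\<close>

fun expand_block :: "'a block \<Rightarrow> ('a squier_edge \<times> bool) list" where
  "expand_block (x, None) = []"
| "expand_block (x, Some w) = wrap x @ inner x (tree x w)"

fun expand :: "'a block list \<Rightarrow> ('a squier_edge \<times> bool) list" where
  "expand [] = []"
| "expand (b # bs) = whisker [] (expand_block b) (base bs) @ whisker (block_word b) (expand bs) []"

lemma expand_append:
  "expand (bs @ bs') = whisker [] (expand bs) (base bs') @ whisker (flat bs) (expand bs') []"
  by (induction bs) auto

lemma expand_letter_blocks [simp]: "expand (letter_blocks u) = []"
  by (induction u) auto

lemma is_path_expand_block:
  "valid_block b \<Longrightarrow> is_path C.K [fst b] (expand_block b) (block_word b)"
  using words_C(1) is_path_appendI[OF is_path_wrap is_path_inner[OF _ is_path_tree]]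
  by (cases b rule: block_word.cases) (auto simp: words_Cons)

lemma is_path_expand: "valid bs \<Longrightarrow> is_path C.K (base bs) (expand bs) (flat bs)"
proof (induction bs)
  case (Cons b bs)
  then have w: "base bs \<in> words C" "block_word b \<in> words C"
    using words_C(4)[OF words_base, of bs] words_flat[of "[b]"] by auto
  have "is_path C.K ([] @ [fst b] @ base bs) (whisker [] (expand_block b) (base bs)) ([] @ block_word b @ base bs)"
    using Cons.prems w by (intro C.is_path_whisker is_path_expand_block) auto
  moreover have "is_path C.K (block_word b @ base bs @ []) (whisker (block_word b) (expand bs) []) (block_word b @ flat bs @ [])"
    using Cons w by (intro C.is_path_whisker) auto
  ultimately show ?case using is_path_appendI by fastforce
qed simp

text \<open>
  For a relation of \<open>\<R>\<^sub>x\<close> from \<open>u\<close> to \<open>v\<close> the drawn loop, followed by the expansion to \<open>v\<close>, is the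
  expansion to \<open>a\<^sub>x w\<^sub>x a\<^sub>x\<close> followed by \<open>w\<^sub>x \<leadsto> u \<rightarrow> v \<leadsto> w\<^sub>x \<leadsto> v\<close>, and the last two pieces cancel.
\<close>

lemma expand_move:
  assumes m: "move m p (l, r) q m' c"
  shows "homotopic C.K (base m) (flat m') (expand m @ [((p, (l, r), q), True)]) (draw_label c @ expand m')"
  using m
proof cases
  case move_S
  then show ?thesis using is_path_draw_relation[of "[]" l r "[]"] by (auto intro!: homotopic_refl simp del: is_path.simps)
next
  case (move_W x)
  have "homotopic C.K [x] (flat m') (draw_element x \<one>\<^bsub>H x\<^esub> @ wrap x) ([] @ wrap x)"
    using C.homotopic_append_right[OF draw_element_one is_path_wrap] move_W by simp
  from homotopic_sym[OF this] show ?thesis using move_W by (simp add: wrap_def tree_def)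
next
  case (move_R x p' q')
  note x = move_R(6)
  interpret Px: squier "P x" using squier_P[OF x] .
  let ?u = "p' @ l @ q'" and ?v = "p' @ r @ q'" and ?e = "[((p', (l, r), q'), True)]"
  have v: "?v \<in> component x" using component_edge[OF x move_R(7)] move_R(8) by blast
  have e: "is_path (Kx x) ?u ?e ?v" using inner_edge[OF x move_R(7) component_words[OF x move_R(8)]] .
  note tu = is_path_tree[OF x move_R(8)] and tv = is_path_tree[OF x v]
  let ?l = "tree x ?u @ ?e @ path_inv (tree x ?v)"
  note l = is_path_loop_of[OF x move_R(8) v e]
  note tail = is_path_appendI[OF is_path_wrap[OF x] is_path_inner[OF x tv]]
  have "homotopic C.K [x] (a x # ?v @ [a x])
      (draw_element x (loop_of x ?u ?e ?v) @ wrap x @ inner x (tree x ?v)) (wrapped_loop x ?l @ wrap x @ inner x (tree x ?v))"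
    using C.homotopic_append_right[OF draw_element(1)[OF x l] tail] by (simp add: loop_of_def)
  also have "homotopic C.K [x] (a x # ?v @ [a x]) (wrapped_loop x ?l @ wrap x @ inner x (tree x ?v))
      (wrap x @ inner x (?l @ tree x ?v))"
    using wrapped_loop_wrap[OF x is_path_inner[OF x tv] l] by simp
  also have "homotopic C.K [x] (a x # ?v @ [a x]) (wrap x @ inner x (?l @ tree x ?v)) (wrap x @ inner x (tree x ?u @ ?e))"
  proof (rule C.homotopic_append_left[OF is_path_wrap[OF x] homotopic_inner[OF x]])
    show "homotopic (Kx x) (wx x) ?v (?l @ tree x ?v) (tree x ?u @ ?e)"
      using Px.homotopic_append_left[OF is_path_appendI[OF tu e] Px.inv_left[OF tv]] by simp
  qed
  finally have "homotopic C.K [x] (a x # ?v @ [a x])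
      (draw_element x (loop_of x ?u ?e ?v) @ wrap x @ inner x (tree x ?v)) (wrap x @ inner x (tree x ?u @ ?e))" .
  from homotopic_sym[OF this] show ?thesis by (simp add: move_R(1-5))
qed

text \<open>
  The expansion of a word consists of the expansions of the blocks before the move, of the blocks
  moved and of the blocks behind.  The first and the last are independent of the move and commute with
  it, and the middle part is \<open>expand_move\<close>.
\<close>

lemma expand_natural:
  assumes e: "e \<in> edges C.K" "initial C.K e \<in> block_words"
  shows "homotopic C.K (base (parse (initial C.K e))) (terminal C.K e)
    (expand (parse (initial C.K e)) @ [(e, True)]) (draw_edge (read_edge e) @ expand (parse (terminal C.K e)))"
proof -
  obtain p l r q where e': "e = (p, (l, r), q)" by (metis prod.exhaust)
  have lr: "(l, r) \<in> relations C" using e e' by simp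
  have "p @ l @ q \<in> block_words" using e(2) unfolding e' by simp
  then obtain bs where bs: "p @ l @ q = flat bs" "valid bs" by (rule block_wordsE)
  obtain bs1 m bs2 p1 q1 m' c where 1: "bs = bs1 @ m @ bs2" "p = flat bs1 @ p1" "q = q1 @ flat bs2"
    "move m p1 (l, r) q1 m' c"
    by (rule find_move_initial[OF lr bs(2) bs(1)[symmetric]])
  note m = move_props[OF 1(4)]
  have v: "valid bs1" "valid bs2" using bs 1 by auto
  have i: "initial C.K e = flat (bs1 @ m @ bs2)" and t: "terminal C.K e = flat (bs1 @ m' @ bs2)"
    using 1 m e' by simp_all
  have read: "read_edge e = D.label_edge (base bs1) c (base bs2)"
    unfolding e' 1 by (rule read_edge[OF v 1(4)])
  have pi: "parse (initial C.K e) = bs1 @ m @ bs2" unfolding i by (rule parse_flat) (use v m(3) in auto)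
  have pt: "parse (terminal C.K e) = bs1 @ m' @ bs2" unfolding t by (rule parse_flat) (use v m(4) in auto)
  let ?e1 = "[((p1, (l, r), q1), True)]"
  have wC: "base bs1 \<in> words C" "base bs2 \<in> words C" "flat bs1 \<in> words C" "flat bs2 \<in> words C"
    "base m \<in> words C" "base m' \<in> words C" "flat m \<in> words C" "flat m' \<in> words C"
    using v m(3,4) words_flat words_C(4)[OF words_base] by auto
  have e1: "is_path C.K (flat m) ?e1 (flat m')"
    using is_path_edge[OF C.complex0, of "(p1, (l, r), q1)"] m by (simp del: is_path.simps)
  note x1 = is_path_expand[OF v(1)] and x2 = is_path_expand[OF v(2)]
    and xm = is_path_expand[OF m(3)] and xm' = is_path_expand[OF m(4)]
    and dc = is_path_draw_label[OF m(7), unfolded m(5,6)]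
  let ?A = "\<lambda>m. whisker [] (expand bs1) (m @ base bs2)"
  let ?B = "\<lambda>\<pi>. whisker (flat bs1) \<pi> (base bs2)"
  let ?Z = "\<lambda>m. whisker (flat bs1 @ m) (expand bs2) []"
  let ?D = "whisker (base bs1) (draw_label c) (base bs2)"
  let ?E = "whisker (flat bs1) ?e1 (flat bs2)"
  let ?s = "base bs1 @ base m @ base bs2" and ?t = "flat bs1 @ flat m' @ flat bs2"
  have A: "is_path C.K ?s (?A (base m)) (flat bs1 @ base m @ base bs2)"
    using C.is_path_whisker[OF x1, of "[]" "base m @ base bs2"] wC by (simp del: is_path.simps)
  have D: "is_path C.K ?s ?D (base bs1 @ base m' @ base bs2)"
    using C.is_path_whisker[OF dc wC(1,2)] .
  have Bm: "is_path C.K (flat bs1 @ base m @ base bs2) (?B (expand m)) (flat bs1 @ flat m @ base bs2)"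
    using C.is_path_whisker[OF xm wC(3,2)] .
  have Bm': "is_path C.K (flat bs1 @ base m' @ base bs2) (?B (expand m')) (flat bs1 @ flat m' @ base bs2)"
    using C.is_path_whisker[OF xm' wC(3,2)] .
  have Z: "is_path C.K (flat bs1 @ flat m' @ base bs2) (?Z (flat m')) ?t"
    using C.is_path_whisker[OF x2, of "flat bs1 @ flat m'" "[]"] wC by (simp del: is_path.simps)
  have Db: "is_path C.K (base m @ base bs2) (whisker [] (draw_label c) (base bs2)) (base m' @ base bs2)"
    using C.is_path_whisker[OF dc, of "[]" "base bs2"] wC by (simp del: is_path.simps)
  \<comment> \<open>past the expansion of the blocks behind, through the blocks moved, past the blocks before\<close>
  have s1: "homotopic C.K (flat bs1 @ flat m @ base bs2) ?t (?Z (flat m) @ ?E) (?B ?e1 @ ?Z (flat m'))"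
    using C.homotopic_whisker[OF homotopic_sym[OF C.interchange[OF e1 x2]], of "flat bs1" "[]"] wC by simp
  have s2: "homotopic C.K (flat bs1 @ base m @ base bs2) (flat bs1 @ flat m' @ base bs2)
      (?B (expand m) @ ?B ?e1) (?B (draw_label c) @ ?B (expand m'))"
    using C.homotopic_whisker[OF expand_move[OF 1(4)] wC(3,2)] by simp
  have s3: "homotopic C.K ?s (flat bs1 @ base m' @ base bs2) (?A (base m) @ ?B (draw_label c)) (?D @ ?A (base m'))"
    using C.interchange[OF x1 Db] by simp
  have s4: "homotopic C.K ?s (base bs1 @ base m' @ base bs2) ?D (draw_edge (read_edge e))"
    unfolding read using homotopic_sym[OF draw_label_edge[OF m(7) words_base[OF v(1)] words_base[OF v(2)]]] m(5,6) by simp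
  have "homotopic C.K ?s ?t (?A (base m) @ ?B (expand m) @ ?Z (flat m) @ ?E)
    (?A (base m) @ ?B (expand m) @ ?B ?e1 @ ?Z (flat m'))"
    by (rule C.homotopic_append_left[OF A C.homotopic_append_left[OF Bm s1]])
  also have "homotopic C.K ?s ?t (?A (base m) @ ?B (expand m) @ ?B ?e1 @ ?Z (flat m'))
    (?A (base m) @ ?B (draw_label c) @ ?B (expand m') @ ?Z (flat m'))"
    using homotopic_context[OF s2 A Z] by simp
  also have "homotopic C.K ?s ?t (?A (base m) @ ?B (draw_label c) @ ?B (expand m') @ ?Z (flat m'))
    (?D @ ?A (base m') @ ?B (expand m') @ ?Z (flat m'))"
    using C.homotopic_append_right[OF s3 is_path_appendI[OF Bm' Z]] by simp
  also have "homotopic C.K ?s ?t (?D @ ?A (base m') @ ?B (expand m') @ ?Z (flat m'))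
    (draw_edge (read_edge e) @ ?A (base m') @ ?B (expand m') @ ?Z (flat m'))"
    using C.homotopic_append_right[OF s4, of "?A (base m') @ ?B (expand m') @ ?Z (flat m')" ?t]
      is_path_expand[of "bs1 @ m' @ bs2"] v m(4) by (simp add: expand_append)
  finally show ?thesis unfolding pi pt by (simp add: e' 1(2,3) expand_append t m(2))
qed

abbreviation "read_path \<equiv> path_map (\<lambda>e. [(read_edge e, True)])"

text \<open>
  Each edge is read as the loop through its two ends, and in the product of these loops the chosen
  paths to the intermediate words cancel.
\<close>

lemma read_inner:
  assumes bs: "valid bs1" "valid bs2" and x: "x \<in> alphabet Q"
    and "is_path (Kx x) u \<pi> v" "u \<in> component x"
  shows "homotopic D.T (base bs1 @ [x] @ base bs2) (base bs1 @ [x] @ base bs2)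
    (read_path (whisker (flat bs1 @ [a x]) \<pi> ([a x] @ flat bs2)))
    [(D.label_edge (base bs1) (Elt x (loop_of x u \<pi> v)) (base bs2), True)]"
  using assms(4,5)
proof (induction \<pi> arbitrary: u)
  case Nil
  then show ?case
    using homotopic_sym[OF D.label_one[OF x words_base[OF bs(1)] words_base[OF bs(2)]]] loop_of_Nil[OF x] by simp
next
  case (Cons d \<pi>)
  interpret Px: squier "P x" using squier_P[OF x] .
  interpret Hx: group "H x" using group_H[OF x] .
  obtain p l r q s where d: "d = ((p, (l, r), q), s)" by (metis prod.exhaust)
  let ?t = "tgt (Kx x) d" and ?e = "(p, (l, r), q)"
  have e: "?e \<in> edges (Kx x)" "src (Kx x) d = u" "is_path (Kx x) ?t \<pi> v"
    using Cons.prems d by auto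
  have pd: "is_path (Kx x) u [d] ?t" using Cons.prems is_path_verts(1)[OF e(3)] by auto
  have t: "?t \<in> component x" using component_path[OF x Cons.prems(2) pd] .
  have v: "v \<in> component x" using component_path[OF x t e(3)] .
  note w = words_base[OF bs(1)] words_base[OF bs(2)]
  let ?lab = "\<lambda>u \<pi> v. D.label_edge (base bs1) (Elt x (loop_of x u \<pi> v)) (base bs2)"
  have rel: "(l, r) \<in> relations (P x)" using e(1) by simp
  have lc: "p @ l @ q \<in> component x" and rc: "p @ r @ q \<in> component x"
    using t Cons.prems(2) e(2) by (cases s; auto simp: d src_def tgt_def)+
  have read: "read_edge (flat bs1 @ a x # p, (l, r), q @ a x # flat bs2) = ?lab (p @ l @ q) [(?e, True)] (p @ r @ q)"
    using read_edge[OF bs move_R[OF x rel lc]] by simp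
  have pe: "is_path (Kx x) (p @ l @ q) [(?e, True)] (p @ r @ q)"
    using inner_edge[OF x rel component_words[OF x lc]] .
  have step: "homotopic D.T (base bs1 @ [x] @ base bs2) (base bs1 @ [x] @ base bs2)
     (read_path (whisker (flat bs1 @ [a x]) [d] ([a x] @ flat bs2))) [(?lab u [d] ?t, True)]"
  proof (cases s)
    case True
    then have "u = p @ l @ q" "?t = p @ r @ q" using e(2) by (auto simp: d src_def tgt_def)
    then show ?thesis using True D.label_edge[of "Elt x (loop_of x u [d] ?t)", OF _ w] loop_of_closed[OF x Cons.prems(2) t pd] x
      by (auto simp: d path_map_Cons read intro!: homotopic_refl simp del: is_path.simps)
  next
    case False
    then have u: "p @ r @ q = u" "p @ l @ q = ?t" using e(2) by (auto simp: d src_def tgt_def)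
    have pe': "is_path (Kx x) ?t [(?e, True)] u" using pe unfolding u .
    have "loop_of x ?t [(?e, True)] u \<otimes>\<^bsub>H x\<^esub> loop_of x u [d] ?t = loop_of x ?t ([(?e, True)] @ [d]) ?t"
      by (rule loop_of_mult[OF x t Cons.prems(2) t pe' pd])
    also have "\<dots> = loop_of x ?t [] ?t"
    proof (rule loop_of_homotopic[OF x t t])
      have "[d] = path_inv [(?e, True)]" using False by (simp add: d path_inv_single)
      then show "homotopic (Kx x) ?t ?t ([(?e, True)] @ [d]) []" using Px.inv_right[OF pe'] by simp
    qed
    also have "\<dots> = \<one>\<^bsub>H x\<^esub>" by (rule loop_of_Nil[OF x t])
    finally have "homotopic D.T (base bs1 @ [x] @ base bs2) (base bs1 @ [x] @ base bs2)
        [(?lab ?t [(?e, True)] u, False)] [(?lab u [d] ?t, True)]"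
      by (rule D.label_inverse[OF x loop_of_closed[OF x t Cons.prems(2) pe'] loop_of_closed[OF x Cons.prems(2) t pd] _ w])
    then show ?thesis using False u by (simp add: d path_map_Cons read path_inv_single)
  qed
  have "homotopic D.T (base bs1 @ [x] @ base bs2) (base bs1 @ [x] @ base bs2)
     (read_path (whisker (flat bs1 @ [a x]) ([d] @ \<pi>) ([a x] @ flat bs2)))
     ([(?lab u [d] ?t, True)] @ [(?lab ?t \<pi> v, True)])"
    unfolding whisker_simps(3) path_map_append by (rule D.T.homotopic_append2[OF step Cons.IH[OF e(3) t]])
  also have "homotopic D.T (base bs1 @ [x] @ base bs2) (base bs1 @ [x] @ base bs2)
     ([(?lab u [d] ?t, True)] @ [(?lab ?t \<pi> v, True)]) [(?lab u ([d] @ \<pi>) v, True)]"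
    using D.label_mult[OF x loop_of_closed[OF x Cons.prems(2) t pd] loop_of_closed[OF x t v e(3)] w]
      loop_of_mult[OF x Cons.prems(2) t v pd e(3)] by simp
  finally show ?case by simp
qed

lemma read_draw_element:
  assumes x: "x \<in> alphabet Q" and g: "g \<in> carrier (H x)" and w: "p \<in> words Q" "q \<in> words Q"
  shows "homotopic D.T (p @ [x] @ q) (p @ [x] @ q) (read_path (whisker p (draw_element x g) q)) [(D.label_edge p (Elt x g) q, True)]"
proof -
  let ?v = "p @ [x] @ q"
  let ?W = "[(D.label_edge p (Elt x \<one>\<^bsub>H x\<^esub>) q, True)]"
  have wrap: "read_path (whisker p (wrap x) q) = ?W"
    using read_edge[OF valid_letter_blocks[OF w(1)] valid_letter_blocks[OF w(2)] move_W[OF x]]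
    by (simp add: wrap_def path_map_Cons)
  have W: "homotopic D.T ?v ?v ?W []" by (rule D.label_one[OF x w])
  obtain \<pi> where \<pi>: "is_path (Kx x) (wx x) \<pi> (wx x)" "g = loop_class (Kx x) (wx x) \<pi>"
    using carrier_HE[OF x g] .
  let ?\<rho> = "SOME \<rho>. \<rho> \<in> g"
  have \<rho>: "is_path (Kx x) (wx x) ?\<rho> (wx x)" "loop_class (Kx x) (wx x) ?\<rho> = g"
    using draw_element(2,3)[OF x \<pi>(1)] unfolding \<pi>(2)[symmetric] by auto
  have inner: "homotopic D.T ?v ?v (read_path (whisker p (inner x ?\<rho>) q)) [(D.label_edge p (Elt x g) q, True)]"
    using read_inner[OF valid_letter_blocks[OF w(1)] valid_letter_blocks[OF w(2)] x \<rho>(1) wx_component[OF x]] \<rho>(2)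
    by (simp add: loop_of_base[OF x])
  have "homotopic D.T ?v ?v (read_path (whisker p (wrap x) q) @ read_path (whisker p (inner x ?\<rho>) q) @ path_inv (read_path (whisker p (wrap x) q)))
    ([] @ [(D.label_edge p (Elt x g) q, True)] @ path_inv [])"
    unfolding wrap by (rule D.T.homotopic_append2[OF W D.T.homotopic_append2[OF inner D.T.homotopic_inv[OF W]]])
  then show ?thesis by (simp add: draw_element_def wrapped_loop_def path_map_path_inv[symmetric])
qed

text \<open>
  The word \<open>p\<close> in front makes the induction over the letters of \<open>u\<close> possible: after the first letter has
  been treated it joins \<open>p\<close>.
\<close>

lemma read_draw:
  assumes "p \<in> words Q" "u \<in> words Q" "g \<in> carrier (D.G u)" "p @ u \<noteq> []"
  shows "homotopic D.T (p @ u) (p @ u) (read_path (whisker p (draw u g) [])) [(Inr (p @ u, D.id_word p @ g), True)]"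
  using assms
proof (induction u arbitrary: p g)
  case Nil
  then show ?case using homotopic_sym[OF D.loop_one[of p]] by (simp add: nonempty_words_def)
next
  case (Cons x u)
  then obtain h hs where g: "g = h # hs" "h \<in> carrier (H x)" "hs \<in> carrier (D.G u)"
    and x: "x \<in> alphabet Q" "u \<in> words Q"
    by (auto simp: D.carrier_G_Cons words_Cons)
  let ?v = "p @ [x] @ u"
  have v: "?v \<in> nonempty_words Q" using x Cons.prems by (simp add: nonempty_words_def words_Cons)
  have px: "p @ [x] \<in> words Q" "[x] \<in> words Q" using Cons.prems x by (auto simp: words_Cons)
  have h1: "[h] \<in> carrier (D.G [x])" using g by (auto simp: D.carrier_G_Cons)
  have 1: "homotopic D.T ?v ?v (read_path (whisker p (draw_element x h) u)) [(Inr (?v, D.id_word p @ [h] @ D.id_word u), True)]"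
    using read_draw_element[OF x(1) g(2) Cons.prems(1) x(2)] by simp
  have 2: "homotopic D.T ?v ?v (read_path (whisker (p @ [x]) (draw u hs) [])) [(Inr (?v, D.id_word p @ D.id_word [x] @ hs), True)]"
    using Cons.IH[OF px(1) x(2) g(3)] by (simp add: D.id_word_append D.id_word_Cons)
  have c: "D.id_word p @ [h] @ D.id_word u \<in> carrier (D.G ?v)" "D.id_word p @ D.id_word [x] @ hs \<in> carrier (D.G ?v)"
    by (intro D.carrier_G_append D.id_word_closed Cons.prems(1) h1 x(2) g(3) px(2))+
  have "(D.id_word p @ [h] @ D.id_word u) \<otimes>\<^bsub>D.G ?v\<^esub> (D.id_word p @ D.id_word [x] @ hs) = D.id_word p @ [h] @ hs"
    by (simp only: D.mult_append D.carrier_G_append D.id_word_closed Cons.prems(1) h1 x(2) g(3) px(2) D.one_mult)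
  from homotopic_trans[OF D.T.homotopic_append2[OF 1 2], of "[(Inr (?v, D.id_word p @ [h] @ hs), True)]"] D.loop_mult[OF v c, unfolded this]
  show ?case by (simp add: g)
qed

theorem composite_iso:
  assumes w: "w \<in> nonempty_words Q"
  shows "diagram_group C w \<cong> diagram_product H Q w"
proof -
  have w': "w \<in> words Q" "w \<noteq> []" using w by (auto simp: nonempty_words_def)
  have flat_w: "flat (letter_blocks w) = w" by simp
  have block_u: "u \<in> block_words" and parse_u: "parse u = letter_blocks u" if "u \<in> nonempty_words Q" for u
    using block_wordsI[OF valid_letter_blocks, of u] parse_flat[OF valid_letter_blocks, of u] that
    by (auto simp: nonempty_words_def)
  have "fundamental_group C.K w \<cong> fundamental_group D.T (base (parse w))"
  proof (rule fundamental_group_iso[OF complex_map_read complex_map_draw, where \<eta> = "\<lambda>u. expand (parse u)" and \<theta> = "\<lambda>_. []"])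
    fix u assume u: "u \<in> block_words"
    then obtain bs where "u = flat bs" "valid bs" "parse u = bs" by (rule block_wordsE)
    then show "is_path C.K (base (parse u)) (expand (parse u)) u" using is_path_expand by simp
  next
    fix e assume "e \<in> edges C.K" "initial C.K e \<in> block_words"
    from expand_natural[OF this]
    show "homotopic C.K (base (parse (initial C.K e))) (terminal C.K e)
        (expand (parse (initial C.K e)) @ [(e, True)]) (path_map draw_edge [(read_edge e, True)] @ expand (parse (terminal C.K e)))"
      by (simp add: path_map_Cons)
  next
    fix e assume e: "e \<in> edges D.T"
    show "homotopic D.T (base (parse (initial D.T e))) (terminal D.T e) ([] @ [(e, True)]) (read_path (draw_edge e) @ [])"
    proof (cases e)
      case (Inl e')
      obtain p s t q where e': "e' = (p, (s, t), q)" by (metis prod.exhaust)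
      have st: "p \<in> words Q" "(s, t) \<in> relations Q" "q \<in> words Q" using e Inl e' by auto
      have "p @ s @ q \<in> nonempty_words Q" using st Q.relation_words[OF st(2)] by (simp add: nonempty_words_def)
      then show ?thesis
        using read_edge[OF valid_letter_blocks[OF st(1)] valid_letter_blocks[OF st(3)] move_S[OF st(2)]] parse_u
          D.is_path_relation[OF st]
        by (auto simp: Inl e' path_map_Cons intro!: homotopic_refl simp del: is_path.simps)
    next
      case (Inr ug)
      obtain u g where ug: "ug = (u, g)" by force
      have u: "u \<in> nonempty_words Q" "g \<in> carrier (D.G u)" using e Inr ug by auto
      then have "homotopic D.T u u (read_path (draw u g)) [(Inr (u, g), True)]"
        using read_draw[of "[]" u g] by (simp add: nonempty_words_def)
      from homotopic_sym[OF this] show ?thesis using parse_u[OF u(1)] by (simp add: Inr ug)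
    qed
  next
    fix u assume "u \<in> verts D.T"
    then show "u \<in> block_words" "is_path D.T (base (parse u)) [] u" using block_u parse_u by auto
  qed (use block_u[OF w] parse_u[OF w] w' words_C(4) in auto)
  then show ?thesis
    using C.diagram_group_eq[OF w'(2)] parse_u[OF w] by (simp add: diagram_product_def complex_of_groups_pi1_def)
qed

end


section \<open>Renaming letters and replacing the groups\<close>

definition rename :: "('a \<Rightarrow> 'b) \<Rightarrow> 'a presentation \<Rightarrow> 'b presentation" where
  "rename f P = \<lparr>alphabet = f ` alphabet P, relations = map_prod (map f) (map f) ` relations P\<rparr>"

lemma rename_simps [simp]:
  "alphabet (rename f P) = f ` alphabet P"
  "relations (rename f P) = map_prod (map f) (map f) ` relations P"
  by (simp_all add: rename_def)

text \<open>
  A map of letters that preserves relations; it is used for a renaming and for its inverse.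
\<close>

locale presentation_morphism =
  fixes f :: "'a \<Rightarrow> 'b" and P :: "'a presentation" and R :: "'b presentation"
  assumes P: "semigroup_presentation P" and R: "semigroup_presentation R"
    and letter: "x \<in> alphabet P \<Longrightarrow> f x \<in> alphabet R"
    and relation: "(l, r) \<in> relations P \<Longrightarrow> (map f l, map f r) \<in> relations R"
begin

sublocale P: squier P by unfold_locales (rule P)
sublocale R: squier R by unfold_locales (rule R)

lemma words_map: "u \<in> words P \<Longrightarrow> map f u \<in> words R"
  using letter by (auto simp: words_def)

lemma complex_map_rename:
  "complex_map P.K UNIV R.K (map f) (\<lambda>(p, (l, r), q). [((map f p, (map f l, map f r), map f q), True)])"
    (is "complex_map _ _ _ _ ?f")
proof
  fix e assume e: "e \<in> edges P.K"
  obtain p l r q where e': "e = (p, (l, r), q)" by (metis prod.exhaust)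
  show "is_path R.K (map f (initial P.K e)) (?f e) (map f (terminal P.K e))"
    using is_path_edge[OF R.complex0, of "(map f p, (map f l, map f r), map f q)"] e words_map relation
    unfolding e' by (simp del: is_path.simps)
next
  fix c v assume c: "c \<in> cells P.K" "is_path P.K v c v"
  then obtain p z q l1 r1 l2 r2 where cell: "c = [((p, (l1, r1), z @ l2 @ q), True), ((p @ r1 @ z, (l2, r2), q), True)] @
         path_inv [((p @ l1 @ z, (l2, r2), q), True), ((p, (l1, r1), z @ r2 @ q), True)]"
    and w: "p \<in> words P" "z \<in> words P" "q \<in> words P" and rel: "(l1, r1) \<in> relations P" "(l2, r2) \<in> relations P"
    by (auto simp: squier_complex_def)
  have v: "v = (p @ l1 @ z) @ (l2 @ q)" using c(2) by (simp add: cell src_def)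
  have e1: "is_path R.K (map f (p @ l1 @ z)) [((map f p, (map f l1, map f r1), map f z), True)] (map f (p @ r1 @ z))"
    using is_path_edge[OF R.complex0, of "(map f p, (map f l1, map f r1), map f z)"] w words_map relation[OF rel(1)]
    by (simp del: is_path.simps)
  have e2: "is_path R.K (map f (l2 @ q)) [(([], (map f l2, map f r2), map f q), True)] (map f (r2 @ q))"
    using is_path_edge[OF R.complex0, of "([], (map f l2, map f r2), map f q)"] w words_map relation[OF rel(2)]
    by (simp del: is_path.simps)
  have "homotopic R.K (map f v) (map f v)
    ([((map f p, (map f l1, map f r1), map f (z @ l2 @ q)), True), ((map f (p @ r1 @ z), (map f l2, map f r2), map f q), True)] @
     path_inv [((map f (p @ l1 @ z), (map f l2, map f r2), map f q), True), ((map f p, (map f l1, map f r1), map f (z @ r2 @ q)), True)]) []"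
    using R.homotopic_imp_null[OF R.interchange[OF e1 e2]] by (simp add: v)
  then show "homotopic R.K (map f v) (map f v) (path_map ?f c) []"
    unfolding cell path_map_append path_map_path_inv by (simp add: path_map_Cons)
qed (use P.complex0 R.complex0 words_map in auto)

end

lemma semigroup_presentation_rename:
  assumes P: "semigroup_presentation P" and inj: "inj_on f (alphabet P)"
  shows "semigroup_presentation (rename f P)"
  unfolding semigroup_presentation_def
proof (intro conjI allI impI subsetI)
  interpret squier P by unfold_locales fact
  fix lr assume "lr \<in> relations (rename f P)"
  then show "lr \<in> nonempty_words (rename f P) \<times> nonempty_words (rename f P)"
    using relation_words by (fastforce simp: nonempty_words_def words_def)
next
  interpret squier P by unfold_locales fact
  fix l r assume "(l, r) \<in> relations (rename f P)"
  then obtain u v where uv: "(u, v) \<in> relations P" "l = map f u" "r = map f v" by auto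
  show "(r, l) \<notin> relations (rename f P)"
  proof
    assume "(r, l) \<in> relations (rename f P)"
    then obtain u' v' where uv': "(v', u') \<in> relations P" "l = map f u'" "r = map f v'" by auto
    have "u = u'" "v = v'"
      using uv uv' relation_words[OF uv(1)] relation_words[OF uv'(1)] inj
      by (auto intro!: map_inj_on[of f] elim!: inj_on_subset simp: words_def)
    then show False using uv uv' P by (auto simp: semigroup_presentation_def)
  qed
qed

lemma presentation_morphism_rename:
  "semigroup_presentation P \<Longrightarrow> inj_on f (alphabet P) \<Longrightarrow> presentation_morphism f P (rename f P)"
  by unfold_locales (auto simp: semigroup_presentation_rename intro: rev_image_eqI)

lemma map_inv_into: "inj_on f A \<Longrightarrow> u \<in> lists A \<Longrightarrow> map (inv_into A f) (map f u) = u"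
  by (induction u) auto

lemma presentation_morphism_rename_inv:
  assumes "semigroup_presentation P" "inj_on f (alphabet P)"
  shows "presentation_morphism (inv_into (alphabet P) f) (rename f P) P"
proof
  interpret squier P by unfold_locales fact
  fix l r assume "(l, r) \<in> relations (rename f P)"
  then obtain u v where uv: "(u, v) \<in> relations P" "l = map f u" "r = map f v" by auto
  then have "u \<in> lists (alphabet P)" "v \<in> lists (alphabet P)" using relation_words[OF uv(1)] by (auto simp: words_def)
  then show "(map (inv_into (alphabet P) f) l, map (inv_into (alphabet P) f) r) \<in> relations P"
    using uv(1) by (simp add: uv(2,3) map_inv_into[OF assms(2)] del: map_map)
qed (use assms semigroup_presentation_rename in auto)

lemma diagram_group_rename:
  assumes P: "semigroup_presentation P" and inj: "inj_on f (alphabet P)" and w: "w \<in> nonempty_words P"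
  shows "diagram_group P w \<cong> diagram_group (rename f P) (map f w)"
proof -
  let ?g = "inv_into (alphabet P) f"
  interpret F: presentation_morphism f P "rename f P" using presentation_morphism_rename[OF P inj] .
  interpret G: presentation_morphism ?g "rename f P" P using presentation_morphism_rename_inv[OF P inj] .
  have gf: "map ?g (map f u) = u" if "u \<in> words P" for u
    using that unfolding words_def by (rule map_inv_into[OF inj])
  have fg: "map f (map ?g u) = u" if "u \<in> words (rename f P)" for u
    using that by (induction u) (auto simp: words_def f_inv_into_f)
  have "fundamental_group F.P.K w \<cong> fundamental_group F.R.K (map f w)"
  proof (rule fundamental_group_iso[OF F.complex_map_rename G.complex_map_rename, where \<eta> = "\<lambda>_. []" and \<theta> = "\<lambda>_. []"])
    fix e assume e: "e \<in> edges F.P.K"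
    obtain p l r q where e': "e = (p, (l, r), q)" by (metis prod.exhaust)
    have "l \<in> words P" "r \<in> words P" "p \<in> words P" "q \<in> words P" using e e' F.P.relation_words by auto
    then show "homotopic F.P.K (map ?g (map f (initial F.P.K e))) (terminal F.P.K e) ([] @ [(e, True)])
       (path_map (\<lambda>(p, (l, r), q). [((map ?g p, (map ?g l, map ?g r), map ?g q), True)])
         ((\<lambda>(p, (l, r), q). [((map f p, (map f l, map f r), map f q), True)]) e) @ [])"
      using is_path_edge[OF F.P.complex0 e] gf
      by (auto simp: e' path_map_Cons intro!: homotopic_refl simp del: is_path.simps map_map)
  next
    fix e assume e: "e \<in> edges F.R.K"
    obtain p l r q where e': "e = (p, (l, r), q)" by (metis prod.exhaust)
    have "l \<in> words (rename f P)" "r \<in> words (rename f P)" "p \<in> words (rename f P)" "q \<in> words (rename f P)"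
      using e F.R.relation_words unfolding e' squier_complex0_simps by blast+
    then show "homotopic F.R.K (map f (map ?g (initial F.R.K e))) (terminal F.R.K e) ([] @ [(e, True)])
       (path_map (\<lambda>(p, (l, r), q). [((map f p, (map f l, map f r), map f q), True)])
         ((\<lambda>(p, (l, r), q). [((map ?g p, (map ?g l, map ?g r), map ?g q), True)]) e) @ [])"
      using is_path_edge[OF F.R.complex0 e] fg
      by (auto simp: e' path_map_Cons intro!: homotopic_refl simp del: is_path.simps map_map rename_simps)
  qed (use gf fg w in \<open>auto simp: nonempty_words_def simp del: map_map rename_simps\<close>)
  then show ?thesis using w F.P.diagram_group_eq F.R.diagram_group_eq by (auto simp: nonempty_words_def)
qed

locale group_family_morphism = presentation_morphism f P R +
  D: group_family P H + D': group_family R H'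
  for f :: "'a \<Rightarrow> 'b" and P R and H :: "'a \<Rightarrow> 'g monoid" and H' :: "'b \<Rightarrow> 'h monoid" +
  fixes \<phi> :: "'a \<Rightarrow> 'g \<Rightarrow> 'h"
  assumes \<phi>: "x \<in> alphabet P \<Longrightarrow> \<phi> x \<in> hom (H x) (H' (f x))"
begin

definition map_tuple :: "'a list \<Rightarrow> 'g list \<Rightarrow> 'h list" where
  "map_tuple u gs = map2 \<phi> u gs"

lemma map_tuple_append: "length g = length u \<Longrightarrow> map_tuple (u @ v) (g @ h) = map_tuple u g @ map_tuple v h"
  by (simp add: map_tuple_def)

lemma map_tuple_closed: "u \<in> words P \<Longrightarrow> g \<in> carrier (D.G u) \<Longrightarrow> map_tuple u g \<in> carrier (D'.G (map f u))"
proof (induction u arbitrary: g)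
  case (Cons x u)
  then show ?case using \<phi>[of x]
    by (auto simp: map_tuple_def D.carrier_G_Cons D'.carrier_G_Cons words_Cons hom_def)
qed (simp add: map_tuple_def)

lemma map_tuple_mult:
  "u \<in> words P \<Longrightarrow> g \<in> carrier (D.G u) \<Longrightarrow> h \<in> carrier (D.G u) \<Longrightarrow>
   map_tuple u (g \<otimes>\<^bsub>D.G u\<^esub> h) = map_tuple u g \<otimes>\<^bsub>D'.G (map f u)\<^esub> map_tuple u h"
proof (induction u arbitrary: g h)
  case Nil
  then show ?case using D.one_mult(1)[of "[]" "[]"] D'.one_mult(1)[of "[]" "[]"] by (simp add: map_tuple_def)
next
  case (Cons x u)
  then obtain g0 g' h0 h' where g: "g = g0 # g'" "g0 \<in> carrier (H x)" "g' \<in> carrier (D.G u)"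
    and h: "h = h0 # h'" "h0 \<in> carrier (H x)" "h' \<in> carrier (D.G u)"
    and x: "x \<in> alphabet P" "u \<in> words P"
    by (auto simp: D.carrier_G_Cons words_Cons)
  have "\<phi> x g0 \<in> carrier (H' (f x))" "\<phi> x h0 \<in> carrier (H' (f x))" "\<phi> x (g0 \<otimes>\<^bsub>H x\<^esub> h0) = \<phi> x g0 \<otimes>\<^bsub>H' (f x)\<^esub> \<phi> x h0"
    using \<phi>[OF x(1)] g h by (auto simp: hom_def)
  then show ?case
    using Cons.IH[OF x(2) g(3) h(3)] map_tuple_closed[OF x(2) g(3)] map_tuple_closed[OF x(2) h(3)]
    by (simp add: g h D.mult_Cons D'.mult_Cons map_tuple_def)
qed

lemma map_tuple_id: "u \<in> words P \<Longrightarrow> map_tuple u (D.id_word u) = D'.id_word (map f u)"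
proof (induction u)
  case (Cons x u)
  then show ?case using hom_one[OF \<phi> D.H D'.H] letter
    by (simp add: map_tuple_def D.id_word_Cons D'.id_word_Cons words_Cons)
qed (simp add: map_tuple_def)

fun map_edge :: "'a squier_edge + 'a list \<times> 'g list \<Rightarrow> 'b squier_edge + 'b list \<times> 'h list" where
  "map_edge (Inl (p, (l, r), q)) = Inl (map f p, (map f l, map f r), map f q)"
| "map_edge (Inr (u, g)) = Inr (map f u, map_tuple u g)"

lemma map_tuple_context:
  assumes w: "p \<in> words P" "s \<in> words P" "q \<in> words P" and "g \<in> carrier (D.G p)" "h \<in> carrier (D.G q)"
  shows "map_tuple (p @ s @ q) (g @ D.id_word s @ h) = map_tuple p g @ D'.id_word (map f s) @ map_tuple q h"
  using D.length_carrier_G[OF D.id_word_closed[OF w(2)]] D.length_carrier_G[OF assms(4)] map_tuple_id[OF w(2)]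
  by (simp add: map_tuple_append)

text \<open>
  Edges go to edges, and each 2-cell to a 2-cell of the same kind.
\<close>

lemma complex_map_product: "complex_map D.T UNIV D'.T (map f) (\<lambda>e. [(map_edge e, True)])"
proof
  fix c v assume c: "c \<in> cells D.T" and path: "is_path D.T v c v"
  have ends: "v = src D.T (hd c)" using path D.complex_T c by (cases c) (auto simp: is_complex2_def)
  let ?F = "path_map (\<lambda>e. [(map_edge e, True)])"
  from c consider (base) c' where "c' \<in> cells (squier_complex P)" "c = map (map_prod Inl id) c'"
    | (mult) u g h where "u \<in> nonempty_words P" "g \<in> carrier (D.G u)" "h \<in> carrier (D.G u)"
        "c = [(Inr (u, g), True), (Inr (u, h), True), (Inr (u, g \<otimes>\<^bsub>D.G u\<^esub> h), False)]"
    | (slide) p s t q g h where "p \<in> words P" "(s, t) \<in> relations P" "q \<in> words P"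
        "g \<in> carrier (D.G p)" "h \<in> carrier (D.G q)"
        "c = [(Inl (p, (s, t), q), False), (Inr (p @ s @ q, g @ D.id_word s @ h), True),
          (Inl (p, (s, t), q), True), (Inr (p @ t @ q, g @ D.id_word t @ h), False)]"
    unfolding D.cells_T by blast
  then show "homotopic D'.T (map f v) (map f v) (?F c) []"
  proof cases
    case base
    then obtain p z q l1 r1 l2 r2 where cell: "c' = [((p, (l1, r1), z @ l2 @ q), True), ((p @ r1 @ z, (l2, r2), q), True)] @
         path_inv [((p @ l1 @ z, (l2, r2), q), True), ((p, (l1, r1), z @ r2 @ q), True)]"
      and w: "p \<in> words P" "z \<in> words P" "q \<in> words P" and rel: "(l1, r1) \<in> relations P" "(l2, r2) \<in> relations P"
      by (auto simp: squier_complex_def)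
    have v: "v = p @ l1 @ z @ l2 @ q" using ends by (simp add: base cell src_def)
    from D'.T.homotopic_imp_null[OF D'.label_interchange[of "Rel (map f l1) (map f r1)" "Rel (map f l2) (map f r2)" "map f p" "map f z" "map f q"]]
    have "homotopic D'.T (map f v) (map f v) ([(Inl (map f p, (map f l1, map f r1), map f (z @ l2 @ q)), True), (Inl (map f (p @ r1 @ z), (map f l2, map f r2), map f q), True)] @
      path_inv [(Inl (map f (p @ l1 @ z), (map f l2, map f r2), map f q), True), (Inl (map f p, (map f l1, map f r1), map f (z @ r2 @ q)), True)]) []"
      using relation rel w words_map by (simp add: v)
    then show ?thesis
      by (simp add: base cell path_map_Cons path_inv_def edge_inv_def)
  next
    case mult
    then have u: "u \<in> words P" "v = u" using ends by (auto simp: nonempty_words_def src_def)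
    have fu: "map f u \<in> nonempty_words R" using mult(1) words_map by (auto simp: nonempty_words_def)
    show ?thesis
      using D'.T.homotopic_imp_null[OF D'.loop_mult[OF fu map_tuple_closed[OF u(1) mult(2)] map_tuple_closed[OF u(1) mult(3)]]]
      by (simp add: mult(4) u path_map_Cons map_tuple_mult[OF u(1) mult(2,3)])
  next
    case slide
    have v: "v = p @ t @ q" using ends by (simp add: slide src_def)
    note st = P.relation_words[OF slide(2)]
    have e: "is_path D'.T (map f (p @ s @ q)) [(Inl (map f p, (map f s, map f t), map f q), True)] (map f (p @ t @ q))"
      using D'.is_path_relation[OF words_map[OF slide(1)] relation[OF slide(2)] words_map[OF slide(3)]]
      by (simp del: is_path.simps)
    have sl: "homotopic D'.T (map f (p @ s @ q)) (map f (p @ t @ q))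
       ([(Inr (map f (p @ s @ q), map_tuple (p @ s @ q) (g @ D.id_word s @ h)), True)] @ [(Inl (map f p, (map f s, map f t), map f q), True)])
       ([(Inl (map f p, (map f s, map f t), map f q), True)] @ [(Inr (map f (p @ t @ q), map_tuple (p @ t @ q) (g @ D.id_word t @ h)), True)])"
      using D'.edge_slide[OF words_map[OF slide(1)] relation[OF slide(2)] words_map[OF slide(3)]
        map_tuple_closed[OF slide(1,4)] map_tuple_closed[OF slide(3,5)]]
        map_tuple_context[OF slide(1) st(1) slide(3,4,5)] map_tuple_context[OF slide(1) st(2) slide(3,4,5)]
      by simp
    have tw: "p @ t @ q \<in> words P" "map f (p @ t @ q) \<in> nonempty_words R"
      using slide st words_map by (auto simp: nonempty_words_def)
    have "g @ D.id_word t @ h \<in> carrier (D.G (p @ t @ q))"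
      using slide st by (intro D.carrier_G_append D.id_word_closed)
    from D'.is_path_loop[OF tw(2) map_tuple_closed[OF tw(1) this]]
    have h: "is_path D'.T (map f (p @ t @ q)) [(Inr (map f (p @ t @ q), map_tuple (p @ t @ q) (g @ D.id_word t @ h)), True)] (map f (p @ t @ q))" .
    from D'.T.homotopic_imp_null[OF D'.T.homotopic_conjugate[OF sl e h]] show ?thesis
      by (simp add: v slide(6) path_map_Cons path_inv_single)
  qed
next
  fix e assume e: "e \<in> edges D.T"
  show "is_path D'.T (map f (initial D.T e)) [(map_edge e, True)] (map f (terminal D.T e))"
  proof (cases e)
    case (Inl e')
    obtain p s t q where "e' = (p, (s, t), q)" by (metis prod.exhaust)
    with e Inl show ?thesis using D'.is_path_relation words_map relation by (auto simp del: is_path.simps)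
  next
    case (Inr ug)
    obtain u g where ug: "ug = (u, g)" by force
    have u: "u \<in> words P" "u \<noteq> []" "g \<in> carrier (D.G u)" using e Inr ug by (auto simp: nonempty_words_def)
    then have "map f u \<in> nonempty_words R" using words_map by (simp add: nonempty_words_def)
    from D'.is_path_loop[OF this map_tuple_closed[OF u(1,3)]] show ?thesis by (simp add: Inr ug del: is_path.simps)
  qed
next
  fix v assume "v \<in> verts D.T"
  then show "map f v \<in> verts D'.T" using words_map by (auto simp: nonempty_words_def)
qed (use D.complex_T D'.complex_T in auto)

end

lemma diagram_product_rename:
  assumes Q: "semigroup_presentation Q" and inj: "inj_on f (alphabet Q)" and w: "w \<in> nonempty_words Q"
    and H: "\<And>x. x \<in> alphabet Q \<Longrightarrow> group (H x)" and H': "\<And>x. x \<in> alphabet Q \<Longrightarrow> group (H' (f x))"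
    and iso: "\<And>x. x \<in> alphabet Q \<Longrightarrow> H x \<cong> H' (f x)"
  shows "diagram_product H Q w \<cong> diagram_product H' (rename f Q) (map f w)"
proof -
  let ?g = "inv_into (alphabet Q) f"
  have "\<forall>x\<in>alphabet Q. \<exists>h. h \<in> Group.iso (H x) (H' (f x))"
    using iso unfolding is_iso_def by blast
  from bchoice[OF this] obtain \<phi> where \<phi>: "\<And>x. x \<in> alphabet Q \<Longrightarrow> \<phi> x \<in> Group.iso (H x) (H' (f x))"
    by blast
  define \<psi> where "\<psi> y = inv_into (carrier (H (?g y))) (\<phi> (?g y))" for y
  have \<psi>: "\<psi> (f x) \<in> hom (H' (f x)) (H (?g (f x)))" if "x \<in> alphabet Q" for x
    using group.iso_set_sym[OF H[OF that] \<phi>[OF that]] inj that by (simp add: \<psi>_def iso_def)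
  have \<psi>\<phi>: "\<psi> (f x) (\<phi> x h) = h" if "x \<in> alphabet Q" "h \<in> carrier (H x)" for x h
    using \<phi>[OF that(1)] that inj by (simp add: \<psi>_def iso_def bij_betw_def)
  have \<phi>\<psi>: "\<phi> x (\<psi> (f x) h) = h" if "x \<in> alphabet Q" "h \<in> carrier (H' (f x))" for x h
    using \<phi>[OF that(1)] that inj by (auto simp: \<psi>_def iso_def bij_betw_def f_inv_into_f)
  interpret F: group_family_morphism f Q "rename f Q" H H' \<phi>
    by (intro group_family_morphism.intro presentation_morphism_rename group_family.intro
        semigroup_presentation_rename group_family_morphism_axioms.intro)
      (use Q inj H H' \<phi> in \<open>auto simp: iso_def\<close>)
  interpret G: group_family_morphism ?g "rename f Q" Q H' H \<psi>
    by (intro group_family_morphism.intro presentation_morphism_rename_inv group_family.intro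
        semigroup_presentation_rename group_family_morphism_axioms.intro)
      (use Q inj H H' \<psi> in auto)
  have gf: "map ?g (map f u) = u" if "u \<in> words Q" for u
    using that unfolding words_def by (rule map_inv_into[OF inj])
  have fg: "map f (map ?g u) = u" if "u \<in> words (rename f Q)" for u
    using that by (induction u) (auto simp: words_def f_inv_into_f)
  have gf_tuple: "G.map_tuple (map f u) (F.map_tuple u h) = h" if "u \<in> words Q" "h \<in> carrier (F.D.G u)" for u h
    using that
    by (induction u arbitrary: h)
      (auto simp: F.map_tuple_def G.map_tuple_def F.D.carrier_G_Cons words_Cons \<psi>\<phi>)
  have fg_tuple: "F.map_tuple (map ?g u) (G.map_tuple u h) = h" if "u \<in> words (rename f Q)" "h \<in> carrier (F.D'.G u)" for u h
    using that
    by (induction u arbitrary: h)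
      (auto simp: F.map_tuple_def G.map_tuple_def F.D'.carrier_G_Cons words_Cons \<phi>\<psi> inj)
  have "fundamental_group F.D.T w \<cong> fundamental_group F.D'.T (map f w)"
  proof (rule fundamental_group_iso[OF F.complex_map_product G.complex_map_product, where \<eta> = "\<lambda>_. []" and \<theta> = "\<lambda>_. []"])
    fix e assume e: "e \<in> edges F.D.T"
    have "G.map_edge (F.map_edge e) = e"
      using e F.P.relation_words gf gf_tuple by (auto simp: nonempty_words_def simp del: map_map)
    moreover have "map ?g (map f (initial F.D.T e)) = initial F.D.T e"
      using F.D.complex_T e gf by (auto simp: is_complex2_def nonempty_words_def simp del: map_map)
    ultimately show "homotopic F.D.T (map ?g (map f (initial F.D.T e))) (terminal F.D.T e) ([] @ [(e, True)])
       (path_map (\<lambda>e. [(G.map_edge e, True)]) [(F.map_edge e, True)] @ [])"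
      using is_path_edge[OF F.D.complex_T e] by (auto simp: path_map_Cons intro!: homotopic_refl simp del: is_path.simps map_map)
  next
    fix e assume e: "e \<in> edges F.D'.T"
    have "F.map_edge (G.map_edge e) = e"
      using e F.R.relation_words fg fg_tuple by (auto simp: nonempty_words_def simp del: map_map rename_simps)
    moreover have "map f (map ?g (initial F.D'.T e)) = initial F.D'.T e"
      using F.D'.complex_T e fg by (auto simp: is_complex2_def nonempty_words_def simp del: map_map rename_simps)
    ultimately show "homotopic F.D'.T (map f (map ?g (initial F.D'.T e))) (terminal F.D'.T e) ([] @ [(e, True)])
       (path_map (\<lambda>e. [(F.map_edge e, True)]) [(G.map_edge e, True)] @ [])"
      using is_path_edge[OF F.D'.complex_T e] by (auto simp: path_map_Cons intro!: homotopic_refl simp del: is_path.simps map_map)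
  qed (use gf fg w in \<open>auto simp: nonempty_words_def simp del: map_map rename_simps\<close>)
  then show ?thesis by (simp add: diagram_product_def complex_of_groups_pi1_def)
qed

section \<open>Diagram products of diagram groups\<close>

text \<open>
  The three summands of the type keep \<open>X\<close>, the letters \<open>(x, b)\<close> of the copies of \<open>\<Sigma>\<^sub>x\<close> and the markers
  \<open>a\<^sub>x\<close> apart.
\<close>

theorem is_diagram_group_diagram_product:
  fixes Q :: "'a presentation" and H :: "'a \<Rightarrow> 'g monoid"
  assumes Q: "semigroup_presentation Q" and w: "w \<in> nonempty_words Q"
    and H: "\<And>x. x \<in> alphabet Q \<Longrightarrow> is_diagram_group TYPE('b) (H x)"
  shows "is_diagram_group TYPE('a + 'a \<times> 'b + 'a) (diagram_product H Q w)"
proof -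
  obtain P :: "'a \<Rightarrow> 'b presentation" and wx
    where pres: "\<And>x. x \<in> alphabet Q \<Longrightarrow> semigroup_presentation (P x)"
      "\<And>x. x \<in> alphabet Q \<Longrightarrow> wx x \<in> nonempty_words (P x)"
      "\<And>x. x \<in> alphabet Q \<Longrightarrow> H x \<cong> diagram_group (P x) (wx x)"
    using H unfolding is_diagram_group_def by metis
  have group_H: "\<And>x. x \<in> alphabet Q \<Longrightarrow> group (H x)" using H by (simp add: is_diagram_group_def)
  define Q' :: "('a + 'a \<times> 'b + 'a) presentation" where "Q' = rename Inl Q"
  \<comment> \<open>\<open>P'\<close>, \<open>w'\<close> and \<open>a\<close> are only evaluated at letters \<open>Inl x\<close>, where \<open>projl\<close> recovers \<open>x\<close>\<close>
  define j :: "'a + 'a \<times> 'b + 'a \<Rightarrow> 'b \<Rightarrow> 'a + 'a \<times> 'b + 'a" where "j y b = Inr (Inl (projl y, b))" for y b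
  define P' where "P' y = rename (j y) (P (projl y))" for y
  define w' where "w' y = map (j y) (wx (projl y))" for y
  define a :: "'a + 'a \<times> 'b + 'a \<Rightarrow> 'a + 'a \<times> 'b + 'a" where "a y = Inr (Inr (projl y))" for y
  have inj_j: "inj_on (j y) A" for y A by (auto simp: inj_on_def j_def)
  have Q': "semigroup_presentation Q'" unfolding Q'_def by (rule semigroup_presentation_rename[OF Q]) simp
  interpret S: composite Q' P' w' a
  proof
    fix y assume "y \<in> alphabet Q'"
    then obtain x where x: "x \<in> alphabet Q" "y = Inl x" by (auto simp: Q'_def)
    show "semigroup_presentation (P' y)" using semigroup_presentation_rename[OF pres(1)[OF x(1)] inj_j] by (simp add: P'_def x)
    show "w' y \<in> nonempty_words (P' y)" using pres(2)[OF x(1)] by (auto simp: w'_def P'_def x nonempty_words_def words_def)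
    show "alphabet Q' \<inter> alphabet (P' y) = {}" "a ` alphabet Q' \<inter> alphabet (P' y) = {}"
      by (auto simp: Q'_def P'_def j_def a_def)
  qed (use Q' in \<open>auto simp: Q'_def P'_def a_def j_def inj_on_def disjoint_family_on_def\<close>)
  have iso: "H x \<cong> diagram_group (P' (Inl x)) (w' (Inl x))" if "x \<in> alphabet Q" for x
    using iso_trans[OF pres(3)[OF that] diagram_group_rename[OF pres(1)[OF that] inj_j pres(2)[OF that]], of "Inl x"]
    by (simp add: P'_def w'_def)
  have grp: "group (diagram_group (P' (Inl x)) (w' (Inl x)))" if "x \<in> alphabet Q" for x
    by (rule S.group_H) (use that in \<open>simp add: Q'_def\<close>)
  have 1: "diagram_product H Q w \<cong> diagram_product (\<lambda>y. diagram_group (P' y) (w' y)) Q' (map Inl w)"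
    unfolding Q'_def by (rule diagram_product_rename[OF Q _ w]) (simp_all add: group_H grp iso)
  have w'': "map Inl w \<in> nonempty_words Q'" using w by (auto simp: Q'_def nonempty_words_def words_def)
  have wC: "map Inl w \<in> nonempty_words S.C" using w'' S.words_C(4) by (auto simp: nonempty_words_def)
  have "group (diagram_group S.C (map Inl w))"
    unfolding diagram_group_def using S.C.complex_squier_complex wC by (intro group_fundamental_group) auto
  then have "diagram_product (\<lambda>y. diagram_group (P' y) (w' y)) Q' (map Inl w) \<cong> diagram_group S.C (map Inl w)"
    using group.iso_sym[OF _ S.composite_iso[OF w'']] by blast
  with 1 have "diagram_product H Q w \<cong> diagram_group S.C (map Inl w)" by (rule iso_trans)
  moreover have "group (diagram_product H Q w)"
  proof -
    interpret D0: group_family Q H by (rule group_family.intro[OF Q group_H])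
    show ?thesis unfolding diagram_product_def complex_of_groups_pi1_def
      using D0.complex_T w by (intro group_fundamental_group) auto
  qed
  ultimately show ?thesis unfolding is_diagram_group_def using S.semigroup_presentation_C wC by blast
qed

theorem theorem4:
  fixes Q :: "'a presentation" and w :: "'a list"
  assumes "semigroup_presentation Q" and "w \<in> nonempty_words Q"
  shows
    "(\<forall>(P :: 'a \<Rightarrow> 'a presentation) (wx :: 'a \<Rightarrow> 'a list) (a :: 'a \<Rightarrow> 'a).
        (\<forall>x\<in>alphabet Q. semigroup_presentation (P x) \<and> wx x \<in> nonempty_words (P x)) \<and>
        inj_on a (alphabet Q) \<and>
        alphabet Q \<inter> a ` alphabet Q = {} \<and>
        (\<forall>x\<in>alphabet Q. alphabet Q \<inter> alphabet (P x) = {}) \<and>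
        (\<forall>x\<in>alphabet Q. a ` alphabet Q \<inter> alphabet (P x) = {}) \<and>
        disjoint_family_on (\<lambda>x. alphabet (P x)) (alphabet Q) \<longrightarrow>
        diagram_group (composite_presentation Q P wx a) w
          \<cong> diagram_product (\<lambda>x. diagram_group (P x) (wx x)) Q w) \<and>
     (\<forall>H :: 'a \<Rightarrow> 'g monoid.
        (\<forall>x\<in>alphabet Q. is_diagram_group TYPE('b) (H x)) \<longrightarrow>
        is_diagram_group TYPE('a + 'a \<times> 'b + 'a) (diagram_product H Q w))"
proof (intro conjI allI impI)
  fix P :: "'a \<Rightarrow> 'a presentation" and wx :: "'a \<Rightarrow> 'a list" and a :: "'a \<Rightarrow> 'a"
  assume *: "(\<forall>x\<in>alphabet Q. semigroup_presentation (P x) \<and> wx x \<in> nonempty_words (P x)) \<and>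
        inj_on a (alphabet Q) \<and>
        alphabet Q \<inter> a ` alphabet Q = {} \<and>
        (\<forall>x\<in>alphabet Q. alphabet Q \<inter> alphabet (P x) = {}) \<and>
        (\<forall>x\<in>alphabet Q. a ` alphabet Q \<inter> alphabet (P x) = {}) \<and>
        disjoint_family_on (\<lambda>x. alphabet (P x)) (alphabet Q)"
  interpret composite Q P wx a
    by (rule composite.intro) (use * assms(1) in auto)
  show "diagram_group (composite_presentation Q P wx a) w
          \<cong> diagram_product (\<lambda>x. diagram_group (P x) (wx x)) Q w"
    by (rule composite_iso[OF assms(2)])
next
  fix H :: "'a \<Rightarrow> 'g monoid"
  assume "\<forall>x\<in>alphabet Q. is_diagram_group TYPE('b) (H x)"
  then show "is_diagram_group TYPE('a + 'a \<times> 'b + 'a) (diagram_product H Q w)"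
    by (intro is_diagram_group_diagram_product[OF assms]) blast
qed

end
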